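(* Fix an integer $n\geq 6$. Let $A_n$ be the alternating group on $n$ letters and let $\alpha,\beta\in A_n$ be nontrivial elements. Assume that $\eta(\alpha^{A_n}\beta^{A_n})<5$. Then either $\alpha$ or $\beta$ is a product of (pairwise disjoint) transpositions. Moreover, assuming that $\alpha$ is a product of (pairwise disjoint) transpositions, one of the following holds: (i) $n$ is a multiple of $4$, $\alpha$ is the product of $\frac{n}{2}$ disjoint $2$-cycles, $\beta$ is a $3$-cycle, and $\eta(\alpha^{A_n}\beta^{A_n})=2$; (ii) $n-1$ is a multiple of $4$, $\alpha$ is the product of $\frac{n-1}{2}$ disjoint $2$-cycles, $\beta$ is a $3$-cycle, and $\eta(\alpha^{A_n}\beta^{A_n})=4$.
   Context: For a finite group $G$ and $a,b\in G$, $a^G=\{g^{-1}ag : g\in G\}$ denotes the conjugacy class of $a$ in $G$, and $a^Gb^G=\{xy : x\in a^G,\ y\in b^G\}$. The set $a^Gb^G$ is a union of conjugacy classes of $G$; $\eta(a^Gb^G)$ denotes the number of distinct conjugacy classes of $G$ contained in it. (Since $a^Gb^G=b^Ga^G$, the roles of $\alpha$ and $\beta$ are symmetric.) *)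

theory Defs
  imports "HOL-Algebra.Sym_Groups"
begin

definition conj_class :: "('a, 'b) monoid_scheme \<Rightarrow> 'a \<Rightarrow> 'a set" where
  "conj_class G a = {inv\<^bsub>G\<^esub> g \<otimes>\<^bsub>G\<^esub> a \<otimes>\<^bsub>G\<^esub> g |g. g \<in> carrier G}"

definition conj_classes :: "('a, 'b) monoid_scheme \<Rightarrow> 'a set set" where
  "conj_classes G = conj_class G ` carrier G"

text \<open>The number of conjugacy classes contained in X; meaningful when G is finite.\<close>

definition eta :: "('a, 'b) monoid_scheme \<Rightarrow> 'a set \<Rightarrow> nat" where
  "eta G X = card {C \<in> conj_classes G. C \<subseteq> X}"

text \<open>
  The map p is the product of k pairwise disjoint 2-cycles. Distinctness of the concatenated
  list says both that each factor is a genuine 2-cycle and that the supports are disjoint.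
\<close>

definition prod_disjoint_transpositions :: "nat \<Rightarrow> ('a \<Rightarrow> 'a) \<Rightarrow> bool" where
  "prod_disjoint_transpositions k p \<longleftrightarrow>
     (\<exists>css. length css = k \<and> (\<forall>cs \<in> set css. length cs = 2) \<and> distinct (concat css) \<and>
            p = foldr (\<circ>) (map cycle_of_list css) id)"

end

theory Submission
  imports Defs "HOL-Library.Multiset"
begin

text \<open>
  Conjugacy classes are separated by cycle types, so it suffices to exhibit five cycle types among
  the products of conjugates of the two permutations. If two permutations move sets that meet in a
  single point, their product fuses the two cycles through that point. Hence a small pair of
  permutations \<open>a\<close>, \<open>b\<close> with a common marked point can be enlarged by gluing arbitrary permutations
  at the marked point, and the marked cycle of \<open>a \<circ> b\<close> grows by an amount that depends only on what
  is glued. About fifty small pairs, each with five product types that remain different under such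
  growth, reach all pairs of nontrivial even cycle types on at least seven points except a
  3-cycle with an involution having at most one fixed point. On six points, four product types may
  be all there are, but then the type (5,1) is one of them and accounts for two classes. If a
  factor commutes with an odd permutation, every product type occurs in the product of classes of
  the alternating group; otherwise both factors have distinct odd cycle lengths, and the witnesses
  are chosen to work for both relative parities. For the exceptional pairs the product types are
  computed directly.
\<close>

section \<open>Cycle types\<close>

text \<open>The gluing takes place on the outer sides: the enlarged pair is
  \<open>\<sigma> \<circ> a\<close> and \<open>b \<circ> \<tau>\<close>, where
  \<open>\<sigma>\<close> and \<open>\<tau>\<close> move at most the mark and the new points.
  Conjugation by \<open>\<tau>\<close> turns the product into
  \<open>(\<tau> \<circ> \<sigma>) \<circ> (a \<circ> b)\<close>, whose two factors again share only
  the mark. The cycles of \<open>\<tau> \<circ> \<sigma>\<close> are never determined, but they are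
  the same for all witnesses of a small pair: one unknown constant is added to each marked cycle,
  one unknown multiset to the rest. Different product types could only collide when the enlarged
  marked cycle of one has the length of an old cycle of the other, so staying different for every
  constant is a finite check, and one table serves all degrees. In the alternating group only the
  relative parity of the two conjugators matters, since conjugating the whole product by a
  transposition flips both. One odd element centralizing either factor therefore removes the parity
  obstruction, and a second realization by an odd conjugate of one factor replaces it when no such
  element exists.\<close>

definition perm_of :: "'a list list \<Rightarrow> 'a \<Rightarrow> 'a" where
  "perm_of css = foldr (\<circ>) (map cycle_of_list css) id"

text \<open>Fixed points in \<open>S\<close> are listed as one-element cycles, so \<open>M\<close>
  is a partition of \<open>card S\<close> and depends on \<open>S\<close>. Without the exclusion of
  empty lists, \<open>M\<close> would not be determined by \<open>p\<close>.\<close>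

definition ctype :: "'a set \<Rightarrow> ('a \<Rightarrow> 'a) \<Rightarrow> nat multiset \<Rightarrow> bool" where
  "ctype S p M \<longleftrightarrow> (\<exists>css. p = perm_of css \<and> distinct (concat css) \<and> [] \<notin> set css \<and>
     set (concat css) = S \<and> mset (map length css) = M)"

lemma perm_of_Nil [simp]: "perm_of [] = id"
  and perm_of_Cons: "perm_of (cs # css) = cycle_of_list cs \<circ> perm_of css"
  by (simp_all add: perm_of_def)

lemma perm_of_append: "perm_of (css @ dss) = perm_of css \<circ> perm_of dss"
  by (induction css) (auto simp: perm_of_Cons)

lemma perm_of_permutes: "perm_of css permutes set (concat css)"
proof (induction css)
  case Nil
  then show ?case by (simp add: permutes_id del: id_apply)
next
  case (Cons cs css)
  then show ?case
    unfolding perm_of_Cons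
    by (metis (no_types, lifting) concat.simps(2) cycle_permutes permutes_compose permutes_subset
        set_append sup_ge1 sup_ge2)
qed

lemma perm_of_outside: "x \<notin> set (concat css) \<Longrightarrow> perm_of css x = x"
  using perm_of_permutes permutes_not_in by metis

lemma permutation_perm_of: "permutation (perm_of css)"
  using perm_of_permutes permutation_permutes by blast

lemma cycle_of_list_in: "distinct cs \<Longrightarrow> x \<in> set cs \<Longrightarrow> cycle_of_list cs x \<in> set cs"
  using cycle_is_surj by blast

lemma perm_of_in:
  assumes "distinct (concat css)" "cs \<in> set css" "x \<in> set cs"
  shows "perm_of css x = cycle_of_list cs x"
  using assms
proof (induction css)
  case Nil
  then show ?case by simp
next
  case (Cons ds css)
  have d: "distinct ds" "distinct (concat css)" "set ds \<inter> set (concat css) = {}"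
    using Cons.prems(1) by auto
  show ?case
  proof (cases "x \<in> set ds")
    case True
    then have "cs = ds" using Cons.prems d by auto
    moreover have "perm_of css x = x" using True d by (intro perm_of_outside) auto
    ultimately show ?thesis by (simp add: perm_of_Cons)
  next
    case False
    then have "cs \<in> set css" using Cons.prems by auto
    with Cons have 1: "perm_of css x = cycle_of_list cs x" using d by auto
    have "distinct cs" using \<open>cs \<in> set css\<close> d by (auto simp: distinct_concat_iff)
    then have "cycle_of_list cs x \<in> set cs" using Cons.prems(3) cycle_of_list_in by metis
    then have "cycle_of_list cs x \<notin> set ds" using d \<open>cs \<in> set css\<close> by auto
    then show ?thesis using 1 by (simp add: perm_of_Cons id_outside_supp)
  qed
qed

text \<open>The value at a point depends only on the cycle that contains it, so the order of
  disjoint cycles is immaterial.\<close>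

lemma perm_of_cong:
  assumes "distinct (concat css)" "distinct (concat dss)" "set css = set dss"
  shows "perm_of css = perm_of dss"
proof
  fix x
  show "perm_of css x = perm_of dss x"
  proof (cases "x \<in> set (concat css)")
    case True
    then obtain cs where "cs \<in> set css" "x \<in> set cs" by auto
    then show ?thesis using perm_of_in assms by metis
  next
    case False
    then have "x \<notin> set (concat dss)" using assms by simp
    then show ?thesis using False perm_of_outside by metis
  qed
qed

lemma perm_of_remove_singletons:
  "perm_of (filter (\<lambda>cs. 2 \<le> length cs) css) = perm_of css"
proof (induction css)
  case (Cons cs css)
  have "cycle_of_list cs = id" if "\<not> 2 \<le> length cs"
    using that by (cases cs rule: cycle_of_list.cases) auto
  then show ?case using Cons by (auto simp: perm_of_Cons)
qed simp

lemma perm_of_conj: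
  assumes "distinct (concat css)" "bij g"
  shows "g \<circ> perm_of css \<circ> inv' g = perm_of (map (map g) css)"
  using assms(1)
proof (induction css)
  case Nil
  have "g \<circ> inv' g = id" using assms(2) bij_is_surj surj_iff by blast
  then show ?case by simp
next
  case (Cons cs css)
  have i: "inv' g \<circ> g = id" using assms(2) by (simp add: bij_is_inj)
  have "g \<circ> perm_of (cs # css) \<circ> inv' g
      = (g \<circ> cycle_of_list cs \<circ> inv' g) \<circ> (g \<circ> perm_of css \<circ> inv' g)"
    using i by (auto simp: perm_of_Cons fun_eq_iff)
  also have "\<dots> = perm_of (map (map g) (cs # css))"
    using Cons assms(2) by (simp add: perm_of_Cons conjugation_of_cycle del: o_apply)
  finally show ?case .
qed

lemma ctype_permutes: "ctype S p M \<Longrightarrow> p permutes S"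
  unfolding ctype_def using perm_of_permutes by blast

lemma ctype_finite: "ctype S p M \<Longrightarrow> finite S"
  unfolding ctype_def by auto

lemma ctype_exists:
  assumes "p permutes S" "finite S"
  shows "\<exists>M. ctype S p M"
proof -
  have "cycle_decomp S p" using cycle_decomposition assms by blast
  then have "\<exists>css. p = perm_of css \<and> distinct (concat css) \<and> [] \<notin> set css \<and> set (concat css) = S"
  proof induction
    case empty
    show ?case by (rule exI[of _ "[]"]) simp
  next
    case (comp I p cs)
    then obtain css where c: "p = perm_of css" "distinct (concat css)" "[] \<notin> set css"
      "set (concat css) = I" by blast
    show ?case
    proof (cases "cs = []")
      \<comment> \<open>The inductive \<open>cycle_decomp\<close> admits empty cycles; they act as
        the identity and are dropped.\<close>
      case True
      then show ?thesis using c by (intro exI[of _ css]) simp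
    next
      case False
      then show ?thesis using c comp by (intro exI[of _ "cs # css"]) (auto simp: perm_of_Cons)
    qed
  qed
  then show ?thesis unfolding ctype_def by blast
qed

lemma ctype_zero: "ctype S p M \<Longrightarrow> 0 \<notin># M"
  unfolding ctype_def by auto

lemma ctype_sum: "ctype S p M \<Longrightarrow> sum_mset M = card S"
  unfolding ctype_def
  by (metis distinct_card length_concat sum_mset_sum_list)

section \<open>Parity from cycle lengths\<close>

lemma evenperm_cycle_of_list:
  assumes "distinct cs"
  shows "evenperm (cycle_of_list cs) \<longleftrightarrow> even (length cs - 1)"
  using swapidseq_ext_imp_swapidseq[OF swapidseq_ext_of_cycles[OF assms]] evenperm_unique by blast

lemma evenperm_perm_of:
  assumes "distinct (concat css)"
  shows "evenperm (perm_of css) \<longleftrightarrow> even (\<Sum>cs\<leftarrow>css. length cs - 1)"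
  using assms
proof (induction css)
  case Nil
  then show ?case by (simp add: evenperm_id)
next
  case (Cons cs css)
  then show ?case
    using evenperm_comp[OF permutation_of_cycle permutation_perm_of, of cs css]
    by (auto simp: perm_of_Cons evenperm_cycle_of_list simp del: o_apply)
qed

lemma ctype_evenperm:
  assumes "ctype S p M"
  shows "evenperm p \<longleftrightarrow> even (\<Sum>l\<in>#M. l - 1)"
proof -
  obtain css where c: "p = perm_of css" "distinct (concat css)" "mset (map length css) = M"
    using assms unfolding ctype_def by blast
  have "(\<Sum>l\<in>#M. l - 1) = (\<Sum>cs\<leftarrow>css. length cs - 1)"
    unfolding c(3)[symmetric] by (induction css) auto
  then show ?thesis using evenperm_perm_of c by simp
qed

section \<open>Uniqueness of the cycle type\<close>

lemma funpow_perm_of: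
  assumes "distinct (concat css)" "cs \<in> set css" "j < length cs"
  shows "(perm_of css ^^ i) (cs ! j) = cs ! ((j + i) mod length cs)"
proof (induction i)
  case 0
  then show ?case using assms by simp
next
  case (Suc i)
  have d: "distinct cs" using assms by (auto simp: distinct_concat_iff)
  let ?k = "(j + i) mod length cs"
  have k: "?k < length cs" using assms(3) by (intro mod_less_divisor) linarith
  have "map (cycle_of_list cs) cs = rotate 1 cs"
    using cyclic_rotation[OF d, of 1] by simp
  then have "cycle_of_list cs (cs ! ?k) = rotate 1 cs ! ?k" using k by (metis nth_map)
  also have "\<dots> = cs ! ((1 + ?k) mod length cs)" using k by (subst nth_rotate) auto
  also have "(1 + ?k) mod length cs = (j + Suc i) mod length cs" by (simp add: mod_Suc_eq)
  finally have "cycle_of_list cs (cs ! ?k) = cs ! ((j + Suc i) mod length cs)" .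
  then show ?case using Suc perm_of_in[OF assms(1,2), of "cs ! ?k"] k by simp
qed

text \<open>Turns the length of a listed cycle into a quantity of the permutation alone, which makes
  the cycle type an invariant.\<close>

lemma least_power_perm_of:
  assumes "distinct (concat css)" "cs \<in> set css" "x \<in> set cs"
  shows "least_power (perm_of css) x = length cs"
proof -
  obtain j where j: "j < length cs" "x = cs ! j" using assms(3) by (metis in_set_conv_nth)
  have d: "distinct cs" using assms by (auto simp: distinct_concat_iff)
  have iff: "(perm_of css ^^ i) x = x \<longleftrightarrow> length cs dvd i" for i
  proof -
    have "(perm_of css ^^ i) x = x \<longleftrightarrow> (j + i) mod length cs = j"
      unfolding j(2) funpow_perm_of[OF assms(1,2) j(1)]
      using d j(1) by (intro nth_eq_iff_index_eq) (auto intro: mod_less_divisor)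
    also have "\<dots> \<longleftrightarrow> length cs dvd i"
      using j(1) mod_eq_dvd_iff_nat[of j "j + i" "length cs"] by simp
    finally show ?thesis .
  qed
  have "least_power (perm_of css) x dvd length cs"
    using iff least_power_minimal by (metis dvd_refl)
  moreover have "length cs dvd least_power (perm_of css) x"
    using iff least_power_of_permutation(1)[OF permutation_perm_of] by metis
  ultimately show ?thesis by (rule dvd_antisym)
qed

lemma card_least_power:
  assumes "ctype S p M"
  shows "card {x \<in> S. least_power p x = k} = k * count M k"
proof -
  obtain css where c: "p = perm_of css" "distinct (concat css)" "set (concat css) = S"
    "mset (map length css) = M"
    using assms unfolding ctype_def by blast
  have "{x \<in> S. least_power p x = k} = set (concat (filter (\<lambda>cs. length cs = k) css))"
    using c least_power_perm_of[OF c(2)] by auto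
  moreover have "distinct (concat (filter (\<lambda>cs. length cs = k) css))"
    using c(2) by (induction css) auto
  ultimately have "card {x \<in> S. least_power p x = k}
      = length (concat (filter (\<lambda>cs. length cs = k) css))"
    by (metis distinct_card)
  also have "\<dots> = k * count (mset (map length css)) k" by (induction css) auto
  finally show ?thesis using c by simp
qed

lemma ctype_unique:
  assumes "ctype S p M" "ctype S p M'"
  shows "M = M'"
proof (rule multiset_eqI)
  fix k
  show "count M k = count M' k"
  \<comment> \<open>Counting the points in cycles of length \<open>k\<close> yields
    \<open>k * count M k\<close>, which says nothing for \<open>k = 0\<close>; there the absence of
    empty cycles decides.\<close>
  proof (cases "k = 0")
    case True
    then show ?thesis using assms[THEN ctype_zero] by (simp add: not_in_iff)
  next
    case False
    then show ?thesis using assms[THEN card_least_power, of k] by simp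
  qed
qed

section \<open>Cycle types and conjugacy in the symmetric group\<close>

lemma ctype_conj:
  assumes "ctype S p M" "g permutes S"
  shows "ctype S (g \<circ> p \<circ> inv' g) M"
proof -
  obtain css where c: "p = perm_of css" "distinct (concat css)" "[] \<notin> set css"
    "set (concat css) = S" "mset (map length css) = M"
    using assms unfolding ctype_def by blast
  have g: "bij g" "inj_on g A" for A
    using assms(2) permutes_bij permutes_inj_on by blast+
  have "set (concat (map (map g) css)) = S"
    using c(4) permutes_image[OF assms(2)] by (auto simp flip: map_concat)
  moreover have "map length (map (map g) css) = map length css" by (auto simp: comp_def)
  moreover have "distinct (concat (map (map g) css))"
    using c(2) g by (simp add: distinct_map flip: map_concat)
  moreover have "[] \<notin> set (map (map g) css)" using c(3) by auto
  ultimately show ?thesis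
    unfolding ctype_def c(1) perm_of_conj[OF c(2) g(1)] using c(5)
    by (intro exI[of _ "map (map g) css"] conjI) (assumption | metis)+
qed

lemma mset_map_reorder:
  assumes "mset (map f xs) = mset ls"
  shows "\<exists>ys. mset ys = mset xs \<and> map f ys = ls"
  using assms
proof (induction ls arbitrary: xs)
  case (Cons l ls)
  then have "l \<in> set (map f xs)" by (metis list.set_intros(1) mset_eq_setD)
  then obtain x where x: "x \<in> set xs" "f x = l" by auto
  have "mset (map f (remove1 x xs)) = mset ls"
    using Cons.prems x by (simp add: image_mset_Diff)
  then obtain ys where "mset ys = mset (remove1 x xs)" "map f ys = ls" using Cons.IH by blast
  then show ?case using x by (intro exI[of _ "x # ys"]) simp
qed simp

lemma mset_concat_cong: "mset css = mset dss \<Longrightarrow> mset (concat css) = mset (concat dss)"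
proof -
  assume "mset css = mset dss"
  then have "mset (map mset css) = mset (map mset dss)" by simp
  then show ?thesis unfolding mset_concat by (metis sum_mset_sum_list)
qed

text \<open>Allows the cycles to be listed in a prescribed order of lengths, so that two
  permutations of one type can be matched cycle by cycle.\<close>

lemma ctype_list:
  assumes "ctype S p (mset ls)"
  shows "\<exists>css. p = perm_of css \<and> distinct (concat css) \<and> [] \<notin> set css \<and>
     set (concat css) = S \<and> map length css = ls"
proof -
  obtain css where c: "p = perm_of css" "distinct (concat css)" "[] \<notin> set css"
    "set (concat css) = S" "mset (map length css) = mset ls"
    using assms unfolding ctype_def by blast
  obtain dss where d: "mset dss = mset css" "map length dss = ls"
    using mset_map_reorder[OF c(5)] by blast
  have s: "set dss = set css" using d by (metis mset_eq_setD)
  have "distinct (concat dss)" using c(2) d(1) mset_concat_cong mset_eq_imp_distinct_iff by blast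
  moreover have "p = perm_of dss" using c(1) perm_of_cong[OF c(2) calculation] s by simp
  ultimately show ?thesis using c(3,4) d s by (intro exI[of _ dss]) simp
qed

lemma permutes_of_lists:
  assumes "distinct xs" "distinct ys" "set xs = S" "set ys = S"
  shows "\<exists>g. g permutes S \<and> map g xs = ys"
proof -
  have l: "length xs = length ys" using assms distinct_card by metis
  define g where "g x = (if x \<in> S then the (map_of (zip xs ys) x) else x)" for x
  have m: "map g xs = ys"
  proof (rule nth_equalityI)
    fix i assume "i < length (map g xs)"
    then show "map g xs ! i = ys ! i"
      using l assms map_of_zip_nth[of xs ys i] by (auto simp: g_def)
  qed (use l in simp)
  then have "g ` S = S" using assms(3,4) image_set[of g xs] by simp
  then have "bij_betw g S S"
    using assms(2,3) m distinct_map[of g xs] by (simp add: bij_betw_def)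
  then have "g permutes S" by (rule bij_imp_permutes) (simp add: g_def)
  then show ?thesis using m by blast
qed

text \<open>With the cycles listed in the same order of lengths, the conjugator is the bijection
  that matches the two concatenated lists by position; cutting them back into cycles respects
  it.\<close>

lemma ctype_imp_conj:
  assumes "ctype S p M" "ctype S q M"
  shows "\<exists>g. g permutes S \<and> q = g \<circ> p \<circ> inv' g"
proof -
  obtain css where c: "p = perm_of css" "distinct (concat css)"
    "set (concat css) = S" "mset (map length css) = M"
    using assms unfolding ctype_def by blast
  obtain dss where d: "q = perm_of dss" "distinct (concat dss)"
    "set (concat dss) = S" "map length dss = map length css"
    using ctype_list assms(2) c(4) by metis
  obtain g where g: "g permutes S" "map g (concat css) = concat dss"
    using permutes_of_lists c d by metis
  have len: "length css = length dss" using d(4) by (metis length_map)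
  have "map (map g) css = dss"
  proof (rule concat_injective)
    show "concat (map (map g) css) = concat dss" using g(2) by (simp add: map_concat)
    show "length (map (map g) css) = length dss" using len by simp
    show "\<forall>(x, y)\<in>set (zip (map (map g) css) dss). length x = length y"
    proof clarify
      fix x y assume "(x, y) \<in> set (zip (map (map g) css) dss)"
      then obtain i where i: "i < length css" "x = map g (css ! i)" "y = dss ! i"
        by (auto simp: set_zip)
      have "length (dss ! i) = length (css ! i)" using d(4) i(1) len by (metis nth_map)
      then show "length x = length y" using i by simp
    qed
  qed
  then have "q = g \<circ> p \<circ> inv' g"
    using perm_of_conj[OF c(2) permutes_bij[OF g(1)]] c(1) d(1) by metis
  then show ?thesis using g(1) by blast
qed

section \<open>Gluing permutations at a point\<close>

text \<open>The marked point \<open>y\<close> lies in a \<open>k\<close>-cycle; \<open>M\<close> collects the lengths of the other cycles.\<close>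

definition marked_ctype :: "'a set \<Rightarrow> ('a \<Rightarrow> 'a) \<Rightarrow> 'a \<Rightarrow> nat \<Rightarrow> nat multiset \<Rightarrow> bool" where
  "marked_ctype S p y k M \<longleftrightarrow> (\<exists>C css. p = perm_of ((y # C) # css) \<and> distinct (concat ((y # C) # css)) \<and>
     [] \<notin> set css \<and> set (concat ((y # C) # css)) = S \<and> k = Suc (length C) \<and> mset (map length css) = M)"

lemma mctype_imp_ctype: "marked_ctype S p y k M \<Longrightarrow> ctype S p (add_mset k M)"
  unfolding marked_ctype_def ctype_def
  by (elim exE conjE, rule_tac x = "(y # C) # css" in exI) auto

lemma mctype_permutes: "marked_ctype S p y k M \<Longrightarrow> p permutes S"
  using mctype_imp_ctype ctype_permutes by metis

text \<open>A cycle may be rotated until it begins at \<open>y\<close> without changing the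
  permutation.\<close>

lemma mctype_exists:
  assumes "p permutes S" "finite S" "y \<in> S"
  shows "\<exists>k M. marked_ctype S p y (Suc k) M"
proof -
  obtain css where c: "p = perm_of css" "distinct (concat css)" "[] \<notin> set css"
    "set (concat css) = S"
    using ctype_exists[OF assms(1,2)] unfolding ctype_def by blast
  obtain cs where cs: "cs \<in> set css" "y \<in> set cs" using c(4) assms(3) by auto
  obtain as bs where css: "css = as @ cs # bs" using cs(1) by (meson split_list)
  obtain us vs where uv: "cs = us @ y # vs" using cs(2) by (meson split_list)
  have d: "distinct cs" using c(2) cs(1) by (auto simp: distinct_concat_iff)
  have 1: "distinct (concat (cs # as @ bs))" using c(2) css by auto
  have "p = perm_of (cs # as @ bs)"
    unfolding c(1) by (rule perm_of_cong[OF c(2) 1]) (auto simp: css)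
  moreover have "rotate (length us) cs = y # vs @ us" unfolding uv by (simp add: rotate_append)
  then have "cycle_of_list cs = cycle_of_list (y # vs @ us)"
    using cycle_of_list_rotate_independent[OF d] by metis
  ultimately have "p = perm_of ((y # vs @ us) # as @ bs)" by (simp add: perm_of_Cons)
  moreover have "set (concat ((y # vs @ us) # as @ bs)) = S"
    using c(4) unfolding css uv by auto
  moreover have "distinct (concat ((y # vs @ us) # as @ bs))"
    using 1 unfolding uv by auto
  moreover have "[] \<notin> set (as @ bs)" using c(3) css by auto
  ultimately show ?thesis unfolding marked_ctype_def by blast
qed

fun split_lengths :: "nat list \<Rightarrow> 'a list \<Rightarrow> 'a list list" where
  "split_lengths [] xs = []"
| "split_lengths (l # ls) xs = take l xs # split_lengths ls (drop l xs)"

lemma concat_chop: "length xs = sum_list ls \<Longrightarrow> concat (split_lengths ls xs) = xs"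
  by (induction ls arbitrary: xs) auto

lemma map_length_chop: "length xs = sum_list ls \<Longrightarrow> map length (split_lengths ls xs) = ls"
  by (induction ls arbitrary: xs) auto

lemma Nil_notin_iff: "[] \<notin> set css \<longleftrightarrow> 0 \<notin> set (map length css)"
  by auto

text \<open>The points are listed with \<open>y\<close> first and cut into blocks. The marked length
  is written \<open>Suc k\<close> because \<open>k\<close>, the number of points beside
  \<open>y\<close>, is the quantity that adds up under gluing.\<close>

lemma mctype_build:
  assumes "finite S" "y \<in> S" "0 \<notin># M" "Suc k + sum_mset M = card S"
  shows "\<exists>p. marked_ctype S p y (Suc k) M"
proof -
  obtain xs where xs: "set xs = S - {y}" "distinct xs"
    using finite_distinct_list assms(1) by (metis finite_Diff)
  obtain ls where ls: "mset ls = M" by (metis ex_mset)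
  let ?xs = "y # xs" and ?ls = "Suc k # ls"
  have "length ?xs = card S"
    using xs assms(1,2) by (metis DiffD2 card_Suc_Diff1 distinct_card length_Cons singletonI)
  then have len: "length ?xs = sum_list ?ls" using assms(4) by (simp add: sum_mset_sum_list flip: ls)
  define css where "css = split_lengths ls (drop k xs)"
  have eq: "split_lengths ?ls ?xs = (y # take k xs) # css" by (simp add: css_def)
  have c: "concat ((y # take k xs) # css) = ?xs" using concat_chop[OF len] unfolding eq .
  have m: "map length ((y # take k xs) # css) = ?ls" using map_length_chop[OF len] unfolding eq .
  have "distinct ?xs" "set ?xs = S" using xs assms(2) by auto
  then have "distinct (concat ((y # take k xs) # css))" "set (concat ((y # take k xs) # css)) = S"
    unfolding c .
  moreover have "Suc k = Suc (length (take k xs))" "map length css = ls" using m by auto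
  moreover from this(2) have "[] \<notin> set css"
    using assms(3) ls unfolding Nil_notin_iff by auto
  ultimately show ?thesis unfolding marked_ctype_def using ls by blast
qed

text \<open>\<open>cycle_of_list\<close> is a product of transpositions of neighbours, and this
  product can be cut at \<open>z\<close>; distinctness does not enter. It is the gluing of two
  single cycles.\<close>

lemma cycle_of_list_append:
  "cycle_of_list (xs @ z # ys) = cycle_of_list (xs @ [z]) \<circ> cycle_of_list (z # ys)"
proof (induction xs rule: induct_list012)
  case 1
  then show ?case by simp
next
  case (2 x)
  then show ?case by (cases ys) auto
next
  case (3 x y xs)
  then show ?case by (simp add: comp_assoc)
qed

lemma disjoint_permutes_commute:
  assumes "p permutes X" "q permutes Y" "X \<inter> Y = {}"
  shows "p \<circ> q = q \<circ> p"
proof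
  fix x
  consider "x \<in> X" "x \<notin> Y" | "x \<in> Y" "x \<notin> X" | "x \<notin> X" "x \<notin> Y" using assms(3) by blast
  then show "(p \<circ> q) x = (q \<circ> p) x"
  proof cases
    case 1
    then have "p x \<notin> Y" using assms permutes_in_image[OF assms(1)] by blast
    then show ?thesis using 1 assms by (simp add: permutes_not_in)
  next
    case 2
    then have "q x \<notin> X" using assms permutes_in_image[OF assms(2)] by blast
    then show ?thesis using 2 assms by (simp add: permutes_not_in)
  next
    case 3
    then show ?thesis using assms by (simp add: permutes_not_in)
  qed
qed

text \<open>Multiplying permutations whose supports meet in one point fuses the two cycles through it.\<close>

lemma mctype_glue:
  assumes "marked_ctype X p y (Suc k) M" "marked_ctype Y q y (Suc k') M'" "X \<inter> Y = {y}"
  shows "marked_ctype (X \<union> Y) (p \<circ> q) y (Suc (k + k')) (M + M')"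
proof -
  obtain P Ps where p: "p = perm_of ((y # P) # Ps)" "distinct (concat ((y # P) # Ps))"
    "[] \<notin> set Ps" "set (concat ((y # P) # Ps)) = X" "k = length P" "mset (map length Ps) = M"
    using assms(1) unfolding marked_ctype_def by auto
  obtain Q Qs where q: "q = perm_of ((y # Q) # Qs)" "distinct (concat ((y # Q) # Qs))"
    "[] \<notin> set Qs" "set (concat ((y # Q) # Qs)) = Y" "k' = length Q" "mset (map length Qs) = M'"
    using assms(2) unfolding marked_ctype_def by auto
  have dis: "set (concat Ps) \<inter> set (y # Q) = {}" "set (concat Ps) \<inter> set (concat Qs) = {}"
    "set P \<inter> set (y # Q) = {}" "set P \<inter> set (concat Qs) = {}"
    using p(2,4) q(2,4) assms(3) by auto
  \<comment> \<open>Rotating \<open>y\<close> to the end of the left cycle puts the shared point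
    where \<open>cycle_of_list_append\<close> expects it.\<close>
  have "cycle_of_list (y # P) = cycle_of_list (P @ [y])"
    using cycle_of_list_rotate_independent[of "y # P" 1] p(2) by auto
  then have "cycle_of_list (y # P) \<circ> cycle_of_list (y # Q) = cycle_of_list (P @ y # Q)"
    using cycle_of_list_append[of P y Q] by simp
  also have "\<dots> = cycle_of_list (y # Q @ P)"
    using cycle_of_list_rotate_independent[of "P @ y # Q" "length P"] p(2) q(2) dis(3)
    by (simp add: rotate_append)
  finally have 1: "cycle_of_list (y # P) \<circ> cycle_of_list (y # Q) = cycle_of_list (y # Q @ P)" .
  have "perm_of Ps \<circ> cycle_of_list (y # Q) = cycle_of_list (y # Q) \<circ> perm_of Ps"
    using disjoint_permutes_commute[OF perm_of_permutes cycle_permutes dis(1)] .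
  then have "p \<circ> q = (cycle_of_list (y # P) \<circ> cycle_of_list (y # Q)) \<circ> perm_of Ps \<circ> perm_of Qs"
    unfolding p(1) q(1) perm_of_Cons by (metis comp_assoc)
  then have "p \<circ> q = perm_of ((y # Q @ P) # (Ps @ Qs))"
    unfolding 1 perm_of_Cons perm_of_append by (simp add: comp_assoc)
  moreover have "distinct (concat ((y # Q @ P) # (Ps @ Qs)))"
    using p(2) q(2) dis by auto
  moreover have "set (concat ((y # Q @ P) # (Ps @ Qs))) = X \<union> Y" using p(4) q(4) by auto
  moreover have "[] \<notin> set (Ps @ Qs)" "mset (map length (Ps @ Qs)) = M + M'"
    using p(3,6) q(3,6) by auto
  ultimately show ?thesis unfolding marked_ctype_def using p(5) q(5)
    by (intro exI[of _ "Q @ P"] exI[of _ "Ps @ Qs"]) auto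
qed

section \<open>Enlarging a pair of permutations to a pair of prescribed types\<close>

definition partition_of :: "nat \<Rightarrow> nat multiset \<Rightarrow> bool" where
  "partition_of n L \<longleftrightarrow> 0 \<notin># L \<and> sum_mset L = n"

text \<open>These are the product types in the symmetric group; their occurrence in the alternating
  group is a separate question of parity.\<close>

definition product_types :: "nat \<Rightarrow> nat multiset \<Rightarrow> nat multiset \<Rightarrow> nat multiset set" where
  "product_types n L M = {K. \<exists>a b. ctype {1..n} a L \<and> ctype {1..n} b M \<and> ctype {1..n} (a \<circ> b) K}"

text \<open>The first entry of a pattern may be enlarged to a part, the others have to occur exactly.\<close>

definition has_pattern :: "nat list \<Rightarrow> nat multiset \<Rightarrow> bool" where
  "has_pattern ls L \<longleftrightarrow> (\<exists>e R. L = add_mset (hd ls + e) (mset (tl ls) + R))"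

lemma ctype_part: "ctype {1..n} p L \<Longrightarrow> partition_of n L"
  using ctype_zero[of "{1..n}" p L] ctype_sum[of "{1..n}" p L] by (simp add: partition_of_def)

text \<open>The order of the quantifiers carries the content: \<open>\<sigma>\<close>,
  \<open>\<tau>\<close>, \<open>k'\<close> and \<open>K'\<close> are fixed before \<open>a\<close>
  and \<open>b\<close>, so all small pairs with the same two marked types grow alike. The set
  permuted by \<open>\<tau>\<close> is recorded in order to show later that an odd permutation of
  old points other than the mark commutes with \<open>\<tau>\<close>.\<close>

lemma extend_pair:
  assumes "partition_of n L" "partition_of n M" "has_pattern (Suc l # ls) L" "has_pattern (Suc m # ms) M"
    "Suc l + sum_list ls = s" "Suc m + sum_list ms = s"
  shows "\<exists>\<sigma> \<tau> k' K'. \<tau> permutes insert 1 {s<..n} \<and>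
    (\<forall>a b k K. marked_ctype {1..s} a 1 (Suc l) (mset ls) \<longrightarrow> marked_ctype {1..s} b 1 (Suc m) (mset ms) \<longrightarrow>
      marked_ctype {1..s} (a \<circ> b) 1 (Suc k) K \<longrightarrow>
      ctype {1..n} (\<sigma> \<circ> a) L \<and> ctype {1..n} (b \<circ> \<tau>) M \<and>
      ctype {1..n} ((\<sigma> \<circ> a) \<circ> (b \<circ> \<tau>)) (add_mset (Suc k + k') (K + K')))"
proof -
  obtain e R where L: "L = add_mset (Suc l + e) (mset ls + R)"
    using assms(3) unfolding has_pattern_def by auto
  obtain f Q where M: "M = add_mset (Suc m + f) (mset ms + Q)"
    using assms(4) unfolding has_pattern_def by auto
  define X where "X = {1..s}"
  define Y where "Y = insert 1 {s<..n}"
  have n1: "n = s + e + sum_mset R" "n = s + f + sum_mset Q"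
    using assms(1,2,5,6) unfolding partition_of_def L M by (auto simp: sum_mset_sum_list)
  have s: "s \<ge> 1" "s \<le> n" using assms(5) n1(1) by linarith+
  have XY: "X \<inter> Y = {1}" "X \<union> Y = {1..n}" "finite Y" "1 \<in> Y"
    using s unfolding X_def Y_def by (auto simp del: One_nat_def)
  have "card Y = Suc (n - s)" using s unfolding Y_def by simp
  then have cY: "Suc e + sum_mset R = card Y" "Suc f + sum_mset Q = card Y"
    using n1 by linarith+
  have nz: "0 \<notin># R" "0 \<notin># Q" using assms(1,2) unfolding partition_of_def L M by simp_all
  obtain \<sigma> where \<sigma>: "marked_ctype Y \<sigma> 1 (Suc e) R" using mctype_build[OF XY(3,4) nz(1) cY(1)] by blast
  obtain \<tau> where \<tau>: "marked_ctype Y \<tau> 1 (Suc f) Q" using mctype_build[OF XY(3,4) nz(2) cY(2)] by blast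
  have per: "\<sigma> permutes Y" "\<tau> permutes Y" by (rule mctype_permutes[OF \<sigma>], rule mctype_permutes[OF \<tau>])
  then have "(\<tau> \<circ> \<sigma>) permutes Y" by (rule permutes_compose)
  then obtain k' K' where k': "marked_ctype Y (\<tau> \<circ> \<sigma>) 1 (Suc k') K'"
    using mctype_exists[OF _ XY(3,4)] by blast
  have YX: "Y \<union> X = {1..n}" "Y \<inter> X = {1}" using XY by auto
  have "ctype {1..n} (\<sigma> \<circ> a) L \<and> ctype {1..n} (b \<circ> \<tau>) M \<and>
      ctype {1..n} ((\<sigma> \<circ> a) \<circ> (b \<circ> \<tau>)) (add_mset (Suc k + k') (K + K'))"
    if a: "marked_ctype X a 1 (Suc l) (mset ls)" and b: "marked_ctype X b 1 (Suc m) (mset ms)"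
      and ab: "marked_ctype X (a \<circ> b) 1 (Suc k) K" for a b k K
  proof (intro conjI)
    show "ctype {1..n} (\<sigma> \<circ> a) L"
      using mctype_imp_ctype[OF mctype_glue[OF \<sigma> a YX(2)], unfolded YX(1)]
      unfolding L by (simp only: add_Suc add_Suc_right add.commute)
    show "ctype {1..n} (b \<circ> \<tau>) M"
      using mctype_imp_ctype[OF mctype_glue[OF b \<tau> XY(1)], unfolded XY(2)]
      unfolding M by (simp only: add_Suc)
    have c: "ctype {1..n} ((\<tau> \<circ> \<sigma>) \<circ> (a \<circ> b)) (add_mset (Suc k + k') (K + K'))"
      using mctype_imp_ctype[OF mctype_glue[OF k' ab YX(2)], unfolded YX(1)]
      by (simp only: add_Suc add_Suc_right add.commute)
    have "\<tau> permutes {1..n}" using per(2) permutes_subset XY(2) by blast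
    then have "inv' \<tau> permutes {1..n}" "inv' (inv' \<tau>) = \<tau>" "inv' \<tau> \<circ> \<tau> = id"
      by (simp_all only: permutes_inv permutes_inv_inv permutes_inv_o)
    then have "ctype {1..n} (inv' \<tau> \<circ> ((\<tau> \<circ> \<sigma>) \<circ> (a \<circ> b)) \<circ> \<tau>) (add_mset (Suc k + k') (K + K'))"
      using ctype_conj[OF c, of "inv' \<tau>"] by simp
    moreover have "inv' \<tau> \<circ> ((\<tau> \<circ> \<sigma>) \<circ> (a \<circ> b)) \<circ> \<tau> = (\<sigma> \<circ> a) \<circ> (b \<circ> \<tau>)"
      using permutes_inverses(2)[OF per(2)] by (simp add: fun_eq_iff)
    ultimately show "ctype {1..n} ((\<sigma> \<circ> a) \<circ> (b \<circ> \<tau>)) (add_mset (Suc k + k') (K + K'))"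
      by metis
  qed
  then show ?thesis using per(2) unfolding X_def Y_def
    by (intro exI[of _ \<sigma>] exI[of _ \<tau>] exI[of _ k'] exI[of _ K'] conjI allI impI) simp_all
qed


section \<open>Certificates checked by evaluation\<close>

definition apply_cycles :: "'a list list \<Rightarrow> 'a \<Rightarrow> 'a" where
  "apply_cycles css x = (case map_of (concat (map (\<lambda>c. zip c (rotate1 c)) css)) x of None \<Rightarrow> x | Some y \<Rightarrow> y)"

text \<open>Replaces the product of cycles by a lookup of successors, which is plain list
  computation.\<close>

lemma perm_of_nxt:
  assumes "distinct (concat css)"
  shows "perm_of css = apply_cycles css"
proof
  fix x
  let ?ps = "concat (map (\<lambda>c. zip c (rotate1 c)) css)"
  have fst: "map fst ?ps = concat css" by (induction css) auto
  show "perm_of css x = apply_cycles css x"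
  proof (cases "x \<in> set (concat css)")
    case True
    then obtain cs where cs: "cs \<in> set css" "x \<in> set cs" by auto
    then obtain j where j: "j < length cs" "x = cs ! j" by (metis in_set_conv_nth)
    have d: "distinct cs" using assms cs(1) by (auto simp: distinct_concat_iff)
    have "map (cycle_of_list cs) cs = rotate1 cs"
      using cyclic_rotation[OF d, of 1] by simp
    then have "rotate1 cs ! j = cycle_of_list cs x" using j by (metis nth_map)
    then have "rotate1 cs ! j = perm_of css x" using perm_of_in[OF assms cs] by simp
    then have "(x, perm_of css x) \<in> set (zip cs (rotate1 cs))"
      using j by (auto simp: set_zip)
    then have "(x, perm_of css x) \<in> set ?ps" using cs(1) by auto
    moreover have "distinct (map fst ?ps)" using assms fst by simp
    ultimately have "map_of ?ps x = Some (perm_of css x)" by simp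
    then show ?thesis by (simp add: apply_cycles_def)
  next
    case False
    then have "map_of ?ps x = None" using fst by (metis list.set_map map_of_eq_None_iff)
    then show ?thesis using perm_of_outside[OF False] by (simp add: apply_cycles_def)
  qed
qed

text \<open>The cycles are consecutive intervals, so the mark 1 lies in the first one and the first
  factor of a certificate is given by its lengths alone.\<close>

definition standard_cycles :: "nat list \<Rightarrow> nat list list" where
  "standard_cycles ls = split_lengths ls [1..<Suc (sum_list ls)]"

text \<open>One sorting test gives both that the cycles are disjoint and that they exhaust
  \<open>{1..s}\<close>.\<close>

definition arrangement :: "nat \<Rightarrow> nat list list \<Rightarrow> bool" where
  "arrangement s css \<longleftrightarrow> sort (concat css) = [1..<Suc s] \<and> list_all (\<lambda>c. c \<noteq> []) css"

lemma arrangementD: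
  assumes "arrangement s css"
  shows "distinct (concat css)" "set (concat css) = {1..s}" "[] \<notin> set css"
proof -
  have s: "sort (concat css) = [1..<Suc s]" using assms by (simp add: arrangement_def)
  have "distinct (sort (concat css))" unfolding s by (rule distinct_upt)
  then show "distinct (concat css)" by simp
  have "set (sort (concat css)) = set [1..<Suc s]" unfolding s ..
  then have "set (concat css) = set [1..<Suc s]" by (simp only: set_sort)
  then show "set (concat css) = {1..s}" by auto
  show "[] \<notin> set css" using assms by (auto simp: arrangement_def list_all_iff)
qed

lemma arrangement_ctype: "arrangement s css \<Longrightarrow> ctype {1..s} (perm_of css) (mset (map length css))"
  unfolding ctype_def using arrangementD by blast

lemma arrangement_mctype:
  assumes "arrangement s css" "hd (concat css) = 1" "css \<noteq> []"
  shows "\<exists>k. length (hd css) = Suc k \<and>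
    marked_ctype {1..s} (perm_of css) 1 (Suc k) (mset (map length (tl css)))"
proof -
  obtain C css' where c: "css = C # css'" using assms(3) by (cases css) auto
  obtain C' where C: "C = 1 # C'" using arrangementD(3)[OF assms(1)] assms(2) c
    by (cases C) auto
  show ?thesis using arrangementD[OF assms(1)] unfolding marked_ctype_def c C
    by (intro exI[of _ "length C'"]) auto
qed

lemma arrangement_std:
  assumes "0 \<notin> set ls"
  shows "arrangement (sum_list ls) (standard_cycles ls)" "map length (standard_cycles ls) = ls"
proof -
  have l: "length [1..<Suc (sum_list ls)] = sum_list ls" by (simp del: upt_Suc)
  show m: "map length (standard_cycles ls) = ls" unfolding standard_cycles_def by (rule map_length_chop[OF l])
  have "[] \<notin> set (standard_cycles ls)" using assms unfolding Nil_notin_iff m by simp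
  moreover have "concat (standard_cycles ls) = [1..<Suc (sum_list ls)]"
    unfolding standard_cycles_def by (rule concat_chop[OF l])
  then have "sort (concat (standard_cycles ls)) = [1..<Suc (sum_list ls)]"
    by (simp only: sorted_sort_id sorted_upt)
  ultimately show "arrangement (sum_list ls) (standard_cycles ls)"
    unfolding arrangement_def list_all_iff by blast
qed

text \<open>Only the points \<open>1..s\<close> are tested, since all three permutations fix every
  other point. Fixing the first factor is harmless because product types are invariant under
  simultaneous conjugation.\<close>

definition witness :: "nat list \<Rightarrow> nat list \<Rightarrow> nat list list \<Rightarrow> nat list list \<Rightarrow> bool" where
  "witness ls ms B C \<longleftrightarrow> arrangement (sum_list ls) B \<and> arrangement (sum_list ls) C \<and>
     map length B = ms \<and>
     list_all (\<lambda>x. apply_cycles (standard_cycles ls) (apply_cycles B x) = apply_cycles C x) [1..<Suc (sum_list ls)]"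

lemma wit_mult:
  assumes "0 \<notin> set ls" "witness ls ms B C"
  shows "perm_of (standard_cycles ls) \<circ> perm_of B = perm_of C"
proof
  fix x
  have B: "arrangement (sum_list ls) B" and C: "arrangement (sum_list ls) C"
    using assms(2) by (auto simp: witness_def)
  note A = arrangement_std(1)[OF assms(1)]
  show "(perm_of (standard_cycles ls) \<circ> perm_of B) x = perm_of C x"
  proof (cases "x \<in> {1..sum_list ls}")
    case True
    then have "apply_cycles (standard_cycles ls) (apply_cycles B x) = apply_cycles C x" using assms(2) by (auto simp: witness_def list_all_iff)
    then show ?thesis using perm_of_nxt arrangementD(1) A B C by (metis comp_apply)
  next
    case False
    then show ?thesis using perm_of_outside arrangementD(2) A B C by (metis comp_apply)
  qed
qed

text \<open>Two product types, marked part first, that stay different when the marked part of both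
  is enlarged by the same amount.\<close>

fun separated :: "nat list \<Rightarrow> nat list \<Rightarrow> bool" where
  "separated (k # ks) (l # ls) \<longleftrightarrow> (if k = l then sort ks \<noteq> sort ls
     else length ks \<noteq> length ls \<or> list_all (\<lambda>x. x < k \<or> sort (x # ks) \<noteq> sort ((l + (x - k)) # ls)) ls)"
| "separated _ _ \<longleftrightarrow> False"

text \<open>If \<open>k\<close> and \<open>l\<close> differ, equality of the enlarged multisets
  forces \<open>k + e\<close> to be one of the entries of \<open>ls\<close>. This leaves finitely
  many values of \<open>e\<close>, which are the ones that \<open>separated\<close> tests.\<close>

lemma separated_shift:
  assumes "separated (k # ks) (l # ls)"
  shows "add_mset (k + e) (mset ks) \<noteq> add_mset (l + e) (mset ls)"
proof
  assume eq: "add_mset (k + e) (mset ks) = add_mset (l + e) (mset ls)"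
  then have e: "mset ((k + e) # ks) = mset ((l + e) # ls)" by simp
  show False
  proof (cases "k = l")
    case True
    then have "mset ks = mset ls" using eq by simp
    then show ?thesis using assms True by (simp add: properties_for_sort)
  next
    case False
    then have m: "k + e \<in># mset ls" using eq
      by (metis add.commute add_left_cancel insert_iff set_mset_add_mset_insert union_single_eq_member)
    have "length ks = length ls" using eq by (metis add_mset_add_single add_right_cancel size_add_mset size_mset nat.inject)
    then have "list_all (\<lambda>x. x < k \<or> sort (x # ks) \<noteq> sort ((l + (x - k)) # ls)) ls"
      using assms False by simp
    then have "sort ((k + e) # ks) \<noteq> sort ((l + (k + e - k)) # ls)"
      using m by (auto simp: list_all_iff simp del: sort_key_simps)
    then have "sort ((k + e) # ks) \<noteq> sort ((l + e) # ls)" by simp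
    then show ?thesis using e by (metis mset_sort properties_for_sort sorted_sort)
  qed
qed

text \<open>In a witness \<open>(B, C)\<close> the first factor is the standard permutation with cycle lengths \<open>ls\<close>,
  the second factor has cycles \<open>B\<close> and the product has cycles \<open>C\<close>; the point 1 is marked.\<close>

definition core :: "nat list \<Rightarrow> nat list \<Rightarrow> (nat list list \<times> nat list list) list \<Rightarrow> bool" where
  "core ls ms ws \<longleftrightarrow> 0 \<notin> set ls \<and> 0 \<notin> set ms \<and> ls \<noteq> [] \<and> ms \<noteq> [] \<and>
     sum_list ls = sum_list ms \<and>
     list_all (\<lambda>(B, C). witness ls ms B C \<and> hd (concat B) = 1 \<and> hd (concat C) = 1 \<and> C \<noteq> []) ws \<and>
     sorted_wrt separated (map (map length \<circ> snd) ws)"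

text \<open>The multiset \<open>K\<close>, common to all products, cancels and leaves the comparison
  to \<open>separated_shift\<close>.\<close>

lemma separated_distinct:
  assumes "sorted_wrt separated (map (map length \<circ> f) ws)"
  shows "distinct (map (\<lambda>w. add_mset (length (hd (f w)) + e) (mset (map length (tl (f w))) + K)) ws)"
proof -
  define G where "G w = add_mset (length (hd (f w)) + e) (mset (map length (tl (f w))) + K)" for w
  have key: "G w \<noteq> G w'" if sep: "separated (map length (f w)) (map length (f w'))" for w w'
  proof -
    obtain c cs c' cs' where c: "f w = c # cs" and c': "f w' = c' # cs'"
      using sep by (cases "f w"; cases "f w'") auto
    show ?thesis
      using separated_shift[of "length c" "map length cs" "length c'" "map length cs'" e] sep
      unfolding G_def c c' by (simp flip: union_mset_add_mset_left)
  qed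
  have "distinct (map G ws)" using assms
  proof (induction ws)
    case (Cons w ws)
    then have "G w \<noteq> G v" if "v \<in> set ws" for v using key that by simp
    then show ?case using Cons by auto
  qed simp
  then show ?thesis unfolding G_def .
qed

lemma arrangement_marked:
  assumes "arrangement s css" "map length css = Suc l # ls" "hd (concat css) = 1"
  shows "marked_ctype {1..s} (perm_of css) 1 (Suc l) (mset ls)"
proof -
  have ne: "css \<noteq> []" using assms(2) by auto
  have "length (hd css) = Suc l" "map length (tl css) = ls" using assms(2) by auto
  then show ?thesis using arrangement_mctype[OF assms(1,3) ne] by simp
qed

lemma std_marked:
  assumes "0 \<notin> set (Suc l # ls)"
  shows "marked_ctype {1..Suc l + sum_list ls} (perm_of (standard_cycles (Suc l # ls))) 1 (Suc l) (mset ls)"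
proof -
  have "concat (standard_cycles (Suc l # ls)) = [1..<Suc (sum_list (Suc l # ls))]"
    unfolding standard_cycles_def by (rule concat_chop) (simp del: upt_Suc)
  then have "hd (concat (standard_cycles (Suc l # ls))) = 1" by (simp add: upt_conv_Cons del: upt_Suc)
  then show ?thesis using arrangement_marked[OF arrangement_std[OF assms]] by simp
qed

text \<open>The gluing data are obtained before a witness is chosen, so a single map
  \<open>F\<close> sends the small product types to the large ones, and separation makes it
  injective on the list of witnesses.\<close>

lemma core_ptypes:
  assumes "core ls ms ws" "has_pattern ls L" "has_pattern ms M" "partition_of n L" "partition_of n M"
  shows "\<exists>T \<subseteq> product_types n L M. finite T \<and> card T = length ws"
proof -
  obtain l ls' m ms' where lm: "ls = Suc l # ls'" "ms = Suc m # ms'"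
    using assms(1) unfolding core_def
    by (cases ls; cases ms) (auto simp: not_less_eq_eq gr0_conv_Suc)
  define s where "s = sum_list ls"
  have s: "Suc l + sum_list ls' = s" "Suc m + sum_list ms' = s"
    using assms(1) unfolding s_def core_def lm by auto
  obtain \<sigma> \<tau> k' K' where "\<forall>a b k K. marked_ctype {1..s} a 1 (Suc l) (mset ls') \<longrightarrow>
      marked_ctype {1..s} b 1 (Suc m) (mset ms') \<longrightarrow> marked_ctype {1..s} (a \<circ> b) 1 (Suc k) K \<longrightarrow>
      ctype {1..n} (\<sigma> \<circ> a) L \<and> ctype {1..n} (b \<circ> \<tau>) M \<and>
      ctype {1..n} ((\<sigma> \<circ> a) \<circ> (b \<circ> \<tau>)) (add_mset (Suc k + k') (K + K'))"
    using extend_pair[OF assms(4,5,2)[unfolded lm] assms(3)[unfolded lm] s] by blast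
  then have ext: "ctype {1..n} (\<sigma> \<circ> a) L \<and> ctype {1..n} (b \<circ> \<tau>) M \<and>
      ctype {1..n} ((\<sigma> \<circ> a) \<circ> (b \<circ> \<tau>)) (add_mset (Suc k + k') (K + K'))"
    if "marked_ctype {1..s} a 1 (Suc l) (mset ls')" "marked_ctype {1..s} b 1 (Suc m) (mset ms')"
      "marked_ctype {1..s} (a \<circ> b) 1 (Suc k) K" for a b k K
    using that by blast
  define F where "F C = add_mset (length (hd C) + k') (mset (map length (tl C)) + K')"
    for C :: "nat list list"
  have nz: "0 \<notin> set ls" using assms(1) by (auto simp: core_def)
  have A: "marked_ctype {1..s} (perm_of (standard_cycles ls)) 1 (Suc l) (mset ls')"
    using std_marked[of l ls'] nz unfolding lm(1) s(1) .
  have F: "F C \<in> product_types n L M" if "(B, C) \<in> set ws" for B C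
  proof -
    have w: "witness ls ms B C" "hd (concat B) = 1" "hd (concat C) = 1" "C \<noteq> []"
      using assms(1) that by (auto simp: core_def list_all_iff)
    have B: "arrangement s B" "map length B = Suc m # ms'" and C: "arrangement s C"
      using w(1) by (auto simp: witness_def s_def lm(2))
    obtain k where k: "length (hd C) = Suc k"
      "marked_ctype {1..s} (perm_of C) 1 (Suc k) (mset (map length (tl C)))"
      using arrangement_mctype[OF C w(3,4)] by blast
    then have "marked_ctype {1..s} (perm_of (standard_cycles ls) \<circ> perm_of B) 1 (Suc k) (mset (map length (tl C)))"
      using wit_mult[OF nz w(1)] by simp
    note e = ext[OF A arrangement_marked[OF B w(2)] this]
    have "F C = add_mset (Suc k + k') (mset (map length (tl C)) + K')"
      unfolding F_def k(1) ..
    then show ?thesis using e unfolding product_types_def by auto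
  qed
  have "distinct (map (F \<circ> snd) ws)"
    using separated_distinct[of snd ws k' K'] assms(1) unfolding core_def F_def comp_def by blast
  then have "card (set (map (F \<circ> snd) ws)) = length ws" using distinct_card length_map by metis
  moreover have "set (map (F \<circ> snd) ws) \<subseteq> product_types n L M" using F by auto
  ultimately show ?thesis by (intro exI[of _ "set (map (F \<circ> snd) ws)"]) simp
qed

lemma wit_ptypes:
  assumes "0 \<notin> set ls" "witness ls ms B C"
  shows "mset (map length C) \<in> product_types (sum_list ls) (mset ls) (mset ms)"
proof -
  have B: "arrangement (sum_list ls) B" "map length B = ms" and C: "arrangement (sum_list ls) C"
    using assms(2) by (auto simp: witness_def)
  show ?thesis
    using arrangement_ctype[OF arrangement_std(1)[OF assms(1)]] arrangement_ctype[OF B(1)]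
      arrangement_ctype[OF C]
    unfolding product_types_def wit_mult[OF assms, symmetric] arrangement_std(2)[OF assms(1)] B(2)
    by blast
qed

section \<open>Products of classes in the alternating group\<close>

definition conj_by :: "('a \<Rightarrow> 'a) \<Rightarrow> ('a \<Rightarrow> 'a) \<Rightarrow> 'a \<Rightarrow> 'a" where
  "conj_by g p = g \<circ> p \<circ> inv' g"

definition even_perms :: "nat \<Rightarrow> (nat \<Rightarrow> nat) set" where
  "even_perms n = {p. p permutes {1..n} \<and> evenperm p}"

lemma cj_mult: "g permutes S \<Longrightarrow> conj_by g (p \<circ> q) = conj_by g p \<circ> conj_by g q"
  by (simp add: conj_by_def fun_eq_iff permutes_inverses(2))

lemma cj_comp: "g permutes S \<Longrightarrow> h permutes S \<Longrightarrow> conj_by (g \<circ> h) p = conj_by g (conj_by h p)"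
  by (simp add: conj_by_def fun_eq_iff o_inv_distrib permutes_bij)

lemma cj_id [simp]: "conj_by id p = p"
  by (simp add: conj_by_def)

lemma cj_inv: "g permutes S \<Longrightarrow> conj_by (inv' g) (conj_by g p) = p"
  using cj_comp[OF permutes_inv, of g S g p] permutes_inv_o(2)[of g S] by simp

lemma ctype_cj: "ctype S p M \<Longrightarrow> g permutes S \<Longrightarrow> ctype S (conj_by g p) M"
  unfolding conj_by_def by (rule ctype_conj)

lemma ctype_imp_cj: "ctype S p M \<Longrightarrow> ctype S q M \<Longrightarrow> \<exists>g. g permutes S \<and> q = conj_by g p"
  unfolding conj_by_def by (rule ctype_imp_conj)

lemma evenperm_comp_permutes:
  assumes "p permutes S" "q permutes S" "finite S"
  shows "evenperm (p \<circ> q) \<longleftrightarrow> (evenperm p \<longleftrightarrow> evenperm q)"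
  using assms evenperm_comp permutation_permutes by blast

lemma evenperm_inv_permutes:
  assumes "p permutes S" "finite S"
  shows "evenperm (inv' p) \<longleftrightarrow> evenperm p"
  using assms evenperm_inv permutation_permutes by blast

lemma even_perms_comp: "p \<in> even_perms n \<Longrightarrow> q \<in> even_perms n \<Longrightarrow> p \<circ> q \<in> even_perms n"
  unfolding even_perms_def using evenperm_comp_permutes[of p "{1..n}" q] permutes_compose by auto

lemma even_perms_inv: "p \<in> even_perms n \<Longrightarrow> inv' p \<in> even_perms n"
  unfolding even_perms_def using evenperm_inv_permutes[of p "{1..n}"] permutes_inv by auto

lemma carrier_alt_group: "carrier (alt_group n) = even_perms n"
  by (auto simp: even_perms_def alt_group_carrier)

lemma even_perms_cj: "g \<in> even_perms n \<Longrightarrow> p \<in> even_perms n \<Longrightarrow> conj_by g p \<in> even_perms n"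
  unfolding conj_by_def by (intro even_perms_comp even_perms_inv)

text \<open>\<open>conj_class\<close> conjugates with the inverse on the left,
  \<open>conj_by\<close> with the inverse on the right; inversion permutes the group, so the classes
  agree.\<close>

lemma conj_class_alt: "conj_class (alt_group n) a = {conj_by u a |u. u \<in> even_perms n}"
proof -
  have "inv\<^bsub>alt_group n\<^esub> g \<otimes>\<^bsub>alt_group n\<^esub> a \<otimes>\<^bsub>alt_group n\<^esub> g = conj_by (inv' g) a"
    if "g \<in> even_perms n" for g
    using that alt_group_inv_equality[of g n] permutes_inv_inv[of g "{1..n}"]
    by (simp add: carrier_alt_group alt_group_mult conj_by_def even_perms_def)
  moreover have "\<exists>g \<in> even_perms n. u = inv' g" if "u \<in> even_perms n" for u
    using that even_perms_inv[OF that] permutes_inv_inv[of u "{1..n}"]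
    by (intro bexI[of _ "inv' u"]) (simp_all add: even_perms_def)
  ultimately show ?thesis
    unfolding conj_class_def carrier_alt_group using even_perms_inv
    by (intro Collect_cong) metis
qed

section \<open>Products of two classes and the number of classes in them\<close>

definition class_prod :: "nat \<Rightarrow> (nat \<Rightarrow> nat) \<Rightarrow> (nat \<Rightarrow> nat) \<Rightarrow> (nat \<Rightarrow> nat) set" where
  "class_prod n a b = {conj_by u a \<circ> conj_by v b |u v. u \<in> even_perms n \<and> v \<in> even_perms n}"

lemma set_mult_alt:
  "conj_class (alt_group n) a <#>\<^bsub>alt_group n\<^esub> conj_class (alt_group n) b = class_prod n a b"
  unfolding set_mult_def conj_class_alt alt_group_mult class_prod_def by blast

lemma class_prod_subset:
  assumes "a \<in> even_perms n" "b \<in> even_perms n"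
  shows "class_prod n a b \<subseteq> even_perms n"
  unfolding class_prod_def using assms even_perms_cj even_perms_comp by blast

lemma class_prod_cj:
  assumes "x \<in> class_prod n a b" "w \<in> even_perms n"
  shows "conj_by w x \<in> class_prod n a b"
proof -
  obtain u v where uv: "x = conj_by u a \<circ> conj_by v b" "u \<in> even_perms n" "v \<in> even_perms n"
    using assms(1) by (auto simp: class_prod_def)
  have p: "u permutes {1..n}" "v permutes {1..n}" "w permutes {1..n}"
    using uv(2,3) assms(2) by (auto simp: even_perms_def)
  have "conj_by w x = conj_by (w \<circ> u) a \<circ> conj_by (w \<circ> v) b"
    unfolding uv(1) cj_mult[OF p(3)] cj_comp[OF p(3,1)] cj_comp[OF p(3,2)] ..
  then show ?thesis
    unfolding class_prod_def using even_perms_comp assms(2) uv(2,3) by blast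
qed

lemma finite_even_perms: "finite (even_perms n)"
  unfolding even_perms_def by (rule finite_subset[OF _ finite_permutations[of "{1..n}"]]) auto

lemma id_even_perms: "id \<in> even_perms n"
  by (auto simp: even_perms_def permutes_id evenperm_id simp del: id_apply)

lemma self_in_conj_class: "x \<in> conj_class (alt_group n) x"
  unfolding conj_class_alt using id_even_perms cj_id by (metis (mono_tags, lifting) mem_Collect_eq)

text \<open>The product is closed under conjugation, so it contains the full class of each of its
  elements; pairwise non-conjugate elements then give different classes. Finiteness of the group
  makes \<open>card\<close> in \<open>eta\<close> a genuine count.\<close>

lemma card_le_eta:
  assumes "a \<in> even_perms n" "b \<in> even_perms n" "F \<subseteq> class_prod n a b"
    and "\<And>x y. x \<in> F \<Longrightarrow> y \<in> F \<Longrightarrow> y \<in> conj_class (alt_group n) x \<Longrightarrow> x = y"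
  shows "card F \<le> eta (alt_group n) (class_prod n a b)"
proof -
  let ?c = "conj_class (alt_group n)"
  have "inj_on ?c F" using assms(4) self_in_conj_class by (metis inj_onI)
  then have "card F = card (?c ` F)" by (simp add: card_image)
  also have "\<dots> \<le> eta (alt_group n) (class_prod n a b)"
    unfolding eta_def
  proof (rule card_mono)
    show "finite {C \<in> conj_classes (alt_group n). C \<subseteq> class_prod n a b}"
      unfolding conj_classes_def carrier_alt_group using finite_even_perms by auto
    show "?c ` F \<subseteq> {C \<in> conj_classes (alt_group n). C \<subseteq> class_prod n a b}"
    proof clarify
      fix x assume x: "x \<in> F"
      then have "x \<in> class_prod n a b" using assms(3) by blast
      moreover from this have "x \<in> carrier (alt_group n)"
        using class_prod_subset assms(1,2) carrier_alt_group by blast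
      moreover from calculation(1) have "?c x \<subseteq> class_prod n a b"
        unfolding conj_class_alt using class_prod_cj by blast
      ultimately show "?c x \<in> conj_classes (alt_group n) \<and> ?c x \<subseteq> class_prod n a b"
        unfolding conj_classes_def by blast
    qed
  qed
  finally show ?thesis .
qed

lemma ctype_conj_class:
  "ctype {1..n} x K \<Longrightarrow> y \<in> conj_class (alt_group n) x \<Longrightarrow> ctype {1..n} y K"
  unfolding conj_class_alt even_perms_def by (auto intro: ctype_cj)

lemma ctypes_le_eta:
  assumes "a \<in> even_perms n" "b \<in> even_perms n" "finite T"
    and "\<And>K. K \<in> T \<Longrightarrow> \<exists>x \<in> class_prod n a b. ctype {1..n} x K"
  shows "card T \<le> eta (alt_group n) (class_prod n a b)"
proof -
  obtain f where f: "\<And>K. K \<in> T \<Longrightarrow> f K \<in> class_prod n a b \<and> ctype {1..n} (f K) K"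
    using assms(4) by metis
  have "inj_on f T" using f ctype_unique by (metis inj_onI)
  moreover have "card (f ` T) \<le> eta (alt_group n) (class_prod n a b)"
  proof (rule card_le_eta[OF assms(1,2)])
    show "f ` T \<subseteq> class_prod n a b" using f by blast
    fix x y assume "x \<in> f ` T" "y \<in> f ` T" and y: "y \<in> conj_class (alt_group n) x"
    then obtain K K' where K: "x = f K" "K \<in> T" "y = f K'" "K' \<in> T" by blast
    then have "ctype {1..n} y K" using y f ctype_conj_class by blast
    then have "K = K'" using K f ctype_unique by blast
    then show "x = y" using K by simp
  qed
  ultimately show ?thesis by (simp add: card_image)
qed

text \<open>Serves degree six: the type \<open>K0\<close> is counted twice, through representatives
  of two different classes. Non-conjugacy is assumed in both directions because
  \<open>card_le_eta\<close> compares ordered pairs.\<close>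

lemma ctypes_split_le_eta:
  assumes "a \<in> even_perms n" "b \<in> even_perms n" "finite T"
    and "\<And>K. K \<in> T \<Longrightarrow> \<exists>x \<in> class_prod n a b. ctype {1..n} x K"
    and "K0 \<in> T" "x1 \<in> class_prod n a b" "x2 \<in> class_prod n a b"
    and "ctype {1..n} x1 K0" "ctype {1..n} x2 K0" 
    and "x2 \<notin> conj_class (alt_group n) x1" "x1 \<notin> conj_class (alt_group n) x2"
  shows "Suc (card T) \<le> eta (alt_group n) (class_prod n a b)"
proof -
  obtain f where f: "\<And>K. K \<in> T \<Longrightarrow> f K \<in> class_prod n a b \<and> ctype {1..n} (f K) K"
    using assms(4) by metis
  let ?T = "T - {K0}"
  have inj: "inj_on f ?T" using f ctype_unique by (metis DiffD1 inj_onI)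
  have ne: "x1 \<noteq> x2" using assms(10) self_in_conj_class by metis
  have x: "x1 \<notin> f ` ?T" "x2 \<notin> f ` ?T" using assms(8,9) f ctype_unique by blast+
  have "card (insert x1 (insert x2 (f ` ?T))) = Suc (Suc (card ?T))"
    using ne x assms(3) card_image[OF inj] by simp
  also have "\<dots> = Suc (card T)" using assms(3,5) by (metis card_Suc_Diff1)
  finally have "card (insert x1 (insert x2 (f ` ?T))) = Suc (card T)" .
  moreover have "card (insert x1 (insert x2 (f ` ?T))) \<le> eta (alt_group n) (class_prod n a b)"
  proof (rule card_le_eta[OF assms(1,2)])
    show "insert x1 (insert x2 (f ` ?T)) \<subseteq> class_prod n a b" using f assms(6,7) by auto
    fix x y assume "x \<in> insert x1 (insert x2 (f ` ?T))" "y \<in> insert x1 (insert x2 (f ` ?T))"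
      and y: "y \<in> conj_class (alt_group n) x"
    then consider "x \<in> {x1, x2}" "y \<in> {x1, x2}" | K where "x \<in> {x1, x2}" "y = f K" "K \<in> ?T"
      | K where "y \<in> {x1, x2}" "x = f K" "K \<in> ?T"
      | K K' where "x = f K" "K \<in> ?T" "y = f K'" "K' \<in> ?T" by blast
    then show "x = y"
    proof cases
      case 1
      then show ?thesis using y assms(10,11) by auto
    next
      case 2
      then have "ctype {1..n} y K0" using y assms(8,9) ctype_conj_class by blast
      then show ?thesis using 2 f ctype_unique by blast
    next
      case 3
      then have "ctype {1..n} y K" using y f ctype_conj_class by blast
      then show ?thesis using 3 assms(8,9) ctype_unique by blast
    next
      case 4
      then have "ctype {1..n} y K" using y f ctype_conj_class by blast
      then show ?thesis using 4 f ctype_unique by blast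
    qed
  qed
  ultimately show ?thesis by simp
qed

text \<open>The condition under which a class of the symmetric group inside the alternating group
  does not split.\<close>

definition nonsplit :: "nat multiset \<Rightarrow> bool" where
  "nonsplit L \<longleftrightarrow> (\<exists>k \<in># L. even k \<or> 2 \<le> count L k)"

section \<open>Odd elements of centralizers\<close>

lemma swap_lists:
  fixes cs ds :: "'a list"
  assumes "length cs = length ds" "distinct (cs @ ds)"
  shows "\<exists>c. c permutes set (cs @ ds) \<and> (evenperm c \<longleftrightarrow> even (length cs)) \<and>
    map c cs = ds \<and> map c ds = cs"
proof -
  define ps where "ps = map2 (\<lambda>x y. [x, y]) cs ds"
  have set_ps: "set (concat ps) = set cs \<union> set ds"
    using assms(1) unfolding ps_def by (induction cs ds rule: list_induct2) auto
  have d: "distinct (concat ps)"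
    using assms unfolding ps_def
  proof (induction cs ds rule: list_induct2)
    case (Cons x xs y ys)
    have "set (concat (map2 (\<lambda>x y. [x, y]) xs ys)) = set xs \<union> set ys"
      using Cons.hyps by (induction xs ys rule: list_induct2) auto
    then show ?case using Cons by auto
  qed simp
  have "(\<Sum>c\<leftarrow>ps. length c - 1) = length cs"
    using assms(1) unfolding ps_def by (induction cs ds rule: list_induct2) auto
  then have "evenperm (perm_of ps) \<longleftrightarrow> even (length cs)" using evenperm_perm_of[OF d] by simp
  moreover have sw: "perm_of ps (cs ! i) = ds ! i \<and> perm_of ps (ds ! i) = cs ! i"
    if "i < length cs" for i
  proof -
    have "[cs ! i, ds ! i] \<in> set ps"
      using that assms(1) unfolding ps_def by (auto simp: set_zip)
    then show ?thesis using perm_of_in[OF d] by simp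
  qed
  then have "map (perm_of ps) cs = ds" "map (perm_of ps) ds = cs"
    using assms(1) by (auto intro!: nth_equalityI)
  moreover have "perm_of ps permutes set (cs @ ds)" using perm_of_permutes[of ps] set_ps by simp
  ultimately show ?thesis by blast
qed

text \<open>A cycle of even length is itself odd and commutes with \<open>p\<close>. If instead two
  cycles have the same odd length, exchanging them position by position centralizes \<open>p\<close>
  and is a product of an odd number of transpositions.\<close>

lemma odd_centralizer:
  assumes "ctype S p L" "nonsplit L"
  shows "\<exists>c. c permutes S \<and> \<not> evenperm c \<and> conj_by c p = p"
proof -
  obtain css where p: "p = perm_of css" "distinct (concat css)" "[] \<notin> set css"
    "set (concat css) = S" "mset (map length css) = L"
    using assms(1) unfolding ctype_def by blast
  obtain k where k: "k \<in># L" "even k \<or> 2 \<le> count L k" using assms(2) by (auto simp: nonsplit_def)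
  show ?thesis
  proof (cases "even k")
    case True
    obtain cs where cs: "cs \<in> set css" "length cs = k" using k(1) p(5) by auto
    have d: "distinct cs" and ne: "cs \<noteq> []"
      using p(2,3) cs by (auto simp: distinct_concat_iff)
    let ?c = "cycle_of_list cs"
    have "set cs \<subseteq> S" using p(4) cs(1) by auto
    then have s: "?c permutes S" by (rule permutes_subset[OF cycle_permutes])
    moreover have "\<not> evenperm ?c"
      using evenperm_cycle_of_list[OF d] ne True cs(2) by (cases cs) auto
    \<comment> \<open>On \<open>set cs\<close> the permutation \<open>p\<close> acts as the cycle;
      off \<open>set cs\<close> the cycle does nothing and \<open>p\<close> does not lead into
      \<open>set cs\<close>.\<close>
    moreover have "?c \<circ> p = p \<circ> ?c"
    proof
      fix x
      show "(?c \<circ> p) x = (p \<circ> ?c) x"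
      proof (cases "x \<in> set cs")
        case True
        then have "p x = ?c x" "p (?c x) = ?c (?c x)"
          using perm_of_in[OF p(2) cs(1)] cycle_of_list_in[OF d] p(1) by auto
        then show ?thesis by simp
      next
        case False
        have "p x \<notin> set cs"
        proof
          assume "p x \<in> set cs"
          then obtain y where y: "y \<in> set cs" "p x = ?c y"
            using cycle_is_surj[OF d] by (metis imageE)
          then have "p x = p y" using perm_of_in[OF p(2) cs(1)] p(1) by simp
          then have "x = y" using permutes_inj[OF perm_of_permutes] p(1) by (metis injD)
          then show False using False y(1) by simp
        qed
        then show ?thesis using False by (simp add: id_outside_supp)
      qed
    qed
    then have "conj_by ?c p = p"
      using permutes_inv_o(1)[OF s] unfolding conj_by_def by (simp only: comp_assoc comp_id)
    ultimately show ?thesis by blast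
  next
    case False
    have "count (mset (map length css)) k = length (filter (\<lambda>cs. length cs = k) css)"
      by (induction css) auto
    then have "2 \<le> length (filter (\<lambda>cs. length cs = k) css)"
      using k(2) False p(5) by simp
    then obtain cs ds rest where f: "filter (\<lambda>cs. length cs = k) css = cs # ds # rest"
      by (auto simp: numeral_2_eq_2 Suc_le_length_iff)
    have "cs \<in> set (filter (\<lambda>cs. length cs = k) css)" "ds \<in> set (filter (\<lambda>cs. length cs = k) css)"
      unfolding f by simp_all
    then have len: "length cs = k" "length ds = k" and mem: "cs \<in> set css" "ds \<in> set css"
      by simp_all
    have "distinct css" using p(2,3) by (simp add: distinct_concat_iff)
    then have "distinct (cs # ds # rest)" by (simp flip: f)
    then have ne: "cs \<noteq> ds" by auto
    then have dis: "set cs \<inter> set ds = {}" and d: "distinct cs" "distinct ds"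
      using p(2) mem unfolding distinct_concat_iff by blast+
    obtain c where c: "c permutes set (cs @ ds)" "\<not> evenperm c" "map c cs = ds" "map c ds = cs"
      using swap_lists[of cs ds] len False dis d unfolding distinct_append by metis
    have "set (cs @ ds) \<subseteq> S" using p(4) mem by auto
    then have cS: "c permutes S" by (rule permutes_subset[OF c(1)])
    have fix_c: "map c es = es" if "es \<in> set css" "es \<noteq> cs" "es \<noteq> ds" for es
    proof (rule map_idI)
      fix x assume x: "x \<in> set es"
      have "set es \<inter> set cs = {}" "set es \<inter> set ds = {}"
        using p(2) that mem by (auto simp: distinct_concat_iff)
      then have "x \<notin> set (cs @ ds)" using x by auto
      then show "c x = x" using c(1) permutes_not_in by metis
    qed
    have "map c es \<in> set css" if "es \<in> set css" for es
    proof -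
      consider "es = cs" | "es = ds" | "es \<noteq> cs" "es \<noteq> ds" by blast
      then show ?thesis using fix_c[OF that] c(3,4) mem that by cases simp_all
    qed
    moreover have "es \<in> map c ` set css" if "es \<in> set css" for es
    proof -
      consider "es = cs" | "es = ds" | "es \<noteq> cs" "es \<noteq> ds" by blast
      then show ?thesis using fix_c[OF that] c(3,4) mem that by cases (metis image_eqI)+
    qed
    \<comment> \<open>Relabelling by \<open>c\<close> exchanges \<open>cs\<close> and
      \<open>ds\<close> and keeps all other cycles, so the result has the same set of cycles as
      \<open>p\<close>.\<close>
    ultimately have "set (map (map c) css) = set css" by auto
    moreover have "distinct (concat (map (map c) css))"
      using p(2) permutes_inj_on[OF cS] by (simp add: distinct_map flip: map_concat)
    ultimately have "perm_of (map (map c) css) = p" unfolding p(1) by (intro perm_of_cong p(2))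
    then have "conj_by c p = p"
      unfolding conj_by_def using perm_of_conj[OF p(2) permutes_bij[OF cS]] p(1) by simp
    then show ?thesis using cS c(2) by blast
  qed
qed

text \<open>Replacing a conjugator of the first factor by its product with an odd centralizing element
  corrects a parity mismatch.\<close>

lemma class_prod_realize:
  assumes "n \<ge> 2" "g permutes {1..n}" "h permutes {1..n}" "evenperm g \<longleftrightarrow> evenperm h"
    and "ctype {1..n} (conj_by g a \<circ> conj_by h b) K"
  shows "\<exists>x \<in> class_prod n a b. ctype {1..n} x K"
proof (cases "evenperm g")
  case True
  then show ?thesis using assms unfolding class_prod_def even_perms_def by blast
next
  case False
  \<comment> \<open>Both conjugators are odd. Composing each with the same transposition makes both
    even and conjugates the whole product, which keeps its type.\<close>
  define t :: "nat \<Rightarrow> nat" where "t = transpose 1 2"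
  have t: "t permutes {1..n}" using assms(1) unfolding t_def by (intro permutes_swap_id) auto
  have ot: "\<not> evenperm t" unfolding t_def by (simp add: evenperm_swap)
  have "t \<circ> g \<in> even_perms n" "t \<circ> h \<in> even_perms n"
    using evenperm_comp_permutes[OF t assms(2)] evenperm_comp_permutes[OF t assms(3)] False ot
      assms(2,3,4) t permutes_compose unfolding even_perms_def by auto
  moreover have "ctype {1..n} (conj_by t (conj_by g a \<circ> conj_by h b)) K" using assms(5) t by (rule ctype_cj)
  then have "ctype {1..n} (conj_by (t \<circ> g) a \<circ> conj_by (t \<circ> h) b) K"
    using cj_mult[OF t] cj_comp[OF t assms(2)] cj_comp[OF t assms(3)] by simp
  ultimately show ?thesis unfolding class_prod_def by blast
qed

lemma ptypes_class_prod:
  assumes "n \<ge> 2" "ctype {1..n} a L" "ctype {1..n} b M" "K \<in> product_types n L M"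
    and "nonsplit L \<or> nonsplit M"
  shows "\<exists>x \<in> class_prod n a b. ctype {1..n} x K"
proof -
  obtain a' b' where ab: "ctype {1..n} a' L" "ctype {1..n} b' M" "ctype {1..n} (a' \<circ> b') K"
    using assms(4) by (auto simp: product_types_def)
  obtain g where g: "g permutes {1..n}" "a' = conj_by g a" using ctype_imp_cj[OF assms(2) ab(1)] by blast
  obtain h where h: "h permutes {1..n}" "b' = conj_by h b" using ctype_imp_cj[OF assms(3) ab(2)] by blast
  show ?thesis
  proof (cases "evenperm g \<longleftrightarrow> evenperm h")
    case True
    then show ?thesis using class_prod_realize[OF assms(1) g(1) h(1)] ab(3) g(2) h(2) by blast
  next
    case False
    from assms(5) show ?thesis
    proof
      assume "nonsplit L"
      then obtain c where c: "c permutes {1..n}" "\<not> evenperm c" "conj_by c a = a"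
        using odd_centralizer assms(2) by blast
      have "evenperm (g \<circ> c) \<longleftrightarrow> evenperm h"
        using False c(2) evenperm_comp_permutes[OF g(1) c(1)] by auto
      moreover have "conj_by (g \<circ> c) a = a'" using cj_comp[OF g(1) c(1)] c(3) g(2) by metis
      ultimately show ?thesis
        using class_prod_realize[OF assms(1) permutes_compose[OF c(1) g(1)] h(1)] ab(3) h(2) by metis
    next
      assume "nonsplit M"
      then obtain c where c: "c permutes {1..n}" "\<not> evenperm c" "conj_by c b = b"
        using odd_centralizer assms(3) by blast
      have "evenperm g \<longleftrightarrow> evenperm (h \<circ> c)"
        using False c(2) evenperm_comp_permutes[OF h(1) c(1)] by auto
      moreover have "conj_by (h \<circ> c) b = b'" using cj_comp[OF h(1) c(1)] c(3) h(2) by metis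
      ultimately show ?thesis
        using class_prod_realize[OF assms(1) g(1) permutes_compose[OF c(1) h(1)]] ab(3) g(2) by metis
    qed
  qed
qed

text \<open>These product types occur in the product of classes of the alternating group even when the
  classes of both factors split.\<close>

definition signed_product_types :: "nat \<Rightarrow> nat multiset \<Rightarrow> nat multiset \<Rightarrow> nat multiset set" where
  "signed_product_types n L M = {K. \<exists>a b h. ctype {1..n} a L \<and> ctype {1..n} b M \<and> h permutes {1..n} \<and>
     \<not> evenperm h \<and> ctype {1..n} (a \<circ> b) K \<and> ctype {1..n} (a \<circ> conj_by h b) K}"

text \<open>If the conjugators \<open>g\<close> and \<open>h\<close> disagree in parity, the second
  realization is used: its odd permutation \<open>w\<close> turns \<open>h\<close> into
  \<open>w \<circ> h\<close>, which agrees with \<open>g\<close>.\<close>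

lemma rtypes_class_prod:
  assumes "n \<ge> 2" "ctype {1..n} a L" "ctype {1..n} b M" "K \<in> signed_product_types n L M"
  shows "\<exists>x \<in> class_prod n a b. ctype {1..n} x K"
proof -
  obtain a' b' w where ab: "ctype {1..n} a' L" "ctype {1..n} b' M" "ctype {1..n} (a' \<circ> b') K"
    and w: "w permutes {1..n}" "\<not> evenperm w" "ctype {1..n} (a' \<circ> conj_by w b') K"
    using assms(4) by (auto simp: signed_product_types_def)
  obtain g where g: "g permutes {1..n}" "a' = conj_by g a" using ctype_imp_cj[OF assms(2) ab(1)] by blast
  obtain h where h: "h permutes {1..n}" "b' = conj_by h b" using ctype_imp_cj[OF assms(3) ab(2)] by blast
  show ?thesis
  proof (cases "evenperm g \<longleftrightarrow> evenperm h")
    case True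
    then show ?thesis using class_prod_realize[OF assms(1) g(1) h(1)] ab(3) g(2) h(2) by blast
  next
    case False
    then have "evenperm g \<longleftrightarrow> evenperm (w \<circ> h)"
      using evenperm_comp_permutes[OF w(1) h(1)] w(2) by auto
    moreover have "conj_by (w \<circ> h) b = conj_by w b'" using cj_comp[OF w(1) h(1)] h(2) by metis
    ultimately show ?thesis
      using class_prod_realize[OF assms(1) g(1) permutes_compose[OF h(1) w(1)]] w(3) g(2) by metis
  qed
qed


text \<open>An odd \<open>t\<close> is absorbed by odd elements centralizing each factor. Hence the
  product is a union of classes of the symmetric group, and a type whose class splits contributes
  both halves.\<close>

lemma class_prod_odd_cj:
  assumes "n \<ge> 2" "ctype {1..n} a L" "ctype {1..n} b M" "nonsplit L" "nonsplit M"
    and "x \<in> class_prod n a b" "t permutes {1..n}" "\<not> evenperm t"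
  shows "conj_by t x \<in> class_prod n a b"
proof -
  obtain u v where uv: "x = conj_by u a \<circ> conj_by v b" "u \<in> even_perms n" "v \<in> even_perms n"
    using assms(6) by (auto simp: class_prod_def)
  have p: "u permutes {1..n}" "v permutes {1..n}" and ev: "evenperm u" "evenperm v"
    using uv(2,3) by (auto simp: even_perms_def)
  obtain c where c: "c permutes {1..n}" "\<not> evenperm c" "conj_by c a = a"
    using odd_centralizer assms(2,4) by blast
  obtain d where d: "d permutes {1..n}" "\<not> evenperm d" "conj_by d b = b"
    using odd_centralizer assms(3,5) by blast
  note t = assms(7)
  have tu: "(t \<circ> u) permutes {1..n}" and tv: "(t \<circ> v) permutes {1..n}"
    using p t permutes_compose by blast+
  have "conj_by t x = conj_by (t \<circ> u) a \<circ> conj_by (t \<circ> v) b"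
    unfolding uv(1) cj_mult[OF t] cj_comp[OF t p(1)] cj_comp[OF t p(2)] ..
  also have "\<dots> = conj_by (t \<circ> u \<circ> c) a \<circ> conj_by (t \<circ> v \<circ> d) b"
    using cj_comp[OF tu c(1)] cj_comp[OF tv d(1)] c(3) d(3) by metis
  finally have "conj_by t x = conj_by (t \<circ> u \<circ> c) a \<circ> conj_by (t \<circ> v \<circ> d) b" .
  moreover have "(t \<circ> u \<circ> c) \<in> even_perms n" "(t \<circ> v \<circ> d) \<in> even_perms n"
    unfolding even_perms_def
    using permutes_compose[OF c(1) tu] permutes_compose[OF d(1) tv]
      evenperm_comp_permutes[OF tu c(1)] evenperm_comp_permutes[OF tv d(1)]
      evenperm_comp_permutes[OF t p(1)] evenperm_comp_permutes[OF t p(2)] assms(8) c(2) d(2) ev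
    by auto
  ultimately show ?thesis unfolding class_prod_def by blast
qed

text \<open>A permutation commuting with \<open>p\<close> fixes its only fixed point and is
  determined by the image of one point of the 5-cycle. It is therefore a power of \<open>p\<close>,
  and \<open>p\<close> is even.\<close>

lemma five_cycle_centralizer:
  fixes n :: nat
  assumes "ctype {1..n} p {#5, 1#}" "w permutes {1..n}" "conj_by w p = p"
  shows "evenperm w"
proof -
  have "mset [5, 1] = {#5, 1::nat#}" by simp
  then obtain css where css: "p = perm_of css" "distinct (concat css)" "set (concat css) = {1..n}"
    "map length css = [5, 1]"
    using ctype_list[of "{1..n}" p "[5, 1]"] assms(1) by auto
  then obtain C Z where CZ: "css = [C, Z]" "length C = 5" "length Z = 1" by (cases css) auto
  then obtain z where z: "css = [C, [z]]" by (cases Z) auto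
  have d: "distinct C" using css(2) z by simp
  have w: "w (p x) = p (w x)" for x
    using assms(3) permutes_inverses(2)[OF assms(2)] unfolding conj_by_def fun_eq_iff o_apply by metis
  have pw: "w ((p ^^ i) x) = (p ^^ i) (w x)" for i x
    by (induction i) (auto simp: w)
  have pC: "(p ^^ i) (C ! j) = C ! ((j + i) mod 5)" if "j < 5" for i j
    using funpow_perm_of[OF css(2), of C j i] that CZ z css(1) by simp
  have pz: "p z = z" using perm_of_in[OF css(2), of "[z]" z] css(1) z by simp
  have moved: "p x \<noteq> x" if x: "x \<in> set C" for x
  proof -
    obtain j where j: "j < 5" "x = C ! j" using x CZ(2) by (metis in_set_conv_nth)
    have "p x = C ! ((j + 1) mod 5)" using pC[OF j(1), of 1] j(2) by simp
    moreover have "(j + 1) mod 5 \<noteq> j" using j(1) by presburger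
    ultimately show ?thesis using j d CZ(2) by (simp add: nth_eq_iff_index_eq)
  qed
  have S: "{1..n} = insert z (set C)" using css(3) z by auto
  have inS: "w x \<in> insert z (set C)" if "x \<in> insert z (set C)" for x
    using that permutes_in_image[OF assms(2)] S by blast
  have "p (w z) = w z" using w[of z] pz by simp
  then have wz: "w z = z" using inS[of z] moved by blast
  have C0: "C ! 0 \<in> set C" using CZ(2) by simp
  then have "C ! 0 \<noteq> z" using css(2) z by auto
  then have "w (C ! 0) \<noteq> z" using wz permutes_inj[OF assms(2)] by (metis injD)
  then have "w (C ! 0) \<in> set C" using inS[of "C ! 0"] C0 by blast
  then obtain j where j: "j < 5" "w (C ! 0) = C ! j" using CZ(2) by (metis in_set_conv_nth)
  have "w = p ^^ j"
  proof
    fix x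
    consider "x \<in> set C" | "x = z" | "x \<notin> {1..n}" using S by blast
    then show "w x = (p ^^ j) x"
    proof cases
      case 1
      then obtain i where i: "i < 5" "x = C ! i" using CZ(2) by (metis in_set_conv_nth)
      have "x = (p ^^ i) (C ! 0)" using pC[of 0 i] i by simp
      then have "w x = (p ^^ i) (C ! j)" using pw j(2) by simp
      also have "\<dots> = C ! ((j + i) mod 5)" by (rule pC[OF j(1)])
      also have "\<dots> = (p ^^ j) x" using pC[OF i(1), of j] i(2) by (simp add: add.commute)
      finally show ?thesis .
    next
      case 2
      have "(p ^^ j) z = z" by (induction j) (auto simp: pz)
      then show ?thesis using 2 wz by simp
    next
      case 3
      have "p x = x" using 3 ctype_permutes[OF assms(1)] permutes_not_in by metis
      then have "(p ^^ j) x = x" by (induction j) auto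
      then show ?thesis using 3 assms(2) permutes_not_in by metis
    qed
  qed
  moreover have "evenperm (p ^^ i)" for i
  proof (induction i)
    case 0
    then show ?case using evenperm_id by (simp add: id_def)
  next
    case (Suc i)
    have "evenperm p" using ctype_evenperm[OF assms(1)] by simp
    then show ?case
      using Suc evenperm_comp_permutes[OF ctype_permutes[OF assms(1)]
          permutes_funpow[OF ctype_permutes[OF assms(1)]] finite_atLeastAtMost, of i]
      unfolding funpow.simps(2) by blast
  qed
  ultimately show ?thesis by simp
qed

text \<open>If an even \<open>u\<close> had the same effect on \<open>p\<close> as the odd
  \<open>t\<close>, then \<open>inv' u \<circ> t\<close> would be an odd element centralizing
  \<open>p\<close>.\<close>

lemma five_cycle_splits:
  assumes "ctype {1..n} p {#5, 1#}" "t permutes {1..n}" "\<not> evenperm t"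
  shows "conj_by t p \<notin> conj_class (alt_group n) p"
proof
  assume "conj_by t p \<in> conj_class (alt_group n) p"
  then obtain u where u: "u permutes {1..n}" "evenperm u" "conj_by t p = conj_by u p"
    by (auto simp: conj_class_alt even_perms_def)
  have iu: "inv' u permutes {1..n}" using u(1) by (rule permutes_inv)
  have "conj_by (inv' u \<circ> t) p = p"
    using cj_comp[OF iu assms(2)] u(3) cj_inv[OF u(1)] by metis
  then have "evenperm (inv' u \<circ> t)"
    using five_cycle_centralizer[OF assms(1)] permutes_compose[OF assms(2) iu] by blast
  then show False
    using evenperm_comp_permutes[OF iu assms(2)] evenperm_inv_permutes[OF u(1)] u(2) assms(3) by simp
qed

section \<open>Certificates for five product types\<close>

definition five_types :: "nat \<Rightarrow> nat multiset \<Rightarrow> nat multiset \<Rightarrow> bool" where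
  "five_types n L M \<longleftrightarrow> (\<exists>T \<subseteq> product_types n L M. finite T \<and> card T = 5)"

definition five_signed_types :: "nat \<Rightarrow> nat multiset \<Rightarrow> nat multiset \<Rightarrow> bool" where
  "five_signed_types n L M \<longleftrightarrow> (\<exists>T \<subseteq> signed_product_types n L M. finite T \<and> card T = 5)"

text \<open>Possible only for \<open>n = 6\<close>, as \<open>{#5, 1#}\<close> has to be the type of
  a product.\<close>

definition four_types_splitting :: "nat \<Rightarrow> nat multiset \<Rightarrow> nat multiset \<Rightarrow> bool" where
  "four_types_splitting n L M \<longleftrightarrow> (\<exists>T \<subseteq> product_types n L M. finite T \<and> card T = 4 \<and> {#5, 1#} \<in> T)"

section \<open>Symmetry in the two factors\<close>

lemma cj_swap: "g permutes S \<Longrightarrow> conj_by g (p \<circ> g) = g \<circ> p"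
  using permutes_inv_o(1)[of g S] by (simp only: conj_by_def comp_assoc comp_id)

text \<open>Conjugating \<open>a \<circ> b\<close> by \<open>b\<close> gives
  \<open>b \<circ> a\<close>.\<close>

lemma ptypes_sym: "product_types n L M \<subseteq> product_types n M L"
proof
  fix K assume "K \<in> product_types n L M"
  then obtain a b where ab: "ctype {1..n} a L" "ctype {1..n} b M" "ctype {1..n} (a \<circ> b) K"
    by (auto simp: product_types_def)
  have b: "b permutes {1..n}" using ab(2) by (rule ctype_permutes)
  have "ctype {1..n} (b \<circ> a) K" using ctype_cj[OF ab(3) b] unfolding cj_swap[OF b] .
  then show "K \<in> product_types n M L" using ab by (auto simp: product_types_def)
qed

text \<open>Conjugating the second product by the inverse of \<open>h\<close> removes
  \<open>h\<close> from \<open>b\<close> and puts its inverse, again odd, on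
  \<open>a\<close>.\<close>

lemma rtypes_sym: "signed_product_types n L M \<subseteq> signed_product_types n M L"
proof
  fix K assume "K \<in> signed_product_types n L M"
  then obtain a b h where ab: "ctype {1..n} a L" "ctype {1..n} b M" "ctype {1..n} (a \<circ> b) K"
    and h: "h permutes {1..n}" "\<not> evenperm h" "ctype {1..n} (a \<circ> conj_by h b) K"
    by (auto simp: signed_product_types_def)
  have b: "b permutes {1..n}" using ab(2) by (rule ctype_permutes)
  have ih: "inv' h permutes {1..n}" using h(1) by (rule permutes_inv)
  have 1: "ctype {1..n} (b \<circ> a) K" using ctype_cj[OF ab(3) b] unfolding cj_swap[OF b] .
  have "ctype {1..n} (b \<circ> conj_by (inv' h) a) K"
    using ctype_cj[OF ctype_cj[OF h(3) ih] b]
    unfolding cj_mult[OF ih] cj_inv[OF h(1)] cj_swap[OF b] .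
  moreover have "\<not> evenperm (inv' h)" using evenperm_inv_permutes[OF h(1)] h(2) by simp
  ultimately show "K \<in> signed_product_types n M L" unfolding signed_product_types_def using 1 ab ih by blast
qed

lemma five_sym: "five_types n L M \<Longrightarrow> five_types n M L"
  unfolding five_types_def using ptypes_sym[of n L M] by (meson subset_trans)

lemma rfive_sym: "five_signed_types n L M \<Longrightarrow> five_signed_types n M L"
  unfolding five_signed_types_def using rtypes_sym[of n L M] by (meson subset_trans)

lemma tight_sym: "four_types_splitting n L M \<Longrightarrow> four_types_splitting n M L"
  unfolding four_types_splitting_def using ptypes_sym[of n L M] by (meson subset_trans)

section \<open>Certificates in a fixed degree\<close>

definition exact :: "nat list \<Rightarrow> nat list \<Rightarrow> (nat list list \<times> nat list list) list \<Rightarrow> bool" where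
  "exact ls ms ws \<longleftrightarrow> 0 \<notin> set ls \<and> list_all (\<lambda>(B, C). witness ls ms B C) ws \<and>
     distinct (map (\<lambda>w. sort (map length (snd w))) ws)"

text \<open>Nothing is enlarged here, so no mark is kept and the product types need only differ as
  multisets.\<close>

lemma exact_ptypes:
  assumes "exact ls ms ws"
  defines "T \<equiv> set (map (\<lambda>w. mset (map length (snd w))) ws)"
  shows "T \<subseteq> product_types (sum_list ls) (mset ls) (mset ms)" "card T = length ws"
proof -
  show "T \<subseteq> product_types (sum_list ls) (mset ls) (mset ms)"
  proof
    fix K assume "K \<in> T"
    then obtain B C where "(B, C) \<in> set ws" "K = mset (map length C)" unfolding T_def by auto
    moreover from this have "0 \<notin> set ls" "witness ls ms B C"
      using assms(1) unfolding exact_def list_all_iff by blast+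
    ultimately show "K \<in> product_types (sum_list ls) (mset ls) (mset ms)" using wit_ptypes by blast
  qed
  have "distinct (map (\<lambda>w. sort (map length (snd w))) ws)" using assms by (simp add: exact_def)
  \<comment> \<open>Sorting factors through the multiset, so distinct sorted lists come from
    distinct multisets.\<close>
  also have "map (\<lambda>w. sort (map length (snd w))) ws
      = map sorted_list_of_multiset (map (\<lambda>w. mset (map length (snd w))) ws)"
    by (simp del: mset_map)
  finally have "distinct (map (\<lambda>w. mset (map length (snd w))) ws)" by (simp only: distinct_map)
  then show "card T = length ws" unfolding T_def by (simp only: distinct_card length_map)
qed

text \<open>The odd permutation with cycles \<open>H\<close> conjugates the second factor \<open>B\<close> without changing the
  type of the product.\<close>

definition signed_witness :: "nat list \<Rightarrow> nat list \<Rightarrow> nat list list \<Rightarrow> nat list list \<Rightarrow> nat list list \<Rightarrow>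
    nat list list \<Rightarrow> bool" where
  "signed_witness ls ms B H C C' \<longleftrightarrow> witness ls ms B C \<and> witness ls ms (map (map (apply_cycles H)) B) C' \<and>
     distinct (concat H) \<and> odd (\<Sum>c\<leftarrow>H. length c - 1) \<and>
     list_all (\<lambda>x. x \<in> set [1..<Suc (sum_list ls)]) (concat H)"

lemma rwitD:
  assumes "signed_witness ls ms B H C C'"
  shows "set (concat H) \<subseteq> {1..sum_list ls}" "perm_of H permutes {1..sum_list ls}" "\<not> evenperm (perm_of H)"
    "perm_of (map (map (apply_cycles H)) B) = conj_by (perm_of H) (perm_of B)"
proof -
  have d: "distinct (concat H)" using assms by (simp add: signed_witness_def)
  have "set (concat H) \<subseteq> set [1..<Suc (sum_list ls)]"
    using assms unfolding signed_witness_def list_all_iff by blast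
  then show S: "set (concat H) \<subseteq> {1..sum_list ls}"
    by (simp only: set_upt atLeastLessThanSuc_atLeastAtMost)
  show h: "perm_of H permutes {1..sum_list ls}"
    by (rule permutes_subset[OF perm_of_permutes S])
  show "\<not> evenperm (perm_of H)" using assms evenperm_perm_of[OF d] by (simp add: signed_witness_def)
  have B: "arrangement (sum_list ls) B" using assms by (simp add: signed_witness_def witness_def)
  show "perm_of (map (map (apply_cycles H)) B) = conj_by (perm_of H) (perm_of B)"
    unfolding conj_by_def perm_of_conj[OF arrangementD(1)[OF B] permutes_bij[OF h]]
      perm_of_nxt[OF d, symmetric] ..
qed

definition rexact :: "nat list \<Rightarrow> nat list \<Rightarrow>
    (nat list list \<times> nat list list \<times> nat list list \<times> nat list list) list \<Rightarrow> bool" where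
  "rexact ls ms ws \<longleftrightarrow> 0 \<notin> set ls \<and>
     list_all (\<lambda>(B, H, C, C'). signed_witness ls ms B H C C' \<and> sort (map length C) = sort (map length C')) ws \<and>
     distinct (map (\<lambda>(B, H, C, C'). sort (map length C)) ws) \<and> length ws = 5"

lemma rexact_rfive:
  assumes "rexact ls ms ws"
  shows "five_signed_types (sum_list ls) (mset ls) (mset ms)"
proof -
  let ?f = "\<lambda>(B :: nat list list, H :: nat list list, C :: nat list list, C' :: nat list list).
    mset (map length C)"
  have nz: "0 \<notin> set ls" using assms by (simp add: rexact_def)
  have "?f w \<in> signed_product_types (sum_list ls) (mset ls) (mset ms)" if "w \<in> set ws" for w
  proof -
    obtain B H C C' where w: "w = (B, H, C, C')" by (cases w) auto
    have r: "signed_witness ls ms B H C C'" "sort (map length C) = sort (map length C')"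
      using assms that unfolding w rexact_def list_all_iff by auto
    have witness: "witness ls ms B C" "witness ls ms (map (map (apply_cycles H)) B) C'"
      using r(1) by (auto simp: signed_witness_def)
    have B: "arrangement (sum_list ls) B" "map length B = ms"
      and C: "arrangement (sum_list ls) C" and C': "arrangement (sum_list ls) C'"
      using witness by (auto simp: witness_def)
    have m: "mset (map length C') = mset (map length C)" using r(2) by (metis mset_sort)
    note rD = rwitD[OF r(1)]
    show ?thesis
      using arrangement_ctype[OF arrangement_std(1)[OF nz]] arrangement_ctype[OF B(1)]
        arrangement_ctype[OF C] arrangement_ctype[OF C'] rD(2,3)
      unfolding wit_mult[OF nz witness(1), symmetric] wit_mult[OF nz witness(2), symmetric]
        arrangement_std(2)[OF nz] B(2) m w rD(4) signed_product_types_def by auto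
  qed
  then have sub: "set (map ?f ws) \<subseteq> signed_product_types (sum_list ls) (mset ls) (mset ms)" by auto
  have "distinct (map (\<lambda>(B, H, C, C'). sort (map length C)) ws)" "length ws = 5"
    using assms by (simp_all add: rexact_def)
  moreover have "(\<lambda>(B :: nat list list, H :: nat list list, C :: nat list list, C' :: nat list list).
      sort (map length C)) = (\<lambda>w. sorted_list_of_multiset (?f w))"
    by (auto simp: fun_eq_iff simp del: mset_map)
  ultimately have "distinct (map sorted_list_of_multiset (map ?f ws))" by (simp add: comp_def)
  then have "distinct (map ?f ws)" by (simp only: distinct_map)
  then have "card (set (map ?f ws)) = 5"
    using \<open>length ws = 5\<close> by (simp only: distinct_card length_map)
  then show ?thesis unfolding five_signed_types_def using sub by blast
qed

text \<open>The odd permutation \<open>H\<close> has to avoid the mark in order to commute with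
  everything glued to the second factor. The two products must agree in the marked length and in the
  rest separately, since only then do they grow to the same type.\<close>

definition rcore :: "nat list \<Rightarrow> nat list \<Rightarrow>
    (nat list list \<times> nat list list \<times> nat list list \<times> nat list list) list \<Rightarrow> bool" where
  "rcore ls ms ws \<longleftrightarrow> core ls ms (map (\<lambda>(B, H, C, C'). (B, C)) ws) \<and>
     core ls ms (map (\<lambda>(B, H, C, C'). (map (map (apply_cycles H)) B, C')) ws) \<and>
     list_all (\<lambda>(B, H, C, C'). signed_witness ls ms B H C C' \<and> 1 \<notin> set (concat H) \<and>
       length (hd C) = length (hd C') \<and> sort (map length (tl C)) = sort (map length (tl C'))) ws \<and>
     length ws = 5"

lemma rcore_rfive:
  assumes "rcore ls ms ws" "has_pattern ls L" "has_pattern ms M" "partition_of n L" "partition_of n M"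
  shows "five_signed_types n L M"
proof -
  have co: "core ls ms (map (\<lambda>(B, H, C, C'). (B, C)) ws)" using assms(1) by (simp add: rcore_def)
  obtain l ls' m ms' where lm: "ls = Suc l # ls'" "ms = Suc m # ms'"
    using co unfolding core_def
    by (cases ls; cases ms) (auto simp: not_less_eq_eq gr0_conv_Suc)
  define s where "s = sum_list ls"
  have s: "Suc l + sum_list ls' = s" "Suc m + sum_list ms' = s"
    using co unfolding s_def core_def lm by auto
  obtain \<sigma> \<tau> k' K' where \<tau>: "\<tau> permutes insert 1 {s<..n}" and
      "\<forall>a b k K. marked_ctype {1..s} a 1 (Suc l) (mset ls') \<longrightarrow>
      marked_ctype {1..s} b 1 (Suc m) (mset ms') \<longrightarrow> marked_ctype {1..s} (a \<circ> b) 1 (Suc k) K \<longrightarrow>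
      ctype {1..n} (\<sigma> \<circ> a) L \<and> ctype {1..n} (b \<circ> \<tau>) M \<and>
      ctype {1..n} ((\<sigma> \<circ> a) \<circ> (b \<circ> \<tau>)) (add_mset (Suc k + k') (K + K'))"
    using extend_pair[OF assms(4,5,2)[unfolded lm] assms(3)[unfolded lm] s] by blast
  then have ext: "ctype {1..n} (\<sigma> \<circ> a) L \<and> ctype {1..n} (b \<circ> \<tau>) M \<and>
      ctype {1..n} ((\<sigma> \<circ> a) \<circ> (b \<circ> \<tau>)) (add_mset (Suc k + k') (K + K'))"
    if "marked_ctype {1..s} a 1 (Suc l) (mset ls')" "marked_ctype {1..s} b 1 (Suc m) (mset ms')"
      "marked_ctype {1..s} (a \<circ> b) 1 (Suc k) K" for a b k K
    using that by blast
  define F where "F C = add_mset (length (hd C) + k') (mset (map length (tl C)) + K')"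
    for C :: "nat list list"
  have nz: "0 \<notin> set ls" using co by (auto simp: core_def)
  have A: "marked_ctype {1..s} (perm_of (standard_cycles ls)) 1 (Suc l) (mset ls')"
    using std_marked[of l ls'] nz unfolding lm(1) s(1) .
  have sn: "s \<le> n"
    using assms(2,4) s(1) unfolding has_pattern_def partition_of_def lm by (auto simp: sum_mset_sum_list)
  have E: "ctype {1..n} (\<sigma> \<circ> perm_of (standard_cycles ls)) L \<and> ctype {1..n} (perm_of B \<circ> \<tau>) M \<and>
      ctype {1..n} ((\<sigma> \<circ> perm_of (standard_cycles ls)) \<circ> (perm_of B \<circ> \<tau>)) (F C)"
    if w: "witness ls ms B C" "hd (concat B) = 1" "hd (concat C) = 1" "C \<noteq> []" for B C
  proof -
    have B: "arrangement s B" "map length B = Suc m # ms'" and C: "arrangement s C"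
      using w(1) by (auto simp: witness_def s_def lm(2))
    obtain k where k: "length (hd C) = Suc k"
      "marked_ctype {1..s} (perm_of C) 1 (Suc k) (mset (map length (tl C)))"
      using arrangement_mctype[OF C w(3,4)] by blast
    then have "marked_ctype {1..s} (perm_of (standard_cycles ls) \<circ> perm_of B) 1 (Suc k) (mset (map length (tl C)))"
      using wit_mult[OF nz w(1)] by simp
    note e = ext[OF A arrangement_marked[OF B w(2)] this]
    have "F C = add_mset (Suc k + k') (mset (map length (tl C)) + K')"
      unfolding F_def k(1) ..
    then show ?thesis using e by simp
  qed
  have F: "F (fst (snd (snd w))) \<in> signed_product_types n L M" if "w \<in> set ws" for w
  proof -
    obtain B H C C' where w: "w = (B, H, C, C')" by (cases w) auto
    have in1: "(B, C) \<in> set (map (\<lambda>(B, H, C, C'). (B, C)) ws)"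
      and in2: "(map (map (apply_cycles H)) B, C') \<in> set (map (\<lambda>(B, H, C, C'). (map (map (apply_cycles H)) B, C')) ws)"
      using that w by force+
    have r: "signed_witness ls ms B H C C'" "1 \<notin> set (concat H)" "length (hd C) = length (hd C')"
      "sort (map length (tl C)) = sort (map length (tl C'))"
      using assms(1) that unfolding w rcore_def list_all_iff by auto
    have E1: "ctype {1..n} (\<sigma> \<circ> perm_of (standard_cycles ls)) L \<and> ctype {1..n} (perm_of B \<circ> \<tau>) M \<and>
      ctype {1..n} ((\<sigma> \<circ> perm_of (standard_cycles ls)) \<circ> (perm_of B \<circ> \<tau>)) (F C)"
      using co in1 unfolding core_def list_all_iff by (intro E) blast+
    have E2: "ctype {1..n} ((\<sigma> \<circ> perm_of (standard_cycles ls)) \<circ> (perm_of (map (map (apply_cycles H)) B) \<circ> \<tau>)) (F C')"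
      using assms(1) in2 E[of "map (map (apply_cycles H)) B" C']
      unfolding rcore_def core_def[of ls ms "map (\<lambda>(B, H, C, C'). (map (map (apply_cycles H)) B, C')) ws"]
        list_all_iff by blast
    have FC: "F C' = F C"
      using r(3,4) unfolding F_def by (metis mset_sort)
    note rD = rwitD[OF r(1), folded s_def]
    let ?h = "perm_of H"
    have hn: "?h permutes {1..n}" using rD(2) by (rule permutes_subset) (use sn in auto)
    \<comment> \<open>\<open>H\<close> moves only old points other than the mark,
      \<open>\<tau>\<close> only the mark and new points. So conjugation by \<open>H\<close> passes
      through the glued factor and acts on \<open>B\<close> alone.\<close>
    have "set (concat H) \<inter> insert 1 {s<..n} = {}"
      using rD(1) r(2) by fastforce
    then have "?h \<circ> \<tau> = \<tau> \<circ> ?h" by (rule disjoint_permutes_commute[OF perm_of_permutes \<tau>])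
    then have "conj_by ?h \<tau> = \<tau>"
      using permutes_inv_o(1)[OF hn] unfolding conj_by_def by (simp only: comp_assoc comp_id)
    then have "conj_by ?h (perm_of B \<circ> \<tau>) = perm_of (map (map (apply_cycles H)) B) \<circ> \<tau>"
      unfolding cj_mult[OF hn] rD(4) by simp
    then have "ctype {1..n} ((\<sigma> \<circ> perm_of (standard_cycles ls)) \<circ> conj_by ?h (perm_of B \<circ> \<tau>)) (F C)"
      using E2 unfolding FC by metis
    then show ?thesis
      using E1 hn rD(3) unfolding signed_product_types_def w fst_conv snd_conv mem_Collect_eq by blast
  qed
  have "map (map length \<circ> snd) (map (\<lambda>(B, H, C, C'). (B, C)) ws)
      = map (map length \<circ> (\<lambda>w. fst (snd (snd w)))) ws" by auto
  then have "sorted_wrt separated (map (map length \<circ> (\<lambda>w. fst (snd (snd w)))) ws)"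
    using co unfolding core_def by metis
  then have "distinct (map (\<lambda>w. F (fst (snd (snd w)))) ws)"
    unfolding F_def by (rule separated_distinct)
  moreover have "length ws = 5" using assms(1) by (simp add: rcore_def)
  ultimately have "card (set (map (\<lambda>w. F (fst (snd (snd w)))) ws)) = 5"
    using distinct_card length_map by metis
  moreover have "set (map (\<lambda>w. F (fst (snd (snd w)))) ws) \<subseteq> signed_product_types n L M" using F by auto
  ultimately show ?thesis unfolding five_signed_types_def by blast
qed

definition five_core :: "nat list \<Rightarrow> nat list \<Rightarrow> bool" where
  "five_core ls ms \<longleftrightarrow> (\<exists>ws. core ls ms ws \<and> length ws = 5)"

lemma five_coreI: "core ls ms ws \<and> length ws = 5 \<Longrightarrow> five_core ls ms"
  unfolding five_core_def by blast

lemma five_coreD: "five_core ls ms \<Longrightarrow> partition_of n L \<Longrightarrow> partition_of n M \<Longrightarrow> has_pattern ls L \<Longrightarrow> has_pattern ms M \<Longrightarrow> five_types n L M"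
  unfolding five_core_def five_types_def using core_ptypes by metis

lemma five_coreD': "five_core ls ms \<Longrightarrow> partition_of n L \<Longrightarrow> partition_of n M \<Longrightarrow> has_pattern ms L \<Longrightarrow> has_pattern ls M \<Longrightarrow> five_types n L M"
  using five_coreD five_sym by blast

lemma five_exactI:
  assumes "exact ls ms ws \<and> length ws = 5"
  shows "five_types (sum_list ls) (mset ls) (mset ms)"
  unfolding five_types_def using assms exact_ptypes[of ls ms ws] by (metis List.finite_set)

text \<open>By convention the witness whose product has type \<open>{#5, 1#}\<close> stands first in
  the list.\<close>

lemma tightI:
  assumes "exact ls ms ws \<and> length ws = 4 \<and> sort (map length (snd (hd ws))) = [1, 5]"
  shows "four_types_splitting (sum_list ls) (mset ls) (mset ms)"
proof -
  have "mset (map length (snd (hd ws))) = mset [1, 5]" using assms by (metis mset_sort)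
  moreover have "ws \<noteq> []" using assms by auto
  ultimately have "{#5, 1#} \<in> set (map (\<lambda>w. mset (map length (snd w))) ws)"
    by (cases ws) (auto simp: add_mset_commute)
  then show ?thesis unfolding four_types_splitting_def using assms exact_ptypes[of ls ms ws] by (metis List.finite_set)
qed

section \<open>The certificates\<close>

text \<open>The witnesses below were found by computer search.\<close>

lemma core_1221_2211: "five_core [1, 2, 2, 1] [2, 2, 1, 1]"
  by (rule five_coreI[where ws = "[
   ([[1,2], [5,6], [3], [4]], [[1,3,2], [4,5,6]]),
   ([[1,2], [4,5], [3], [6]], [[1,3,2], [4], [5], [6]]),
   ([[1,2], [3,4], [5], [6]], [[1,3,5,4,2], [6]]),
   ([[1,2], [3,6], [4], [5]], [[1,3,6,2], [4,5]]),
   ([[1,6], [4,5], [2], [3]], [[1,6], [2,3], [4], [5]])]"]) code_simp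

lemma core_1221_51: "five_core [1, 2, 2, 1] [5, 1]"
  by (rule five_coreI[where ws = "[
   ([[1,2,3,4,5], [6]], [[1,3,5], [2], [4], [6]]),
   ([[1,2,3,4,6], [5]], [[1,3,5,4,6], [2]]),
   ([[1,2,4,3,6], [5]], [[1,3,6], [2,5,4]]),
   ([[1,2,4,5,3], [6]], [[1,3], [2,5], [4], [6]]),
   ([[1,2,4,6,5], [3]], [[1,3,2,5], [4,6]])]"]) code_simp

lemma core_15_33: "five_core [1, 5] [3, 3]"
  by (rule five_coreI[where ws = "[
   ([[1,2,3], [4,6,5]], [[1,3], [2,4], [5], [6]]),
   ([[1,2,4], [3,5,6]], [[1,3,6,4], [2,5]]),
   ([[1,2,4], [3,6,5]], [[1,3,2,5,4], [6]]),
   ([[1,2,5], [3,4,6]], [[1,3,5], [2,6,4]]),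
   ([[1,2,6], [3,5,4]], [[1,3,6], [2], [4], [5]])]"]) code_simp

lemma core_15_42: "five_core [1, 5] [4, 2]"
  by (rule five_coreI[where ws = "[
   ([[1,2,3,4], [5,6]], [[1,3,5,2,4], [6]]),
   ([[1,2,3,5], [4,6]], [[1,3,6,5], [2,4]]),
   ([[1,2,4,3], [5,6]], [[1,3], [2,5], [4], [6]]),
   ([[1,2,4,6], [3,5]], [[1,3,6], [2,5,4]]),
   ([[1,2,6,5], [3,4]], [[1,3,5], [2], [4], [6]])]"]) code_simp

lemma core_15_51: "five_core [1, 5] [5, 1]"
  by (rule five_coreI[where ws = "[
   ([[1,2,3,4,5], [6]], [[1,3,5], [2,4,6]]),
   ([[1,2,3,4,6], [5]], [[1,3,5,6], [2,4]]),
   ([[1,2,3,5,4], [6]], [[1,3,6,2,4], [5]]),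
   ([[1,2,5,4,3], [6]], [[1,3], [2,6], [4], [5]]),
   ([[1,2,6,5,4], [3]], [[1,3,4], [2], [5], [6]])]"]) code_simp

lemma core_15_6: "five_core [1, 5] [6]"
  by (rule five_coreI[where ws = "[
   ([[1,2,3,4,5,6]], [[1,3,5,2,4,6]]),
   ([[1,2,3,4,6,5]], [[1,3,5], [2,4], [6]]),
   ([[1,2,3,6,5,4]], [[1,3,2,4], [5], [6]]),
   ([[1,2,4,5,6,3]], [[1,3], [2,5], [4,6]]),
   ([[1,2,6,5,4,3]], [[1,3], [2], [4], [5], [6]])]"]) code_simp

lemma core_2211_24: "five_core [2, 2, 1, 1] [2, 4]"
  by (rule five_coreI[where ws = "[
   ([[1,2], [3,4,5,6]], [[1], [2], [3], [4,5,6]]),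
   ([[1,2], [3,5,4,6]], [[1], [2], [3,5], [4,6]]),
   ([[1,3], [2,4,5,6]], [[1,4,5,6], [2,3]]),
   ([[1,3], [2,5,4,6]], [[1,4,6], [2,5,3]]),
   ([[1,5], [2,3,4,6]], [[1,5,2,4,6], [3]])]"]) code_simp

lemma core_222_6: "five_core [2, 2, 2] [6]"
  by (rule five_coreI[where ws = "[
   ([[1,2,3,4,5,6]], [[1], [2,4,6], [3], [5]]),
   ([[1,2,3,5,6,4]], [[1], [2,4], [3,6], [5]]),
   ([[1,3,2,4,5,6]], [[1,4,6,2,3], [5]]),
   ([[1,3,2,5,4,6]], [[1,4,5,3], [2,6]]),
   ([[1,3,5,2,4,6]], [[1,4,5], [2,3,6]])]"]) code_simp

lemma core_24_24: "five_core [2, 4] [2, 4]"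
  by (rule five_coreI[where ws = "[
   ([[1,2], [3,4,5,6]], [[1], [2], [3,5], [4,6]]),
   ([[1,2], [3,4,6,5]], [[1], [2], [3,5,4], [6]]),
   ([[1,2], [3,6,5,4]], [[1], [2], [3], [4], [5], [6]]),
   ([[1,3], [2,4,5,6]], [[1,4,6], [2,5,3]]),
   ([[1,3], [2,4,6,5]], [[1,4,3,2,5], [6]])]"]) code_simp

lemma core_24_6: "five_core [2, 4] [6]"
  by (rule five_coreI[where ws = "[
   ([[1,2,3,6,5,4]], [[1], [2,4], [3], [5], [6]]),
   ([[1,3,2,4,5,6]], [[1,4,6,2,5,3]]),
   ([[1,3,2,4,6,5]], [[1,4,3], [2,5], [6]]),
   ([[1,3,2,6,5,4]], [[1,4,2,3], [5], [6]]),
   ([[1,3,4,2,5,6]], [[1,4], [2,6], [3,5]])]"]) code_simp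

lemma core_3111_51: "five_core [3, 1, 1, 1] [5, 1]"
  by (rule five_coreI[where ws = "[
   ([[1,2,3,4,5], [6]], [[1,3,4,5,2], [6]]),
   ([[1,3,2,4,5], [6]], [[1], [2,4,5], [3], [6]]),
   ([[1,3,4,2,5], [6]], [[1], [2,5], [3,4], [6]]),
   ([[1,4,2,5,6], [3]], [[1,4,3], [2,5,6]]),
   ([[1,4,5,2,6], [3]], [[1,4,5,3], [2,6]])]"]) code_simp

lemma core_33_33: "five_core [3, 3] [3, 3]"
  by (rule five_coreI[where ws = "[
   ([[1,2,3], [4,5,6]], [[1,3,2], [4,6,5]]),
   ([[1,2,3], [4,6,5]], [[1,3,2], [4], [5], [6]]),
   ([[1,2,4], [3,6,5]], [[1,3,4,2,5], [6]]),
   ([[1,3,2], [4,6,5]], [[1], [2], [3], [4], [5], [6]]),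
   ([[1,3,4], [2,6,5]], [[1], [2,4], [3,5], [6]])]"]) code_simp

lemma core_33_6: "five_core [3, 3] [6]"
  by (rule five_coreI[where ws = "[
   ([[1,2,3,4,5,6]], [[1,3,5,4,6,2]]),
   ([[1,2,3,4,6,5]], [[1,3,5,2], [4], [6]]),
   ([[1,2,4,3,6,5]], [[1,3,4], [2,5], [6]]),
   ([[1,3,2,4,6,5]], [[1], [2,5], [3], [4], [6]]),
   ([[1,4,2,5,3,6]], [[1,5], [2,6], [3,4]])]"]) code_simp

text \<open>Cores need not consist of even permutations: a 6-cycle is odd, and the missing parity is
  supplied by what is glued.\<close>

lemma core_6_6: "five_core [6] [6]"
  by (rule five_coreI[where ws = "[
   ([[1,2,3,4,5,6]], [[1,3,5], [2,4,6]]),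
   ([[1,2,3,4,6,5]], [[1,3,5,2,4], [6]]),
   ([[1,2,3,5,6,4]], [[1,3,6,5], [2,4]]),
   ([[1,2,3,6,5,4]], [[1,3], [2,4], [5], [6]]),
   ([[1,2,6,5,4,3]], [[1,3,2], [4], [5], [6]])]"]) code_simp

section \<open>Cores on seven points\<close>

lemma core_12211_322: "five_core [1, 2, 2, 1, 1] [3, 2, 2]"
  by (rule five_coreI[where ws = "[
   ([[1,2,3], [4,5], [6,7]], [[1,3], [2], [4], [5], [6,7]]),
   ([[1,2,3], [4,6], [5,7]], [[1,3], [2], [4,6,5,7]]),
   ([[1,2,4], [3,5], [6,7]], [[1,3,4], [2,5], [6,7]]),
   ([[1,2,4], [3,6], [5,7]], [[1,3,6,2,5,7,4]]),
   ([[1,2,6], [3,7], [4,5]], [[1,3,7,2,6], [4], [5]])]"]) code_simp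

lemma core_1222_421: "five_core [1, 2, 2, 2] [4, 2, 1]"
  by (rule five_coreI[where ws = "[
   ([[1,2,3,4], [6,7], [5]], [[1,3,5,4], [2], [6], [7]]),
   ([[1,2,3,4], [5,6], [7]], [[1,3,5,7,6,4], [2]]),
   ([[1,2,4,3], [6,7], [5]], [[1,3], [2,5,4], [6], [7]]),
   ([[1,2,4,6], [5,7], [3]], [[1,3,2,5,6], [4,7]]),
   ([[1,2,4,6], [3,7], [5]], [[1,3,6], [2,5,4,7]])]"]) code_simp

text \<open>The five products come from the possible positions of two 3-cycles: disjoint, sharing
  one point, sharing two points, and twice sharing all three. Of the witnesses that share two points
  or all three, the listed ones give a pair of 2-cycles, a 3-cycle and the identity in some of these
  positions; the mark is a common fixed point.\<close>

lemma core_13111_13111: "five_core [1, 3, 1, 1, 1] [1, 3, 1, 1, 1]"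
  by (rule five_coreI[where ws = "[
   ([[1], [5,6,7], [2], [3], [4]], [[1], [2,3,4], [5,6,7]]),
   ([[1], [4,5,6], [2], [3], [7]], [[1], [2,3,4,5,6], [7]]),
   ([[1], [3,4,5], [2], [6], [7]], [[1], [2,3], [4,5], [6], [7]]),
   ([[1], [3,5,4], [2], [6], [7]], [[1], [2,3,5], [4], [6], [7]]),
   ([[1], [2,4,3], [5], [6], [7]], [[1], [2], [3], [4], [5], [6], [7]])]"]) code_simp

lemma core_13111_22111: "five_core [1, 3, 1, 1, 1] [2, 2, 1, 1, 1]"
  by (rule five_coreI[where ws = "[
   ([[1,2], [6,7], [3], [4], [5]], [[1,3,4,2], [5], [6,7]]),
   ([[1,2], [4,5], [3], [6], [7]], [[1,3,4,5,2], [6], [7]]),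
   ([[1,2], [3,4], [5], [6], [7]], [[1,3,2], [4], [5], [6], [7]]),
   ([[1,5], [6,7], [2], [3], [4]], [[1,5], [2,3,4], [6,7]]),
   ([[1,5], [3,4], [2], [6], [7]], [[1,5], [2,3], [4], [6], [7]])]"]) code_simp

lemma core_13111_232: "five_core [1, 3, 1, 1, 1] [2, 3, 2]"
  by (rule five_coreI[where ws = "[
   ([[1,2], [5,6,7], [3,4]], [[1,3,2], [4], [5,6,7]]),
   ([[1,2], [4,6,7], [3,5]], [[1,3,5,4,6,7,2]]),
   ([[1,2], [3,4,5], [6,7]], [[1,3,2], [4,5], [6,7]]),
   ([[1,2], [3,5,4], [6,7]], [[1,3,5,2], [4], [6,7]]),
   ([[1,5], [2,4,3], [6,7]], [[1,5], [2], [3], [4], [6,7]])]"]) code_simp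

lemma core_13111_25: "five_core [1, 3, 1, 1, 1] [2, 5]"
  by (rule five_coreI[where ws = "[
   ([[1,2], [3,4,5,6,7]], [[1,3,2], [4,5,6,7]]),
   ([[1,2], [3,5,6,4,7]], [[1,3,5,6,2], [4,7]]),
   ([[1,2], [3,5,6,7,4]], [[1,3,5,6,7,2], [4]]),
   ([[1,5], [2,4,3,6,7]], [[1,5], [2], [3,6,7], [4]]),
   ([[1,5], [2,4,6,3,7]], [[1,5], [2], [3,7], [4,6]])]"]) code_simp

lemma core_13111_7: "five_core [1, 3, 1, 1, 1] [7]"
  by (rule five_coreI[where ws = "[
   ([[1,2,3,4,5,6,7]], [[1,3,2,4,5,6,7]]),
   ([[1,2,4,3,5,6,7]], [[1,3,5,6,7], [2], [4]]),
   ([[1,2,4,5,3,6,7]], [[1,3,6,7], [2], [4,5]]),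
   ([[1,2,4,5,6,3,7]], [[1,3,7], [2], [4,5,6]]),
   ([[1,2,5,4,6,3,7]], [[1,3,7], [2,5], [4,6]])]"]) code_simp

lemma core_133_232: "five_core [1, 3, 3] [2, 3, 2]"
  by (rule five_coreI[where ws = "[
   ([[1,2], [5,6,7], [3,4]], [[1,3,2], [4], [5,7,6]]),
   ([[1,2], [5,7,6], [3,4]], [[1,3,2], [4], [5], [6], [7]]),
   ([[1,2], [4,6,7], [3,5]], [[1,3,6,5,4,7,2]]),
   ([[1,2], [4,7,6], [3,5]], [[1,3,6,2], [4,5], [7]]),
   ([[1,2], [3,5,4], [6,7]], [[1,3,6,5,2], [4], [7]])]"]) code_simp

lemma core_133_34: "five_core [1, 3, 3] [3, 4]"
  by (rule five_coreI[where ws = "[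
   ([[1,2,3], [4,5,7,6]], [[1,3], [2,4,6], [5], [7]]),
   ([[1,2,4], [3,5,6,7]], [[1,3,6,5,7,4], [2]]),
   ([[1,2,4], [3,5,7,6]], [[1,3,6,4], [2], [5], [7]]),
   ([[1,2,5], [3,4,6,7]], [[1,3,2,6,5], [4,7]]),
   ([[1,2,5], [3,7,4,6]], [[1,3,5], [2,6,4,7]])]"]) code_simp

lemma core_133_421: "five_core [1, 3, 3] [4, 2, 1]"
  by (rule five_coreI[where ws = "[
   ([[1,2,3,4], [6,7], [5]], [[1,3,2,4], [5,6], [7]]),
   ([[1,2,3,5], [4,6], [7]], [[1,3,6,2,4,7,5]]),
   ([[1,2,4,3], [6,7], [5]], [[1,3], [2], [4], [5,6], [7]]),
   ([[1,2,4,5], [6,7], [3]], [[1,3,4,6,5], [2], [7]]),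
   ([[1,2,4,5], [3,7], [6]], [[1,3,5], [2], [4,6,7]])]"]) code_simp

lemma core_151_34: "five_core [1, 5, 1] [3, 4]"
  by (rule five_coreI[where ws = "[
   ([[1,2,3], [4,5,6,7]], [[1,3], [2,4,6,7,5]]),
   ([[1,2,3], [4,6,5,7]], [[1,3], [2,4], [5,7], [6]]),
   ([[1,2,3], [4,7,6,5]], [[1,3], [2,4,7], [5], [6]]),
   ([[1,2,4], [3,6,5,7]], [[1,3,2,5,7,4], [6]]),
   ([[1,2,6], [3,7,5,4]], [[1,3,7,6], [2], [4], [5]])]"]) code_simp

lemma core_22111_331: "five_core [2, 2, 1, 1, 1] [3, 3, 1]"
  by (rule five_coreI[where ws = "[
   ([[1,2,3], [5,6,7], [4]], [[1], [2,4,3], [5,6,7]]),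
   ([[1,2,3], [4,5,6], [7]], [[1], [2,4,5,6,3], [7]]),
   ([[1,2,5], [4,6,7], [3]], [[1], [2,5], [3,4,6,7]]),
   ([[1,2,5], [3,4,6], [7]], [[1], [2,5], [3], [4,6], [7]]),
   ([[1,3,5], [4,6,7], [2]], [[1,4,6,7,3,5,2]])]"]) code_simp

lemma core_22111_7: "five_core [2, 2, 1, 1, 1] [7]"
  by (rule five_coreI[where ws = "[
   ([[1,2,3,5,6,4,7]], [[1], [2,4,7], [3,5,6]]),
   ([[1,3,2,4,5,6,7]], [[1,4,5,6,7,2,3]]),
   ([[1,3,4,2,5,6,7]], [[1,4], [2,5,6,7], [3]]),
   ([[1,3,4,5,6,7,2]], [[1,4,5,6,7], [2], [3]]),
   ([[1,3,5,4,6,2,7]], [[1,4,6], [2,7], [3,5]])]"]) code_simp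

lemma core_232_322: "five_core [2, 3, 2] [3, 2, 2]"
  by (rule five_coreI[where ws = "[
   ([[1,2,3], [4,5], [6,7]], [[1], [2,4,3], [5], [6], [7]]),
   ([[1,2,3], [4,6], [5,7]], [[1], [2,4,7,3], [5,6]]),
   ([[1,3,4], [2,5], [6,7]], [[1,4,2,3,5], [6], [7]]),
   ([[1,3,4], [2,6], [5,7]], [[1,4,2,7,3,5,6]]),
   ([[1,3,5], [2,6], [4,7]], [[1,4,6], [2,7,5], [3]])]"]) code_simp

lemma core_232_511: "five_core [2, 3, 2] [5, 1, 1]"
  by (rule five_coreI[where ws = "[
   ([[1,2,3,4,5], [6], [7]], [[1], [2,4,3,5], [6,7]]),
   ([[1,2,3,5,4], [6], [7]], [[1], [2,4], [3], [5], [6,7]]),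
   ([[1,2,3,5,6], [4], [7]], [[1], [2,4,5,7,6], [3]]),
   ([[1,2,3,6,5], [4], [7]], [[1], [2,4,5], [3,7,6]]),
   ([[1,3,2,4,6], [5], [7]], [[1,4,7,6,2,5,3]])]"]) code_simp

lemma core_241_322: "five_core [2, 4, 1] [3, 2, 2]"
  by (rule five_coreI[where ws = "[
   ([[1,2,3], [4,5], [6,7]], [[1], [2,4,6,7,3], [5]]),
   ([[1,2,3], [4,6], [5,7]], [[1], [2,4,3], [5,7,6]]),
   ([[1,2,7], [3,4], [5,6]], [[1], [2,7], [3,5], [4], [6]]),
   ([[1,2,7], [3,5], [4,6]], [[1], [2,7], [3,6,5,4]]),
   ([[1,3,4], [2,5], [6,7]], [[1,4,2,6,7,3,5]])]"]) code_simp

lemma core_25_25: "five_core [2, 5] [2, 5]"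
  by (rule five_coreI[where ws = "[
   ([[1,2], [3,4,5,6,7]], [[1], [2], [3,5,7,4,6]]),
   ([[1,2], [3,4,5,7,6]], [[1], [2], [3,5], [4,6], [7]]),
   ([[1,2], [3,4,7,6,5]], [[1], [2], [3,5,4], [6], [7]]),
   ([[1,2], [3,7,6,5,4]], [[1], [2], [3], [4], [5], [6], [7]]),
   ([[1,3], [2,4,5,6,7]], [[1,4,6,3,2,5,7]])]"]) code_simp

lemma core_25_322: "five_core [2, 5] [3, 2, 2]"
  by (rule five_coreI[where ws = "[
   ([[1,2,3], [4,5], [6,7]], [[1], [2,4,6,3], [5], [7]]),
   ([[1,2,3], [4,7], [5,6]], [[1], [2,4,3], [5,7], [6]]),
   ([[1,3,2], [4,6], [5,7]], [[1,4,7,6,5,3], [2]]),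
   ([[1,3,4], [2,6], [5,7]], [[1,4,2,7,6], [3,5]]),
   ([[1,3,5], [2,6], [4,7]], [[1,4,3,6], [2,7,5]])]"]) code_simp

lemma core_25_34: "five_core [2, 5] [3, 4]"
  by (rule five_coreI[where ws = "[
   ([[1,2,3], [4,5,6,7]], [[1], [2,4,6,3], [5,7]]),
   ([[1,2,3], [4,5,7,6]], [[1], [2,4,6,5,3], [7]]),
   ([[1,2,3], [4,7,5,6]], [[1], [2,4,3], [5,7,6]]),
   ([[1,2,3], [4,7,6,5]], [[1], [2,4,3], [5], [6], [7]]),
   ([[1,3,4], [2,5,6,7]], [[1,4,2,6,3,5,7]])]"]) code_simp

lemma core_31111_331: "five_core [3, 1, 1, 1, 1] [3, 3, 1]"
  by (rule five_coreI[where ws = "[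
   ([[1,2,3], [5,6,7], [4]], [[1,3,2], [4], [5,6,7]]),
   ([[1,2,4], [5,6,7], [3]], [[1,3], [2,4], [5,6,7]]),
   ([[1,2,4], [3,5,6], [7]], [[1,3,5,6], [2,4], [7]]),
   ([[1,3,2], [5,6,7], [4]], [[1], [2], [3], [4], [5,6,7]]),
   ([[1,4,2], [3,5,6], [7]], [[1,4,3,5,6], [2], [7]])]"]) code_simp

lemma core_31111_421: "five_core [3, 1, 1, 1, 1] [4, 2, 1]"
  by (rule five_coreI[where ws = "[
   ([[1,2,3,4], [6,7], [5]], [[1,3,4,2], [5], [6,7]]),
   ([[1,2,4,5], [6,7], [3]], [[1,3], [2,4,5], [6,7]]),
   ([[1,2,4,5], [3,6], [7]], [[1,3,6], [2,4,5], [7]]),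
   ([[1,3,2,4], [6,7], [5]], [[1], [2,4], [3], [5], [6,7]]),
   ([[1,4,5,2], [3,6], [7]], [[1,4,5,3,6], [2], [7]])]"]) code_simp

section \<open>Cores on eight points\<close>

lemma core_122111_2222: "five_core [1, 2, 2, 1, 1, 1] [2, 2, 2, 2]"
  by (rule five_coreI[where ws = "[
   ([[1,2], [3,4], [5,6], [7,8]], [[1,3,5,6,4,2], [7,8]]),
   ([[1,2], [3,6], [4,5], [7,8]], [[1,3,6,2], [4], [5], [7,8]]),
   ([[1,2], [3,6], [4,7], [5,8]], [[1,3,6,2], [4,7,5,8]]),
   ([[1,6], [2,3], [4,5], [7,8]], [[1,6], [2], [3], [4], [5], [7,8]]),
   ([[1,6], [2,4], [3,5], [7,8]], [[1,6], [2,5], [3,4], [7,8]])]"]) code_simp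

lemma core_122111_26: "five_core [1, 2, 2, 1, 1, 1] [2, 6]"
  by (rule five_coreI[where ws = "[
   ([[1,2], [3,4,5,6,7,8]], [[1,3,5,6,7,8,2], [4]]),
   ([[1,2], [3,4,6,5,7,8]], [[1,3,5,7,8,2], [4,6]]),
   ([[1,2], [3,4,6,7,5,8]], [[1,3,5,8,2], [4,6,7]]),
   ([[1,2], [3,4,6,7,8,5]], [[1,3,5,2], [4,6,7,8]]),
   ([[1,6], [2,3,4,5,7,8]], [[1,6], [2], [3,5,7,8], [4]])]"]) code_simp

lemma core_131111_233: "five_core [1, 3, 1, 1, 1, 1] [2, 3, 3]"
  by (rule five_coreI[where ws = "[
   ([[1,2], [3,5,4], [6,7,8]], [[1,3,5,2], [4], [6,7,8]]),
   ([[1,2], [3,5,6], [4,7,8]], [[1,3,5,6,4,7,8,2]]),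
   ([[1,5], [2,3,4], [6,7,8]], [[1,5], [2,4,3], [6,7,8]]),
   ([[1,5], [2,3,6], [4,7,8]], [[1,5], [2,4,7,8], [3,6]]),
   ([[1,5], [2,4,3], [6,7,8]], [[1,5], [2], [3], [4], [6,7,8]])]"]) code_simp

lemma core_131111_242: "five_core [1, 3, 1, 1, 1, 1] [2, 4, 2]"
  by (rule five_coreI[where ws = "[
   ([[1,2], [5,6,7,8], [3,4]], [[1,3,2], [4], [5,6,7,8]]),
   ([[1,2], [4,6,7,8], [3,5]], [[1,3,5,4,6,7,8,2]]),
   ([[1,2], [3,4,5,6], [7,8]], [[1,3,2], [4,5,6], [7,8]]),
   ([[1,2], [3,5,4,6], [7,8]], [[1,3,5,2], [4,6], [7,8]]),
   ([[1,2], [3,5,6,4], [7,8]], [[1,3,5,6,2], [4], [7,8]])]"]) code_simp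

lemma core_131111_26: "five_core [1, 3, 1, 1, 1, 1] [2, 6]"
  by (rule five_coreI[where ws = "[
   ([[1,2], [3,4,5,6,7,8]], [[1,3,2], [4,5,6,7,8]]),
   ([[1,2], [3,5,6,7,4,8]], [[1,3,5,6,7,2], [4,8]]),
   ([[1,2], [3,5,6,7,8,4]], [[1,3,5,6,7,8,2], [4]]),
   ([[1,5], [2,4,3,6,7,8]], [[1,5], [2], [3,6,7,8], [4]]),
   ([[1,5], [2,4,6,3,7,8]], [[1,5], [2], [3,7,8], [4,6]])]"]) code_simp

lemma core_1322_2222: "five_core [1, 3, 2, 2] [2, 2, 2, 2]"
  by (rule five_coreI[where ws = "[
   ([[1,2], [3,4], [5,6], [7,8]], [[1,3,2], [4], [5], [6], [7], [8]]),
   ([[1,2], [3,4], [5,7], [6,8]], [[1,3,2], [4], [5,8], [6,7]]),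
   ([[1,2], [3,5], [4,6], [7,8]], [[1,3,6,2], [4,5], [7], [8]]),
   ([[1,2], [3,5], [4,7], [6,8]], [[1,3,6,7,2], [4,8,5]]),
   ([[1,5], [2,3], [4,6], [7,8]], [[1,6,2,4,5], [3], [7], [8]])]"]) code_simp

lemma core_1322_44: "five_core [1, 3, 2, 2] [4, 4]"
  by (rule five_coreI[where ws = "[
   ([[1,2,3,4], [5,6,7,8]], [[1,3,2,4], [5], [6,8], [7]]),
   ([[1,2,3,4], [5,7,6,8]], [[1,3,2,4], [5,8,6,7]]),
   ([[1,2,3,5], [4,6,7,8]], [[1,3,6,8,2,4,5], [7]]),
   ([[1,2,3,5], [4,7,6,8]], [[1,3,6,7,5], [2,4,8]]),
   ([[1,2,4,3], [5,6,7,8]], [[1,3], [2], [4], [5], [6,8], [7]])]"]) code_simp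

lemma core_1331_2222: "five_core [1, 3, 3, 1] [2, 2, 2, 2]"
  by (rule five_coreI[where ws = "[
   ([[1,2], [3,4], [5,6], [7,8]], [[1,3,2], [4], [5,7,8], [6]]),
   ([[1,2], [3,5], [4,6], [7,8]], [[1,3,6,2], [4,7,8,5]]),
   ([[1,2], [3,5], [4,7], [6,8]], [[1,3,6,8,7,2], [4,5]]),
   ([[1,2], [3,5], [4,8], [6,7]], [[1,3,6,5,4,8,2], [7]]),
   ([[1,8], [2,5], [3,7], [4,6]], [[1,8], [2,6], [3,5], [4,7]])]"]) code_simp

lemma core_143_2222: "five_core [1, 4, 3] [2, 2, 2, 2]"
  by (rule five_coreI[where ws = "[
   ([[1,2], [3,4], [5,6], [7,8]], [[1,3,5,7,6,2], [4], [8]]),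
   ([[1,2], [3,5], [4,6], [7,8]], [[1,3,2], [4,7,6,5], [8]]),
   ([[1,2], [3,6], [4,7], [5,8]], [[1,3,7,5,6,4,8,2]]),
   ([[1,2], [3,6], [4,8], [5,7]], [[1,3,7,2], [4,6], [5,8]]),
   ([[1,6], [2,3], [4,5], [7,8]], [[1,7,6], [2,4], [3], [5], [8]])]"]) code_simp

lemma core_1511_2222: "five_core [1, 5, 1, 1] [2, 2, 2, 2]"
  by (rule five_coreI[where ws = "[
   ([[1,2], [3,4], [5,6], [7,8]], [[1,3,5,2], [4], [6], [7,8]]),
   ([[1,2], [3,4], [5,7], [6,8]], [[1,3,5,7,6,8,2], [4]]),
   ([[1,2], [3,5], [4,6], [7,8]], [[1,3,6,5,4,2], [7,8]]),
   ([[1,2], [3,5], [4,7], [6,8]], [[1,3,6,8,2], [4,7,5]]),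
   ([[1,2], [3,6], [4,5], [7,8]], [[1,3,2], [4,6], [5], [7,8]])]"]) code_simp

lemma core_221111_233: "five_core [2, 2, 1, 1, 1, 1] [2, 3, 3]"
  by (rule five_coreI[where ws = "[
   ([[1,2], [3,4,5], [6,7,8]], [[1], [2], [3], [4,5], [6,7,8]]),
   ([[1,3], [2,4,5], [6,7,8]], [[1,4,5], [2,3], [6,7,8]]),
   ([[1,3], [2,5,6], [4,7,8]], [[1,4,7,8,3,2,5,6]]),
   ([[1,5], [2,3,4], [6,7,8]], [[1,5,2,4], [3], [6,7,8]]),
   ([[1,5], [2,6,7], [3,4,8]], [[1,5,2,6,7], [3], [4,8]])]"]) code_simp

lemma core_221111_35: "five_core [2, 2, 1, 1, 1, 1] [3, 5]"
  by (rule five_coreI[where ws = "[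
   ([[1,2,5], [3,4,6,7,8]], [[1], [2,5], [3], [4,6,7,8]]),
   ([[1,2,5], [3,6,4,7,8]], [[1], [2,5], [3,6], [4,7,8]]),
   ([[1,3,2], [4,5,6,7,8]], [[1,4,5,6,7,8,3], [2]]),
   ([[1,3,5], [2,4,6,7,8]], [[1,4,6,7,8], [2,3,5]]),
   ([[1,3,5], [2,6,4,7,8]], [[1,4,7,8], [2,6,3,5]])]"]) code_simp

lemma core_2222_2222: "five_core [2, 2, 2, 2] [2, 2, 2, 2]"
  by (rule five_coreI[where ws = "[
   ([[1,2], [3,4], [5,6], [7,8]], [[1], [2], [3], [4], [5], [6], [7], [8]]),
   ([[1,2], [3,4], [5,7], [6,8]], [[1], [2], [3], [4], [5,8], [6,7]]),
   ([[1,2], [3,5], [4,7], [6,8]], [[1], [2], [3,6,7], [4,8,5]]),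
   ([[1,3], [2,4], [5,7], [6,8]], [[1,4], [2,3], [5,8], [6,7]]),
   ([[1,3], [2,5], [4,7], [6,8]], [[1,4,8,5], [2,6,7,3]])]"]) code_simp

lemma core_2222_233: "five_core [2, 2, 2, 2] [2, 3, 3]"
  by (rule five_coreI[where ws = "[
   ([[1,2], [3,4,5], [6,7,8]], [[1], [2], [3], [4,6,8,5], [7]]),
   ([[1,2], [3,5,7], [4,6,8]], [[1], [2], [3,6,7,4,5,8]]),
   ([[1,2], [3,5,7], [4,8,6]], [[1], [2], [3,6], [4,7], [5,8]]),
   ([[1,3], [2,5,7], [4,6,8]], [[1,4,5,8,3,2,6,7]]),
   ([[1,3], [2,5,7], [4,8,6]], [[1,4,7], [2,6,3], [5,8]])]"]) code_simp

lemma core_2222_35: "five_core [2, 2, 2, 2] [3, 5]"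
  by (rule five_coreI[where ws = "[
   ([[1,2,3], [4,5,6,7,8]], [[1], [2,4,6,8,3], [5], [7]]),
   ([[1,2,3], [4,5,7,8,6]], [[1], [2,4,6,3], [5,8], [7]]),
   ([[1,3,2], [4,5,7,6,8]], [[1,4,6,7,5,8,3], [2]]),
   ([[1,3,5], [2,4,7,6,8]], [[1,4,8], [2,3,6,7,5]]),
   ([[1,3,5], [2,6,7,4,8]], [[1,4,7,3,6,8], [2,5]])]"]) code_simp

lemma core_2222_422: "five_core [2, 2, 2, 2] [4, 2, 2]"
  by (rule five_coreI[where ws = "[
   ([[1,2,3,4], [5,6], [7,8]], [[1], [2,4], [3], [5], [6], [7], [8]]),
   ([[1,2,3,4], [5,7], [6,8]], [[1], [2,4], [3], [5,8], [6,7]]),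
   ([[1,2,3,5], [4,6], [7,8]], [[1], [2,4,5], [3,6], [7], [8]]),
   ([[1,2,3,5], [4,7], [6,8]], [[1], [2,4,8,5], [3,6,7]]),
   ([[1,3,2,4], [5,6], [7,8]], [[1,4,2,3], [5], [6], [7], [8]])]"]) code_simp

lemma core_2222_44: "five_core [2, 2, 2, 2] [4, 4]"
  by (rule five_coreI[where ws = "[
   ([[1,2,3,4], [5,6,7,8]], [[1], [2,4], [3], [5], [6,8], [7]]),
   ([[1,2,3,4], [5,7,6,8]], [[1], [2,4], [3], [5,8,6,7]]),
   ([[1,2,3,5], [4,6,7,8]], [[1], [2,4,5], [3,6,8], [7]]),
   ([[1,2,3,5], [4,7,6,8]], [[1], [2,4,8,3,6,7,5]]),
   ([[1,3,5,7], [2,8,6,4]], [[1,4], [2,7], [3,6], [5,8]])]"]) code_simp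

lemma core_311111_44: "five_core [3, 1, 1, 1, 1, 1] [4, 4]"
  by (rule five_coreI[where ws = "[
   ([[1,2,3,4], [5,6,7,8]], [[1,3,4,2], [5,6,7,8]]),
   ([[1,2,4,5], [3,6,7,8]], [[1,3,6,7,8], [2,4,5]]),
   ([[1,3,2,4], [5,6,7,8]], [[1], [2,4], [3], [5,6,7,8]]),
   ([[1,4,2,5], [3,6,7,8]], [[1,4,3,6,7,8], [2,5]]),
   ([[1,4,5,2], [3,6,7,8]], [[1,4,5,3,6,7,8], [2]])]"]) code_simp

text \<open>Meets a 3-cycle with an involution that has at least two fixed points; the involutions
  with fewer form the exceptional pairs.\<close>

lemma core_22211_131111: "five_core [2, 2, 2, 1, 1] [1, 3, 1, 1, 1, 1]"
  by (rule five_coreI[where ws = "[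
   ([[1], [6,7,8], [2], [3], [4], [5]], [[1,2], [3,4], [5,6,7,8]]),
   ([[1], [5,6,7], [2], [3], [4], [8]], [[1,2], [3,4], [5], [6,7], [8]]),
   ([[1], [4,5,6], [2], [3], [7], [8]], [[1,2], [3,4,6], [5], [7], [8]]),
   ([[1], [4,5,7], [2], [3], [6], [8]], [[1,2], [3,4,6,5,7], [8]]),
   ([[1], [2,3,5], [4], [6], [7], [8]], [[1,2,4,3,6,5], [7], [8]])]"]) code_simp

lemmas five_cores =
  core_1221_2211 core_1221_51 core_15_33 core_15_42 core_15_51
  core_15_6 core_2211_24 core_222_6 core_24_24 core_24_6
  core_3111_51 core_33_33 core_33_6 core_6_6 core_12211_322
  core_1222_421 core_13111_13111 core_13111_22111 core_13111_232 core_13111_25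
  core_13111_7 core_133_232 core_133_34 core_133_421 core_151_34
  core_22111_331 core_22111_7 core_232_322 core_232_511 core_241_322
  core_25_25 core_25_322 core_25_34 core_31111_331 core_31111_421
  core_122111_2222 core_122111_26 core_131111_233 core_131111_242 core_131111_26
  core_1322_2222 core_1322_44 core_1331_2222 core_143_2222 core_1511_2222
  core_221111_233 core_221111_35 core_2222_2222 core_2222_233 core_2222_35
  core_2222_422 core_2222_44 core_311111_44 core_22211_131111

text \<open>Two 3-cycles that share one point, are inverse, are equal, share two points, or are
  disjoint. A mark fixed by both, as in \<open>core_13111_13111\<close>, would require a seventh
  point.\<close>

lemma exact_3111_3111: "five_types (sum_list [3, 1, 1, 1]) (mset [3, 1, 1, 1]) (mset [3, 1, 1, 1])"
  by (rule five_exactI[where ws = "[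
   ([[3,4,6], [1], [2], [5]], [[1,2,3,4,6], [5]]),
   ([[1,3,2], [4], [5], [6]], [[1], [2], [3], [4], [5], [6]]),
   ([[1,2,3], [4], [5], [6]], [[1,3,2], [4], [5], [6]]),
   ([[2,3,6], [1], [4], [5]], [[1,2], [3,6], [4], [5]]),
   ([[4,5,6], [1], [2], [3]], [[1,2,3], [4,5,6]])]"]) code_simp

lemma tight_2211_3111: "four_types_splitting (sum_list [2, 2, 1, 1]) (mset [2, 2, 1, 1]) (mset [3, 1, 1, 1])"
  by (rule tightI[where ws = "[
   ([[2,3,6], [1], [4], [5]], [[1,2,4,3,6], [5]]),
   ([[1,2,3], [4], [5], [6]], [[1], [2,4,3], [5], [6]]),
   ([[3,4,6], [1], [2], [5]], [[1,2], [3], [4,6], [5]]),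
   ([[3,6,5], [1], [2], [4]], [[1,2], [3,6,5,4]])]"]) code_simp

lemma tight_2211_33: "four_types_splitting (sum_list [2, 2, 1, 1]) (mset [2, 2, 1, 1]) (mset [3, 3])"
  by (rule tightI[where ws = "[
   ([[1,2,3], [4,5,6]], [[1], [2,4,5,6,3]]),
   ([[1,5,2], [3,4,6]], [[1,5], [2], [3], [4,6]]),
   ([[1,5,4], [2,3,6]], [[1,5,3,6], [2,4]]),
   ([[1,6,4], [2,5,3]], [[1,6,3], [2,5,4]])]"]) code_simp

lemma tight_3111_33: "four_types_splitting (sum_list [3, 1, 1, 1]) (mset [3, 1, 1, 1]) (mset [3, 3])"
  by (rule tightI[where ws = "[
   ([[1,5,2], [3,4,6]], [[1,5,3,4,6], [2]]),
   ([[1,3,2], [4,6,5]], [[1], [2], [3], [4,6,5]]),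
   ([[1,2,4], [3,6,5]], [[1,3,6,5], [2,4]]),
   ([[1,2,3], [4,5,6]], [[1,3,2], [4,5,6]])]"]) code_simp

lemma tight_3111_42: "four_types_splitting (sum_list [3, 1, 1, 1]) (mset [3, 1, 1, 1]) (mset [4, 2])"
  by (rule tightI[where ws = "[
   ([[1,3,4,6], [2,5]], [[1], [2,5,3,4,6]]),
   ([[1,3,4,2], [5,6]], [[1], [2], [3,4], [5,6]]),
   ([[1,2,3,5], [4,6]], [[1,3,5,2], [4,6]]),
   ([[1,2,5,4], [3,6]], [[1,3,6], [2,5,4]])]"]) code_simp

lemma tight_33_42: "four_types_splitting (sum_list [3, 3]) (mset [3, 3]) (mset [4, 2])"
  by (rule tightI[where ws = "[
   ([[1,2,3,5], [4,6]], [[1,3,6,5,2], [4]]),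
   ([[3,6,5,4], [1,2]], [[1,3,4], [2], [5], [6]]),
   ([[1,3,4,6], [2,5]], [[1], [2,6], [3,5], [4]]),
   ([[2,5,3,4], [1,6]], [[1,4,3,5], [2,6]])]"]) code_simp

section \<open>Certificates for pairs in which both classes split\<close>

lemma rcore_7_7: "rcore [7] [7] [
   ([[1,2,3,4,5,6,7]], [[4,5,7,6]], [[1,3,5,7,2,4,6]], [[1,3,6,2,4,7,5]]),
   ([[1,2,7,4,6,5,3]], [[3,6,5,7]], [[1,3,2], [4,7,5], [6]], [[1,3,5], [2,4,6], [7]]),
   ([[1,2,3,5,4,7,6]], [[4,7,6,5]], [[1,3,6,2,4], [5], [7]], [[1,3,5,2,4], [6], [7]]),
   ([[1,3,5,6,2,7,4]], [[2,6,5,3]], [[1,4,2], [3,6], [5,7]], [[1,3,6], [2,4], [5,7]]),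
   ([[1,2,3,5,7,6,4]], [[5,6]], [[1,3,6,5], [2,4], [7]], [[1,3,7,6], [2,4], [5]])]"
  by code_simp

text \<open>The only pair of nontrivial even types on six points in which both classes
  split.\<close>

lemma rexact_51_51: "five_signed_types (sum_list [5, 1]) (mset [5, 1]) (mset [5, 1])"
  by (rule rexact_rfive[of _ _ "[
   ([[1,5,3,4,6], [2]], [[3,6,4,5]], [[1], [2,3,5,4,6]], [[1,4,2,3,6], [5]]),
   ([[1,2,3,5,6], [4]], [[1,2,5,3,6,4]], [[1,3], [2,4,5,6]], [[1,2], [3,5,6,4]]),
   ([[2,6,5,3,4], [1]], [[1,3,4,5,6,2]], [[1,2,6], [3,5,4]], [[1,3,4], [2,6,5]]),
   ([[1,5,3,6,2], [4]], [[3,4,6,5]], [[1], [2], [3,6], [4,5]], [[1,4], [2], [3,5], [6]]),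
   ([[1,3,2,5,4], [6]], [[2,6,4], [3,5]], [[1,4,2], [3], [5], [6]], [[1], [2], [3], [4,5,6]])]"]) code_simp

text \<open>The types (5,3) and (5,3,1) fix the degree, so these certificates and the three that
  follow are never enlarged.\<close>

lemma rexact_53_53: "five_signed_types (sum_list [5, 3]) (mset [5, 3]) (mset [5, 3])"
  by (rule rexact_rfive[of _ _ "[
   ([[2,6,8,4,7], [1,5,3]], [[1,2], [6,7,8]], [[1], [2,7,3], [4,8,5], [6]], [[1,8,2], [3], [4,6,5], [7]]),
   ([[1,2,3,7,5], [4,6,8]], [[2,3,5,7,4], [6,8]], [[1,3,8,5,2,4,7], [6]], [[1,4,8,7,2,6,3], [5]]),
   ([[4,7,5,6,8], [1,3,2]], [[1,3,4], [2,5,6,8]], [[1,4,8,5,7], [2], [3], [6]], [[1,8,3,5,4], [2], [6], [7]]),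
   ([[1,4,8,5,3], [2,6,7]], [[1,2], [3,7,6,8], [4,5]], [[1,5,4,6,8], [2,7,3]], [[1,6,2], [3,5,4,8,7]]),
   ([[1,3,2,6,7], [4,8,5]], [[2,6,4,3,7], [5,8]], [[1,4,6,8], [2,7], [3], [5]], [[1,8,4,3], [2], [5,6], [7]])]"]) code_simp

lemma rexact_53_71: "five_signed_types (sum_list [5, 3]) (mset [5, 3]) (mset [7, 1])"
  by (rule rexact_rfive[of _ _ "[
   ([[1,5,4,7,2,6,8], [3]], [[2,8], [3,5,7,4,6]], [[1], [2,7,3,4,8], [5], [6]], [[1,8,4,6,5], [2], [3], [7]]),
   ([[1,2,4,6,3,7,5], [8]], [[2,3,8], [4,5,6,7]], [[1,3,8,6,4,7], [2,5]], [[1,4,7,6,2,3], [5,8]]),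
   ([[1,3,8,4,7,5,6], [2]], [[2,8,7,5,6,4]], [[1,4,8,5,7], [2,3,6]], [[1,4,2], [3,8,6,5,7]]),
   ([[1,4,2,6,8,5,3], [7]], [[2,5], [3,7,8,6,4]], [[1,5,4,3,2,7,8], [6]], [[1,4,7,2,8,6,3], [5]]),
   ([[1,3,2,5,4,6,7], [8]], [[2,7,8,5,6], [3,4]], [[1,4,7,2], [3], [5], [6,8]], [[1,5], [2,6,4,8], [3], [7]])]"]) code_simp

lemma rexact_531_531: "five_signed_types (sum_list [5, 3, 1]) (mset [5, 3, 1]) (mset [5, 3, 1])"
  by (rule rexact_rfive[of _ _ "[
   ([[4,6,7,8,5], [1,9,2], [3]], [[1,4,2,5,3], [6,9]], [[1,9,3,4,7,6,8], [2], [5]], [[1,2,9,8,4,7,6], [3], [5]]),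
   ([[3,5,7,8,6], [1,9,2], [4]], [[2,5,7,6,9,8,4,3]], [[1,9,3], [2], [4,5,8,7,6]], [[1,6,5,2,8], [3,4,9], [7]]),
   ([[1,4,2,8,6], [3,9,5], [7]], [[2,3], [4,9,6,7,8]], [[1,5,4,3,9], [2,6], [7,8]], [[1,9,4,8,6], [2,7], [3,5]]),
   ([[2,7,3,4,8], [5,6,9], [1]], [[1,6,9,4,5,2], [3,8,7]], [[1,2,8,3,5,7,4,6,9]], [[1,4,3,6,7,2,9,5,8]]),
   ([[1,5,3,9,4], [6,8,7], [2]], [[2,9,3,8,7,6,5,4]], [[1], [2,3,9,5,4], [6], [7], [8]], [[1,5,8,4,6], [2], [3], [7], [9]])]"]) code_simp

lemma rexact_531_9: "five_signed_types (sum_list [5, 3, 1]) (mset [5, 3, 1]) (mset [9])"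
  by (rule rexact_rfive[of _ _ "[
   ([[1,9,2,3,6,7,8,5,4]], [[4,6,9,7,8,5]], [[1,9,3,7,6,8], [2,4], [5]], [[1,8], [2,4,7,3,9,6], [5]]),
   ([[1,9,2,4,8,6,3,5,7]], [[2,9,7,6,5,3]], [[1,9,3], [2,5,8,7], [4,6]], [[1,8], [2,4,6], [3,7,9,5]]),
   ([[1,2,7,3,6,4,9,5,8]], [[2,9,3,6,5,4,8,7]], [[1,3,7,4,9], [2,8], [5,6]], [[1,9,3,5,6], [2,7], [4,8]]),
   ([[1,2,7,3,4,8,5,6,9]], [[2,3], [4,9,7,8], [5,6]], [[1,3,5,7,4,6,9,2,8]], [[1,4,7,2,9,5,8,3,6]]),
   ([[1,7,6,8,3,9,4,2,5]], [[2,4,5,6,8,3]], [[1,8,4,3,9,5,2], [6], [7]], [[1,8,4,7,6,2,9], [3], [5]])]"]) code_simp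

text \<open>The 3-cycle contains a whole 2-cycle of the involution or not, and contains its fixed
  point or not; each of the four positions gives its own type.\<close>

lemma core_4: "core [2, 2, 2, 1] [3, 1, 1, 1, 1] [
   ([[1,2,3], [4], [5], [6], [7]], [[1], [2,4,3], [5,6], [7]]),
   ([[1,2,7], [3], [4], [5], [6]], [[1], [2,7], [3,4], [5,6]]),
   ([[1,3,5], [2], [4], [6], [7]], [[1,4,3,6,5,2], [7]]),
   ([[1,3,7], [2], [4], [5], [6]], [[1,4,3,7,2], [5,6]])]"
  by code_simp

text \<open>Without a fixed point two positions remain: the 3-cycle contains a whole 2-cycle, or it
  meets three of them.\<close>

lemma core_2: "core [2, 2, 2] [3, 1, 1, 1] [
   ([[1,2,3], [4], [5], [6]], [[1], [2,4,3], [5,6]]),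
   ([[1,3,5], [2], [4], [6]], [[1,4,3,6,5,2]])]"
  by code_simp

section \<open>Shapes of even permutations\<close>

definition three_type :: "nat \<Rightarrow> nat multiset \<Rightarrow> bool" where
  "three_type n L \<longleftrightarrow> L = add_mset 3 (replicate_mset (n - 3) 1)"

text \<open>An involution with at most one fixed point. Evenness of \<open>k\<close> says that it is
  an even permutation, and it is the source of the divisibility by 4 in the theorem.\<close>

definition full_type :: "nat \<Rightarrow> nat multiset \<Rightarrow> bool" where
  "full_type n L \<longleftrightarrow> (\<exists>k. even k \<and> (n = 2 * k \<and> L = replicate_mset k 2 \<or>
     n = Suc (2 * k) \<and> L = add_mset 1 (replicate_mset k 2)))"

lemma mpatI:
  assumes "add_mset p (mset (tl ls)) \<subseteq># L" "hd ls \<le> p"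
  shows "has_pattern ls L"
proof -
  obtain R where "L = add_mset p (mset (tl ls)) + R" using assms(1) by (metis mset_subset_eq_exists_conv)
  then show ?thesis unfolding has_pattern_def using assms(2)
    by (intro exI[of _ "p - hd ls"] exI[of _ R]) simp
qed

text \<open>Inclusion of multisets is tested only at the entries of the pattern, which reduces it to
  inequalities between counts.\<close>

lemma mpat_countI:
  assumes "hd ls \<le> p" "list_all (\<lambda>x. count_list (p # tl ls) x \<le> count L x) (p # tl ls)"
  shows "has_pattern ls L"
proof (rule mpatI[OF _ assms(1)])
  have "count (mset (p # tl ls)) x \<le> count L x" for x
  proof (cases "x \<in> set (p # tl ls)")
    case True
    then have "count_list (p # tl ls) x \<le> count L x" using assms(2) unfolding list_all_iff by blast
    then show ?thesis unfolding count_mset .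
  next
    case False
    then show ?thesis by (metis count_mset_0_iff le0)
  qed
  then show "add_mset p (mset (tl ls)) \<subseteq># L" by (intro mset_subset_eqI) simp
qed

text \<open>The disjuncts run through the cycle types of even permutations of at least seven points,
  ordered by their largest cycles; each lists the patterns that the cores ask for.\<close>

definition shape :: "nat \<Rightarrow> nat multiset \<Rightarrow> bool" where
  "shape n L \<longleftrightarrow>
    (has_pattern [6] L \<and> has_pattern [7] L) \<or>
    (8 \<le> n \<and> has_pattern [6] L \<and> has_pattern [2,6] L) \<or>
    (8 \<le> n \<and> has_pattern [1,5] L \<and> has_pattern [2,5] L \<and> has_pattern [3,5] L) \<or>
    (8 \<le> n \<and> has_pattern [1,5] L \<and> has_pattern [2,2,2] L \<and> has_pattern [4,2] L \<and>
      has_pattern [2,5] L \<and> has_pattern [3,2,2] L \<and> has_pattern [4,2,2] L) \<or>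
    (has_pattern [1,5] L \<and> has_pattern [5,1] L \<and> has_pattern [1,5,1] L \<and>
      has_pattern [5,1,1] L \<and> (8 \<le> n \<longrightarrow> has_pattern [1,5,1,1] L)) \<or>
    (8 \<le> n \<and> has_pattern [2,4] L \<and> has_pattern [3,4] L \<and> has_pattern [4,4] L) \<or>
    (8 \<le> n \<and> has_pattern [2,4] L \<and> has_pattern [3,3] L \<and> has_pattern [4,2] L \<and>
      has_pattern [2,3,2] L \<and> has_pattern [1,4,3] L) \<or>
    (has_pattern [2,4] L \<and> has_pattern [4,2] L \<and> has_pattern [2,4,1] L \<and> has_pattern [4,2,1] L) \<or>
    (8 \<le> n \<and> has_pattern [2,2,2] L \<and> has_pattern [2,4] L \<and> has_pattern [4,2] L \<and>
      has_pattern [3,2,2] L \<and> has_pattern [2,2,2,2] L \<and> has_pattern [2,4,2] L) \<or>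
    (has_pattern [3,3] L \<and> has_pattern [1,3,3] L \<and> has_pattern [3,3,1] L \<and>
      (8 \<le> n \<longrightarrow> has_pattern [1,3,3,1] L)) \<or>
    (8 \<le> n \<and> has_pattern [3,3] L \<and> has_pattern [1,3,3] L \<and> has_pattern [2,3,3] L) \<or>
    (has_pattern [2,2,2] L \<and> has_pattern [2,3,2] L \<and> has_pattern [3,2,2] L \<and>
      (8 \<le> n \<longrightarrow> has_pattern [1,3,2,2] L)) \<or>
    (three_type n L \<and> has_pattern [3,1,1,1] L \<and> has_pattern [1,3,1,1,1] L \<and>
      has_pattern [3,1,1,1,1] L \<and>
      (8 \<le> n \<longrightarrow> has_pattern [1,3,1,1,1,1] L) \<and>
      (8 \<le> n \<longrightarrow> has_pattern [3,1,1,1,1,1] L)) \<or>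
    (8 \<le> n \<and> has_pattern [2,2,2] L \<and> has_pattern [1,2,2,2] L \<and>
      has_pattern [2,2,2,2] L \<and> (has_pattern [2,2,2,1,1] L \<or> full_type n L)) \<or>
    (has_pattern [1,2,2,1] L \<and> has_pattern [2,2,1,1] L \<and> has_pattern [1,2,2,1,1] L \<and>
      has_pattern [2,2,1,1,1] L \<and>
      (8 \<le> n \<longrightarrow> has_pattern [1,2,2,1,1,1] L) \<and>
      (8 \<le> n \<longrightarrow> has_pattern [2,2,1,1,1,1] L))"

text \<open>A part of size at least 7 is enough for the patterns \<open>[6]\<close> and
  \<open>[7]\<close>; all other types are described by six counts, and questions about them become
  linear arithmetic.\<close>

lemma small_parts:
  assumes "partition_of n L" "\<forall>p \<in># L. p \<le> 6"
  shows "L = replicate_mset (count L 1) 1 + replicate_mset (count L 2) 2 + replicate_mset (count L 3) 3 +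
      replicate_mset (count L 4) 4 + replicate_mset (count L 5) 5 + replicate_mset (count L 6) 6"
proof (rule multiset_eqI)
  fix x :: nat
  consider "x = 0" | "x = 1" | "x = 2" | "x = 3" | "x = 4" | "x = 5" | "x = 6" | "x > 6" by linarith
  moreover have "count L 0 = 0" using assms(1) by (simp add: partition_of_def not_in_iff)
  moreover have "count L x = 0" if "x > 6" using assms(2) that by (metis leD not_in_iff)
  ultimately show "count L x = count (replicate_mset (count L 1) 1 + replicate_mset (count L 2) 2 +
      replicate_mset (count L 3) 3 + replicate_mset (count L 4) 4 + replicate_mset (count L 5) 5 +
      replicate_mset (count L 6) 6) x"
    by cases simp_all
qed

text \<open>Only cycles of even length are odd permutations, so the parity sees just the counts of
  2, 4 and 6.\<close>

lemma small_parts_sums: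
  assumes "partition_of n L" "\<forall>p \<in># L. p \<le> 6" "even (\<Sum>l\<in>#L. l - 1)"
  shows "n = count L 1 + 2 * count L 2 + 3 * count L 3 + 4 * count L 4 + 5 * count L 5 + 6 * count L 6"
    "even (count L 2 + count L 4 + count L 6)"
proof -
  have "n = sum_mset L" using assms(1) by (simp add: partition_of_def)
  also have "\<dots> = count L 1 + 2 * count L 2 + 3 * count L 3 + 4 * count L 4 + 5 * count L 5 + 6 * count L 6"
    by (subst small_parts[OF assms(1,2)]) simp
  finally show "n = count L 1 + 2 * count L 2 + 3 * count L 3 + 4 * count L 4 + 5 * count L 5 + 6 * count L 6" .
  have "(\<Sum>l\<in>#L. l - 1) = count L 2 + 2 * count L 3 + 3 * count L 4 + 4 * count L 5 + 5 * count L 6"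
    by (subst small_parts[OF assms(1,2)]) simp
  then show "even (count L 2 + count L 4 + count L 6)" using assms(3) by simp
qed

text \<open>Otherwise the simplifier would turn bounds on counts into membership, and the arithmetic
  hypotheses would no longer apply.\<close>

declare count_greater_eq_one_iff [simp del] count_greater_zero_iff [simp del]

lemma shapeI:
  assumes "partition_of n L" "even (\<Sum>l\<in>#L. l - 1)" "7 \<le> n" "L \<noteq> replicate_mset n 1"
  shows "shape n L"
proof (cases "\<exists>p \<in># L. 7 \<le> p")
  case True
  then obtain p where p: "p \<in># L" "7 \<le> p" by blast
  then have "{#p#} \<subseteq># L" by simp
  then have "has_pattern [6] L" "has_pattern [7] L" using p(2) by (auto intro!: mpatI[of p])
  then show ?thesis unfolding shape_def by simp
next
  case False
  then have le: "\<forall>p \<in># L. p \<le> 6" by auto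
  define c1 c2 c3 c4 c5 c6 where "c1 = count L 1" and "c2 = count L 2" and "c3 = count L 3"
    and "c4 = count L 4" and "c5 = count L 5" and "c6 = count L 6"
  note cdefs = this
  have L: "L = replicate_mset c1 1 + replicate_mset c2 2 + replicate_mset c3 3 + replicate_mset c4 4 +
      replicate_mset c5 5 + replicate_mset c6 6"
    using small_parts[OF assms(1) le] unfolding cdefs .
  have n: "n = c1 + 2 * c2 + 3 * c3 + 4 * c4 + 5 * c5 + 6 * c6" and ev: "even (c2 + c4 + c6)"
    using small_parts_sums[OF assms(1) le assms(2)] unfolding cdefs by blast+
  have nt: "c2 + c3 + c4 + c5 + c6 > 0"
  proof (rule ccontr)
    assume "\<not> ?thesis"
    then have "L = replicate_mset c1 1" "n = c1" using L n by auto
    then show False using assms(4) by simp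
  qed
  note cnt = cdefs[symmetric] cdefs(1)[symmetric, unfolded One_nat_def]
  consider (A6) "1 \<le> c6" | (B3) "c6 = 0" "1 \<le> c5" "2 \<le> c5 \<or> 1 \<le> c4 \<or> 1 \<le> c3"
    | (B2) "c5 = 1" "2 \<le> c2" | (B1) "c5 = 1" "c6 = 0" "c4 = 0" "c3 = 0" "c2 = 0"
    | (C4) "2 \<le> c4" | (C3) "1 \<le> c4" "1 \<le> c3" "1 \<le> c2" | (C2a) "1 \<le> c4" "1 \<le> c2" "1 \<le> c1"
    | (C2b) "1 \<le> c4" "3 \<le> c2" | (D1) "c6 = 0" "c5 = 0" "c4 = 0" "2 \<le> c3" "1 \<le> c1"
    | (D2) "2 \<le> c3" "3 \<le> c3 \<or> 1 \<le> c2" | (E) "c6 = 0" "c5 = 0" "c4 = 0" "c3 = 1" "2 \<le> c2"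
    | (F) "c6 = 0" "c5 = 0" "c4 = 0" "c3 = 1" "c2 = 0"
    | (G) "c6 = 0" "c5 = 0" "c4 = 0" "c3 = 0" "4 \<le> c2"
    | (H) "c6 = 0" "c5 = 0" "c4 = 0" "c3 = 0" "c2 = 2"
  proof -
    \<comment> \<open>Without 4- and 6-cycles the number of 2-cycles is even, and beside a single
      4-cycle it is odd. The bound \<open>7 \<le> n\<close> excludes the types (4,2) and (3,3),
      which leave no spare cycle.\<close>
    have e2: "2 \<le> c2" if "c4 = 0" "c6 = 0" "c2 \<noteq> 0" using ev that by presburger
    have e3: "1 \<le> c2" if "c4 = 1" "c6 = 0" using ev that by presburger
    have e4: "c2 = 2 \<or> 4 \<le> c2" if "c4 = 0" "c6 = 0" "c2 \<noteq> 0" using ev that by presburger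
    have e5: "3 \<le> c2 \<or> 1 \<le> c1" if "c4 = 1" "c6 = 0" "c5 = 0" "c3 = 0"
      using ev n assms(3) that by presburger
    have e6: "3 \<le> c3 \<or> 1 \<le> c2" if "c6 = 0" "c5 = 0" "c4 = 0" "2 \<le> c3" "c1 = 0"
      using n assms(3) that by presburger
    show thesis
    proof (cases "c6 = 0")
      case c6: True
      show thesis
      proof (cases "c5 = 0")
        case c5: True
        show thesis
        proof (cases "c4 = 0")
          case c4: True
          show thesis
          proof (cases "c3 = 0")
            case c3: True
            then show thesis using G H e4 c6 c5 c4 nt by auto
          next
            case c3: False
            show thesis
            proof (cases "c3 = 1")
              case True
              then show thesis using E F e2 c6 c5 c4 by blast
            next
              case False
              then have "2 \<le> c3" using c3 by simp
              then show thesis using D1 D2 e6 c6 c5 c4 by fastforce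
            qed
          qed
        next
          case c4: False
          show thesis
          proof (cases "c4 = 1")
            case True
            then show thesis using C3 C2a C2b e3 e5 c6 c5 by fastforce
          next
            case False
            then show thesis using c4 C4 by simp
          qed
        qed
      next
        case c5: False
        show thesis
        proof (cases "2 \<le> c5 \<or> 1 \<le> c4 \<or> 1 \<le> c3")
          case True
          then show thesis using B3 c6 c5 by simp
        next
          case False
          then show thesis using B1 B2 e2 c6 c5 by fastforce
        qed
      qed
    qed (use A6 in simp)
  qed
  then show ?thesis
  proof cases
    case A6
    \<comment> \<open>A single 6-cycle is odd, so there is a second nontrivial cycle; it holds the
      mark in the pattern \<open>[2, 6]\<close>.\<close>
    have "c6 \<ge> 2 \<or> c5 \<ge> 1 \<or> c4 \<ge> 1 \<or> c3 \<ge> 1 \<or> c2 \<ge> 1" using ev A6 by presburger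
    then obtain q where q: "2 \<le> q" "add_mset q {#6#} \<subseteq># L"
    proof (elim disjE)
      assume "c6 \<ge> 2" then show thesis by (intro that[of 6] mset_subset_eqI) (simp_all add: cnt)
    next
      assume "c5 \<ge> 1" then show thesis using A6 by (intro that[of 5] mset_subset_eqI) (simp_all add: cnt)
    next
      assume "c4 \<ge> 1" then show thesis using A6 by (intro that[of 4] mset_subset_eqI) (simp_all add: cnt)
    next
      assume "c3 \<ge> 1" then show thesis using A6 by (intro that[of 3] mset_subset_eqI) (simp_all add: cnt)
    next
      assume "c2 \<ge> 1" then show thesis using A6 by (intro that[of 2] mset_subset_eqI) (simp_all add: cnt)
    qed
    have "has_pattern [2, 6] L" using q by (intro mpatI[of q]) simp_all
    moreover have "has_pattern [6] L" using A6 by (intro mpat_countI[of _ 6]) (simp_all add: cnt)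
    moreover have "8 \<le> n" using n A6 \<open>c6 \<ge> 2 \<or> _\<close> by linarith
    ultimately show ?thesis unfolding shape_def by simp
  next
    case B3
    then obtain q where q: "3 \<le> q" "add_mset q {#5#} \<subseteq># L"
    proof (elim disjE)
      assume "c5 \<ge> 2" then show thesis by (intro that[of 5] mset_subset_eqI) (simp_all add: cnt)
    next
      assume "c4 \<ge> 1" then show thesis using B3 by (intro that[of 4] mset_subset_eqI) (simp_all add: cnt)
    next
      assume "c3 \<ge> 1" then show thesis using B3 by (intro that[of 3] mset_subset_eqI) (simp_all add: cnt)
    qed
    have "has_pattern [1, 5] L" "has_pattern [2, 5] L" "has_pattern [3, 5] L" using q by (auto intro!: mpatI[of q])
    moreover have "8 \<le> n" using n B3 by linarith
    ultimately show ?thesis unfolding shape_def by simp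
  next
    case B2
    have "has_pattern [1,5] L" using B2 by (intro mpat_countI[of _ 2]) (simp_all add: cnt)
    moreover have "has_pattern [2,2,2] L" using B2 by (intro mpat_countI[of _ 5]) (simp_all add: cnt)
    moreover have "has_pattern [4,2] L" using B2 by (intro mpat_countI[of _ 5]) (simp_all add: cnt)
    moreover have "has_pattern [2,5] L" using B2 by (intro mpat_countI[of _ 2]) (simp_all add: cnt)
    moreover have "has_pattern [3,2,2] L" using B2 by (intro mpat_countI[of _ 5]) (simp_all add: cnt)
    moreover have "has_pattern [4,2,2] L" using B2 by (intro mpat_countI[of _ 5]) (simp_all add: cnt)
    moreover have "8 \<le> n" using n B2 by linarith
    ultimately show ?thesis unfolding shape_def by simp
  next
    case B1
    have c1: "2 \<le> c1" "8 \<le> n \<Longrightarrow> 3 \<le> c1" using n assms(3) B1 by linarith+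
    have "has_pattern [1,5] L" using c1(1) B1 by (intro mpat_countI[of _ 1]) (simp_all add: cnt)
    moreover have "has_pattern [5,1] L" using c1(1) B1 by (intro mpat_countI[of _ 5]) (simp_all add: cnt)
    moreover have "has_pattern [1,5,1] L" using c1(1) B1 by (intro mpat_countI[of _ 1]) (simp_all add: cnt)
    moreover have "has_pattern [5,1,1] L" using c1(1) B1 by (intro mpat_countI[of _ 5]) (simp_all add: cnt)
    moreover have x1511: "has_pattern [1,5,1,1] L" if "8 \<le> n"
      using c1(2)[OF that] B1 by (intro mpat_countI[of _ 1]) (simp_all add: cnt)
    ultimately show ?thesis unfolding shape_def by simp
  next
    case C4
    have "has_pattern [2,4] L" using C4 by (intro mpat_countI[of _ 4]) (simp_all add: cnt)
    moreover have "has_pattern [3,4] L" using C4 by (intro mpat_countI[of _ 4]) (simp_all add: cnt)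
    moreover have "has_pattern [4,4] L" using C4 by (intro mpat_countI[of _ 4]) (simp_all add: cnt)
    moreover have "8 \<le> n" using n C4 by linarith
    ultimately show ?thesis unfolding shape_def by simp
  next
    case C3
    have "has_pattern [2,4] L" using C3 by (intro mpat_countI[of _ 2]) (simp_all add: cnt)
    moreover have "has_pattern [3,3] L" using C3 by (intro mpat_countI[of _ 4]) (simp_all add: cnt)
    moreover have "has_pattern [4,2] L" using C3 by (intro mpat_countI[of _ 4]) (simp_all add: cnt)
    moreover have "has_pattern [2,3,2] L" using C3 by (intro mpat_countI[of _ 4]) (simp_all add: cnt)
    moreover have "has_pattern [1,4,3] L" using C3 by (intro mpat_countI[of _ 2]) (simp_all add: cnt)
    moreover have "8 \<le> n" using n C3 by linarith
    ultimately show ?thesis unfolding shape_def by simp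
  next
    case C2a
    have "has_pattern [2,4] L" using C2a by (intro mpat_countI[of _ 2]) (simp_all add: cnt)
    moreover have "has_pattern [4,2] L" using C2a by (intro mpat_countI[of _ 4]) (simp_all add: cnt)
    moreover have "has_pattern [2,4,1] L" using C2a by (intro mpat_countI[of _ 2]) (simp_all add: cnt)
    moreover have "has_pattern [4,2,1] L" using C2a by (intro mpat_countI[of _ 4]) (simp_all add: cnt)
    ultimately show ?thesis unfolding shape_def by simp
  next
    case C2b
    have "has_pattern [2,2,2] L" using C2b by (intro mpat_countI[of _ 2]) (simp_all add: cnt)
    moreover have "has_pattern [2,4] L" using C2b by (intro mpat_countI[of _ 2]) (simp_all add: cnt)
    moreover have "has_pattern [4,2] L" using C2b by (intro mpat_countI[of _ 4]) (simp_all add: cnt)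
    moreover have "has_pattern [3,2,2] L" using C2b by (intro mpat_countI[of _ 4]) (simp_all add: cnt)
    moreover have "has_pattern [2,2,2,2] L" using C2b by (intro mpat_countI[of _ 4]) (simp_all add: cnt)
    moreover have "has_pattern [2,4,2] L" using C2b by (intro mpat_countI[of _ 2]) (simp_all add: cnt)
    moreover have "8 \<le> n" using n C2b by linarith
    ultimately show ?thesis unfolding shape_def by simp
  next
    case D1
    have "has_pattern [3,3] L" using D1 by (intro mpat_countI[of _ 3]) (simp_all add: cnt)
    moreover have "has_pattern [1,3,3] L" using D1 by (intro mpat_countI[of _ 1]) (simp_all add: cnt)
    moreover have "has_pattern [3,3,1] L" using D1 by (intro mpat_countI[of _ 3]) (simp_all add: cnt)
    \<comment> \<open>Beyond (3,3,1) there is a second fixed point, a 2-cycle or a third 3-cycle,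
      and this extra cycle can hold the mark.\<close>
    moreover have x: "has_pattern [1, 3, 3, 1] L" if "8 \<le> n"
    proof -
      have "2 \<le> c1 \<or> 1 \<le> c2 \<or> 3 \<le> c3" using n that D1 by linarith
      then show ?thesis using D1
        by (elim disjE) (rule mpat_countI[of _ 1] mpat_countI[of _ 2] mpat_countI[of _ 3];
          simp add: cnt; fail)+
    qed
    ultimately show ?thesis unfolding shape_def by simp
  next
    case D2
    then obtain q where q: "2 \<le> q" "add_mset q {#3, 3#} \<subseteq># L"
    proof (elim disjE)
      assume "c3 \<ge> 3" then show thesis by (intro that[of 3] mset_subset_eqI) (simp_all add: cnt)
    next
      assume "c2 \<ge> 1" then show thesis using D2 by (intro that[of 2] mset_subset_eqI) (simp_all add: cnt)
    qed
    have "has_pattern [1, 3, 3] L" "has_pattern [2, 3, 3] L" using q by (auto intro!: mpatI[of q])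
    moreover have "has_pattern [3, 3] L" using D2 by (intro mpat_countI[of _ 3]) (simp_all add: cnt)
    moreover have "8 \<le> n" using n D2 by linarith
    ultimately show ?thesis unfolding shape_def by simp
  next
    case E
    have "has_pattern [2,2,2] L" using E by (intro mpat_countI[of _ 3]) (simp_all add: cnt)
    moreover have "has_pattern [2,3,2] L" using E by (intro mpat_countI[of _ 2]) (simp_all add: cnt)
    moreover have "has_pattern [3,2,2] L" using E by (intro mpat_countI[of _ 3]) (simp_all add: cnt)
    moreover have x: "has_pattern [1, 3, 2, 2] L" if "8 \<le> n"
    proof -
      have "1 \<le> c1 \<or> 3 \<le> c2" using n that E by linarith
      then show ?thesis using E
        by (elim disjE) (rule mpat_countI[of _ 1] mpat_countI[of _ 2]; simp add: cnt; fail)+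
    qed
    ultimately show ?thesis unfolding shape_def by simp
  next
    case F
    have c1: "4 \<le> c1" "8 \<le> n \<Longrightarrow> 5 \<le> c1" using n assms(3) F by linarith+
    have "has_pattern [3,1,1,1] L" using c1(1) F by (intro mpat_countI[of _ 3]) (simp_all add: cnt)
    moreover have "has_pattern [1,3,1,1,1] L" using c1(1) F by (intro mpat_countI[of _ 1]) (simp_all add: cnt)
    moreover have "has_pattern [3,1,1,1,1] L" using c1(1) F by (intro mpat_countI[of _ 3]) (simp_all add: cnt)
    moreover have x131111: "has_pattern [1,3,1,1,1,1] L" if "8 \<le> n"
      using c1(2)[OF that] F by (intro mpat_countI[of _ 1]) (simp_all add: cnt)
    moreover have x311111: "has_pattern [3,1,1,1,1,1] L" if "8 \<le> n"
      using c1(2)[OF that] F by (intro mpat_countI[of _ 3]) (simp_all add: cnt)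
    moreover have "three_type n L" unfolding three_type_def using L n F by simp
    ultimately show ?thesis unfolding shape_def by simp
  next
    case G
    have "has_pattern [2,2,2] L" using G by (intro mpat_countI[of _ 2]) (simp_all add: cnt)
    moreover have "has_pattern [1,2,2,2] L" using G by (intro mpat_countI[of _ 2]) (simp_all add: cnt)
    moreover have "has_pattern [2,2,2,2] L" using G by (intro mpat_countI[of _ 2]) (simp_all add: cnt)
    moreover have "8 \<le> n" using n G by linarith
    moreover have "has_pattern [2,2,2,1,1] L \<or> full_type n L"
    proof (cases "2 \<le> c1")
      case True
      then have "has_pattern [2,2,2,1,1] L" using G by (intro mpat_countI[of _ 2]) (simp_all add: cnt)
      then show ?thesis ..
    next
      case False
      have z: "replicate_mset c3 3 = {#}" "replicate_mset c4 4 = {#}" "replicate_mset c5 5 = {#}"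
        "replicate_mset c6 6 = {#}" using G by simp_all
      have "even c2" using ev G by simp
      moreover have "n = 2 * c2 \<and> L = replicate_mset c2 2 \<or>
          n = Suc (2 * c2) \<and> L = add_mset 1 (replicate_mset c2 2)"
      proof (cases "c1 = 0")
        case True
        then have "replicate_mset c1 1 = {#}" by simp
        then have "L = replicate_mset c2 2" using L unfolding z by simp
        moreover have "n = 2 * c2" using n G True by linarith
        ultimately show ?thesis by blast
      next
        case c1: False
        then have "c1 = 1" using False by simp
        then have "L = add_mset 1 (replicate_mset c2 2)" using L unfolding z by simp
        moreover have "n = Suc (2 * c2)" using n G \<open>c1 = 1\<close> by linarith
        ultimately show ?thesis by blast
      qed
      ultimately show ?thesis unfolding full_type_def by blast
    qed
    ultimately show ?thesis unfolding shape_def by simp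
  next
    case H
    have c1: "3 \<le> c1" "8 \<le> n \<Longrightarrow> 4 \<le> c1" using n assms(3) H by linarith+
    have "has_pattern [1,2,2,1] L" using c1(1) H by (intro mpat_countI[of _ 1]) (simp_all add: cnt)
    moreover have "has_pattern [2,2,1,1] L" using c1(1) H by (intro mpat_countI[of _ 2]) (simp_all add: cnt)
    moreover have "has_pattern [1,2,2,1,1] L" using c1(1) H by (intro mpat_countI[of _ 1]) (simp_all add: cnt)
    moreover have "has_pattern [2,2,1,1,1] L" using c1(1) H by (intro mpat_countI[of _ 2]) (simp_all add: cnt)
    moreover have x122111: "has_pattern [1,2,2,1,1,1] L" if "8 \<le> n"
      using c1(2)[OF that] H by (intro mpat_countI[of _ 1]) (simp_all add: cnt)
    moreover have x221111: "has_pattern [2,2,1,1,1,1] L" if "8 \<le> n"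
      using c1(2)[OF that] H by (intro mpat_countI[of _ 2]) (simp_all add: cnt)
    ultimately show ?thesis unfolding shape_def by simp
  qed
qed

declare count_greater_eq_one_iff [simp] count_greater_zero_iff [simp]

text \<open>For each pair out of the fifteen shapes, apart from the exceptional ones, some core in
  one of its two orders has both its patterns available. Shapes that also occur on seven points
  offer their eight-point patterns under the premise \<open>8 \<le> n\<close>, which the partner
  shape then supplies.\<close>

lemma shape_five:
  assumes "partition_of n L" "partition_of n M" "shape n L" "shape n M"
  shows "five_types n L M \<or> three_type n L \<and> full_type n M \<or> full_type n L \<and> three_type n M"
proof -
  note cores = five_cores[THEN five_coreD, OF assms(1,2)] five_cores[THEN five_coreD', OF assms(1,2)]
  show ?thesis
    using assms(3,4) unfolding shape_def
    by (elim disjE) (blast intro: cores)+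
qed

section \<open>At least five classes\<close>

lemma six_types:
  assumes "partition_of 6 L" "even (\<Sum>l\<in>#L. l - 1)" "L \<noteq> replicate_mset 6 1"
  shows "L = {#5, 1#} \<or> L = {#4, 2#} \<or> L = {#3, 3#} \<or> L = {#3, 1, 1, 1#} \<or> L = {#2, 2, 1, 1#}"
proof -
  have le: "\<forall>p \<in># L. p \<le> 6"
    using assms(1) unfolding partition_of_def by (metis add.commute le_add2 insert_DiffM sum_mset.add_mset)
  define c1 c2 c3 c4 c5 c6 where "c1 = count L 1" and "c2 = count L 2" and "c3 = count L 3"
    and "c4 = count L 4" and "c5 = count L 5" and "c6 = count L 6"
  note cdefs = this
  have L: "L = replicate_mset c1 1 + replicate_mset c2 2 + replicate_mset c3 3 + replicate_mset c4 4 +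
      replicate_mset c5 5 + replicate_mset c6 6"
    using small_parts[OF assms(1) le] unfolding cdefs .
  have n: "6 = c1 + 2 * c2 + 3 * c3 + 4 * c4 + 5 * c5 + 6 * c6" and ev: "even (c2 + c4 + c6)"
    using small_parts_sums[OF assms(1) le assms(2)] unfolding cdefs by blast+
  have c6: "c6 = 0"
  proof (rule ccontr)
    assume "c6 \<noteq> 0"
    then have "c6 = 1" "c4 = 0" "c2 = 0" using n by linarith+
    then show False using ev by simp
  qed
  consider "c6 = 0" "c5 = 1" "c4 = 0" "c3 = 0" "c2 = 0" "c1 = 1"
    | "c6 = 0" "c5 = 0" "c4 = 1" "c3 = 0" "c2 = 1" "c1 = 0"
    | "c6 = 0" "c5 = 0" "c4 = 0" "c3 = 2" "c2 = 0" "c1 = 0"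
    | "c6 = 0" "c5 = 0" "c4 = 0" "c3 = 1" "c2 = 0" "c1 = 3"
    | "c6 = 0" "c5 = 0" "c4 = 0" "c3 = 0" "c2 = 2" "c1 = 2"
    | "c6 = 0" "c5 = 0" "c4 = 0" "c3 = 0" "c2 = 0" "c1 = 6"
  proof (cases "c5 = 0")
    case c5: True
    show thesis
    proof (cases "c4 = 0")
      case c4: True
      then have "even c2" "c2 \<le> 3" using n ev c6 by simp_all
      then have e: "c2 = 0 \<or> c2 = 2" by presburger
      consider "c3 = 2" | "c3 = 1" | "c3 = 0" using n by linarith
      then show thesis
      proof cases
        case 1
        then have "c2 = 0" "c1 = 0" using n by linarith+
        then show thesis using that(3) c6 c5 c4 1 by blast
      next
        case 2
        then have "c2 = 0" "c1 = 3" using n e c6 c5 c4 by linarith+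
        then show thesis using that(4) c6 c5 c4 2 by blast
      next
        case 3
        then have "c2 = 0 \<and> c1 = 6 \<or> c2 = 2 \<and> c1 = 2" using n e c6 c5 c4 by linarith
        then show thesis using that(5,6) c6 c5 c4 3 by blast
      qed
    next
      case False
      then have c4: "c4 = 1" "c3 = 0" "c2 \<le> 1" using n by linarith+
      then have "odd c2" using ev c6 by simp
      then have "c2 = 1" using c4(3) by presburger
      then have "c1 = 0" using n c4 by linarith
      then show thesis using that(2) c6 c5 c4 \<open>c2 = 1\<close> by blast
    qed
  next
    case False
    then have c5: "c5 = 1" "c4 = 0" "c3 = 0" "c2 = 0" using n by linarith+
    then have "c1 = 1" using n c6 by linarith
    then show thesis using that(1) c6 c5 by blast
  qed
  then show ?thesis
  proof cases
    case 1
    then have "L = {#5, 1#}" using L by (simp add: add_mset_commute)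
    then show ?thesis by blast
  next
    case 2
    then have "L = {#4, 2#}" using L by (simp add: add_mset_commute)
    then show ?thesis by blast
  next
    case 3
    then have "L = {#3, 3#}" using L by (simp add: numeral_2_eq_2)
    then show ?thesis by blast
  next
    case 4
    then have "L = {#3, 1, 1, 1#}" using L by (simp add: numeral_3_eq_3 add_mset_commute)
    then show ?thesis by blast
  next
    case 5
    then have "L = {#2, 2, 1, 1#}" using L by (simp add: numeral_2_eq_2 add_mset_commute)
    then show ?thesis by blast
  next
    case 6
    then show ?thesis using L assms(3) by simp
  qed
qed

lemma mpat_six:
  "has_pattern [1,5] {#5, 1#}" "has_pattern [5,1] {#5, 1#}" "has_pattern [2,4] {#4, 2#}" "has_pattern [4,2] {#4, 2#}"
  "has_pattern [3,3] {#3, 3#}" "has_pattern [3,1,1,1] {#3, 1, 1, 1#}" "has_pattern [1,2,2,1] {#2, 2, 1, 1#}"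
  "has_pattern [2,2,1,1] {#2, 2, 1, 1#}"
  by (rule mpatI[of 1] mpatI[of 2] mpatI[of 3] mpatI[of 4] mpatI[of 5]; simp; fail)+

text \<open>The outcomes differ in what they demand of the classes: (5,1) with itself leaves no
  nonsplit factor, five types ask for one nonsplit factor, and four types with a splitting one ask
  for both, which is why \<open>{#5, 1#}\<close> is excluded there.\<close>

lemma six_five:
  assumes "partition_of 6 L" "partition_of 6 M"
    and "L = {#5, 1#} \<or> L = {#4, 2#} \<or> L = {#3, 3#} \<or> L = {#3, 1, 1, 1#} \<or> L = {#2, 2, 1, 1#}"
    and "M = {#5, 1#} \<or> M = {#4, 2#} \<or> M = {#3, 3#} \<or> M = {#3, 1, 1, 1#} \<or> M = {#2, 2, 1, 1#}"
  shows "L = {#5, 1#} \<and> M = {#5, 1#} \<or> five_types 6 L M \<or> four_types_splitting 6 L M \<and> L \<noteq> {#5, 1#} \<and> M \<noteq> {#5, 1#}"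
proof -
  note cores = five_cores[THEN five_coreD, OF assms(1,2)] five_cores[THEN five_coreD', OF assms(1,2)]
  have ff: "five_types 6 {#3, 1, 1, 1#} {#3, 1, 1, 1#}" using exact_3111_3111 by simp
  have t: "four_types_splitting 6 {#2, 2, 1, 1#} {#3, 1, 1, 1#}" "four_types_splitting 6 {#2, 2, 1, 1#} {#3, 3#}"
    "four_types_splitting 6 {#3, 1, 1, 1#} {#3, 3#}" "four_types_splitting 6 {#3, 1, 1, 1#} {#4, 2#}" "four_types_splitting 6 {#3, 3#} {#4, 2#}"
    using tight_2211_3111 tight_2211_33 tight_3111_33 tight_3111_42 tight_33_42 by simp_all
  have ne: "{#4, 2#} \<noteq> {#5, 1 :: nat#}" "{#3, 3#} \<noteq> {#5, 1 :: nat#}"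
    "{#3, 1, 1, 1#} \<noteq> {#5, 1 :: nat#}" "{#2, 2, 1, 1#} \<noteq> {#5, 1 :: nat#}"
    by (auto simp: add_eq_conv_ex)
  \<comment> \<open>Opaque copies of equality and of the goal, so that the automation does not take them apart.\<close>
  define E :: "nat multiset \<Rightarrow> nat multiset \<Rightarrow> bool" where "E X Y \<longleftrightarrow> X = Y" for X Y
  define Q where "Q \<longleftrightarrow> L = {#5, 1#} \<and> M = {#5, 1#} \<or> five_types 6 L M \<or>
    four_types_splitting 6 L M \<and> L \<noteq> {#5, 1#} \<and> M \<noteq> {#5, 1#}"
  have tQ: Q if "E L A" "E M B" "four_types_splitting 6 A B" "A \<noteq> {#5, 1#}" "B \<noteq> {#5, 1#}" for A B
    using that unfolding E_def Q_def by simp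
  note ts = t t[THEN tight_sym]
  note tights = tQ[OF _ _ ts(1) ne(4,3)] tQ[OF _ _ ts(2) ne(4,2)] tQ[OF _ _ ts(3) ne(3,2)]
    tQ[OF _ _ ts(4) ne(3,1)] tQ[OF _ _ ts(5) ne(2,1)] tQ[OF _ _ ts(6) ne(3,4)] tQ[OF _ _ ts(7) ne(2,4)]
    tQ[OF _ _ ts(8) ne(2,3)] tQ[OF _ _ ts(9) ne(1,3)] tQ[OF _ _ ts(10) ne(1,2)]
  have fQ: "five_types 6 L M \<Longrightarrow> Q" unfolding Q_def by simp
  have ffQ: Q if "E L {#3, 1, 1, 1#}" "E M {#3, 1, 1, 1#}"
    using that ff unfolding E_def Q_def by simp
  have both: Q if "E L {#5, 1#}" "E M {#5, 1#}"
    using that unfolding E_def Q_def by simp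
  have shape6: "E X {#5, 1#} \<and> has_pattern [1,5] X \<and> has_pattern [5,1] X \<or>
      E X {#4, 2#} \<and> has_pattern [2,4] X \<and> has_pattern [4,2] X \<or> E X {#3, 3#} \<and> has_pattern [3,3] X \<or>
      E X {#3, 1, 1, 1#} \<and> has_pattern [3,1,1,1] X \<or>
      E X {#2, 2, 1, 1#} \<and> has_pattern [1,2,2,1] X \<and> has_pattern [2,2,1,1] X"
    if "X = {#5, 1#} \<or> X = {#4, 2#} \<or> X = {#3, 3#} \<or> X = {#3, 1, 1, 1#} \<or> X = {#2, 2, 1, 1#}" for X
    using that mpat_six unfolding E_def by (elim disjE) simp_all
  have Q
    using shape6[OF assms(3)] shape6[OF assms(4)]
    by (elim disjE) (blast intro: cores[THEN fQ] tights ffQ both)+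
  then show ?thesis unfolding Q_def .
qed

section \<open>From product types to classes of the alternating group\<close>

lemma five_eta:
  assumes "n \<ge> 2" "a \<in> even_perms n" "b \<in> even_perms n" "ctype {1..n} a L" "ctype {1..n} b M"
    and "five_types n L M" "nonsplit L \<or> nonsplit M"
  shows "5 \<le> eta (alt_group n) (class_prod n a b)"
proof -
  obtain T where T: "T \<subseteq> product_types n L M" "finite T" "card T = 5" using assms(6) by (auto simp: five_types_def)
  have "card T \<le> eta (alt_group n) (class_prod n a b)"
    using ptypes_class_prod[OF assms(1,4,5) _ assms(7)] T(1)
    by (intro ctypes_le_eta[OF assms(2,3) T(2)]) blast
  then show ?thesis using T(3) by simp
qed

lemma rfive_eta:
  assumes "n \<ge> 2" "a \<in> even_perms n" "b \<in> even_perms n" "ctype {1..n} a L" "ctype {1..n} b M"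
    and "five_signed_types n L M"
  shows "5 \<le> eta (alt_group n) (class_prod n a b)"
proof -
  obtain T where T: "T \<subseteq> signed_product_types n L M" "finite T" "card T = 5" using assms(6) by (auto simp: five_signed_types_def)
  have "card T \<le> eta (alt_group n) (class_prod n a b)"
    using rtypes_class_prod[OF assms(1,4,5)] T(1)
    by (intro ctypes_le_eta[OF assms(2,3) T(2)]) blast
  then show ?thesis using T(3) by simp
qed

text \<open>With both factors nonsplit, the product contains an element of type (5,1) together with
  its conjugate by a transposition. These lie in different classes, which raises the count from four
  to five.\<close>

lemma tight_eta:
  assumes "n \<ge> 2" "a \<in> even_perms n" "b \<in> even_perms n" "ctype {1..n} a L" "ctype {1..n} b M"
    and "four_types_splitting n L M" "nonsplit L" "nonsplit M"
  shows "5 \<le> eta (alt_group n) (class_prod n a b)"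
proof -
  obtain T where T: "T \<subseteq> product_types n L M" "finite T" "card T = 4" "{#5, 1#} \<in> T"
    using assms(6) by (auto simp: four_types_splitting_def)
  have real: "\<exists>x \<in> class_prod n a b. ctype {1..n} x K" if "K \<in> T" for K
    using ptypes_class_prod[OF assms(1,4,5)] T(1) that assms(7) by blast
  obtain x where x: "x \<in> class_prod n a b" "ctype {1..n} x {#5, 1#}" using real[OF T(4)] by blast
  define t :: "nat \<Rightarrow> nat" where "t = transpose 1 2"
  have t: "t permutes {1..n}" using assms(1) unfolding t_def by (intro permutes_swap_id) auto
  have ot: "\<not> evenperm t" unfolding t_def by (simp add: evenperm_swap)
  have it: "inv' t permutes {1..n}" "\<not> evenperm (inv' t)"
    using permutes_inv[OF t] evenperm_inv_permutes[OF t] ot by simp_all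
  have y: "conj_by t x \<in> class_prod n a b"
    using class_prod_odd_cj[OF assms(1,4,5,7,8) x(1) t ot] .
  have ty: "ctype {1..n} (conj_by t x) {#5, 1#}" using ctype_cj[OF x(2) t] .
  have "conj_by t x \<notin> conj_class (alt_group n) x" using five_cycle_splits[OF x(2) t ot] .
  moreover have "x \<notin> conj_class (alt_group n) (conj_by t x)"
    using five_cycle_splits[OF ty it] cj_inv[OF t] by metis
  ultimately have "Suc (card T) \<le> eta (alt_group n) (class_prod n a b)"
    using ctypes_split_le_eta[OF assms(2,3) T(2) real T(4) x(1) y x(2) ty] by blast
  then show ?thesis using T(3) by simp
qed

section \<open>Types with distinct odd parts\<close>

lemma part_one: "partition_of 1 L \<Longrightarrow> L = {#1#}"
proof -
  assume L: "partition_of 1 L"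
  then obtain x L' where x: "L = add_mset x L'" by (cases L) (auto simp: partition_of_def)
  have "x \<noteq> 0" "x + sum_mset L' = 1" using L unfolding x partition_of_def by auto
  then have x1: "x = 1" and "sum_mset L' = 0" by linarith+
  then have "L' = {#}" using L unfolding x partition_of_def by (cases L') auto
  then show ?thesis using x x1 by simp
qed

lemma split_part_two: "partition_of 2 L \<Longrightarrow> nonsplit L"
proof -
  assume L: "partition_of 2 L"
  then obtain x L' where x: "L = add_mset x L'" by (cases L) (auto simp: partition_of_def)
  then have "x = 2 \<or> x = 1" using L by (auto simp: partition_of_def)
  then show ?thesis
  proof
    assume "x = 1"
    then have "partition_of 1 L'" using L x by (auto simp: partition_of_def)
    then have "L = {#1, 1#}" using part_one x \<open>x = 1\<close> by blast
    then show ?thesis by (simp add: nonsplit_def)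
  qed (use x in \<open>auto simp: nonsplit_def\<close>)
qed

lemma nonsplit_mono: "nonsplit L \<Longrightarrow> L \<subseteq># M \<Longrightarrow> nonsplit M"
  unfolding nonsplit_def by (meson mset_subset_eqD mset_subset_eq_count order_trans)

text \<open>Distinct odd parts below 7 are among 1, 3 and 5, and a sum of at least 7 requires both 3
  and 5.\<close>

lemma split_types:
  assumes "partition_of n L" "\<not> nonsplit L" "7 \<le> n"
  shows "has_pattern [7] L \<or> n = 8 \<and> L = {#5, 3#} \<or> n = 9 \<and> L = {#5, 3, 1#}"
proof (cases "\<exists>p \<in># L. 7 \<le> p")
  case True
  then obtain p where p: "p \<in># L" "7 \<le> p" by blast
  then show ?thesis by (auto intro!: mpatI[of p])
next
  case False
  then have le: "\<forall>p \<in># L. p \<le> 6" by auto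
  define c1 c2 c3 c4 c5 c6 where "c1 = count L 1" and "c2 = count L 2" and "c3 = count L 3"
    and "c4 = count L 4" and "c5 = count L 5" and "c6 = count L 6"
  note cdefs = this
  have L: "L = replicate_mset c1 1 + replicate_mset c2 2 + replicate_mset c3 3 + replicate_mset c4 4 +
      replicate_mset c5 5 + replicate_mset c6 6"
    using small_parts[OF assms(1) le] unfolding cdefs .
  have "n = sum_mset L" using assms(1) by (simp add: partition_of_def)
  also have "\<dots> = c1 + 2 * c2 + 3 * c3 + 4 * c4 + 5 * c5 + 6 * c6" by (subst L) simp
  finally have n: "n = c1 + 2 * c2 + 3 * c3 + 4 * c4 + 5 * c5 + 6 * c6" .
  have odd: "count L k = 0" if "even k" for k
    using assms(2) that unfolding nonsplit_def not_in_iff[symmetric] by blast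
  have one: "count L k \<le> 1" for k
  proof (cases "k \<in># L")
    case True
    then have "\<not> 2 \<le> count L k" using assms(2) unfolding nonsplit_def by blast
    then show ?thesis by linarith
  next
    case False
    then show ?thesis by (simp add: not_in_iff)
  qed
  have even0: "c2 = 0" "c4 = 0" "c6 = 0" using odd unfolding cdefs by simp_all
  have le1: "c1 \<le> 1" "c3 \<le> 1" "c5 \<le> 1" using one unfolding cdefs by blast+
  have c35: "c3 = 1" "c5 = 1" using even0 le1 n assms(3) by linarith+
  show ?thesis
  proof (cases "c1 = 0")
    case True
    then have "n = 8" using even0 c35 n by linarith
    moreover have "L = {#5, 3#}" using L even0 c35 True by (simp add: add_mset_commute)
    ultimately show ?thesis by blast
  next
    case False
    then have c1: "c1 = 1" using le1 by linarith
    then have "n = 9" using even0 c35 n by linarith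
    moreover have "L = {#5, 3, 1#}" using L even0 c35 c1 by (simp add: add_mset_commute)
    ultimately show ?thesis by blast
  qed
qed

text \<open>Lists the possible partners of \<open>{#5, 3#}\<close> and \<open>{#5, 3, 1#}\<close>. A
  part 8 is even, and a part 7 on nine points leaves two points, which form a 2-cycle or two fixed
  points.\<close>

lemma split_seven:
  assumes "partition_of n L" "\<not> nonsplit L" "has_pattern [7] L" "n = 8 \<or> n = 9"
  shows "n = 8 \<and> L = {#7, 1#} \<or> n = 9 \<and> L = {#9#}"
proof -
  obtain e R where L: "L = add_mset (7 + e) R" using assms(3) by (auto simp: has_pattern_def)
  have p: "partition_of (n - 7 - e) R" "7 + e \<le> n" using assms(1) L by (auto simp: partition_of_def)
  have ne: "even (7 + e) \<Longrightarrow> False" using assms(2) L by (auto simp: nonsplit_def)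
  have "R \<subseteq># L" using L by simp
  then have "\<not> nonsplit R" using assms(2) nonsplit_mono by blast
  then have "n - 7 - e \<noteq> 2" using p(1) split_part_two by metis
  then have "n = 8 \<and> e = 0 \<or> n = 9 \<and> e = 2" using assms(4) p(2) ne by presburger
  then show ?thesis
  proof
    assume "n = 8 \<and> e = 0"
    then show ?thesis using p(1) part_one[of R] L by simp
  next
    assume e: "n = 9 \<and> e = 2"
    then have "R = {#}" using p(1) by (cases R) (auto simp: partition_of_def)
    then show ?thesis using L e by simp
  qed
qed

lemma split_rfive:
  assumes "partition_of n L" "partition_of n M" "\<not> nonsplit L" "\<not> nonsplit M" "7 \<le> n"
  shows "five_signed_types n L M"
proof -
  have r: "five_signed_types 8 {#5, 3#} {#5, 3#}" "five_signed_types 8 {#5, 3#} {#7, 1#}"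
    "five_signed_types 9 {#5, 3, 1#} {#5, 3, 1#}" "five_signed_types 9 {#5, 3, 1#} {#9#}"
    using rexact_53_53 rexact_53_71 rexact_531_531 rexact_531_9 by simp_all
  consider "has_pattern [7] L" "has_pattern [7] M"
    | "n = 8" "L = {#5, 3#}" "M = {#5, 3#} \<or> has_pattern [7] M"
    | "n = 8" "M = {#5, 3#}" "L = {#5, 3#} \<or> has_pattern [7] L"
    | "n = 9" "L = {#5, 3, 1#}" "M = {#5, 3, 1#} \<or> has_pattern [7] M"
    | "n = 9" "M = {#5, 3, 1#}" "L = {#5, 3, 1#} \<or> has_pattern [7] L"
    using split_types[OF assms(1,3,5)] split_types[OF assms(2,4,5)] by auto
  then show ?thesis
  proof cases
    case 1
    then show ?thesis using rcore_rfive[OF rcore_7_7] assms(1,2) by blast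
  next
    case 2
    then have "M = {#5, 3#} \<or> M = {#7, 1#}" using split_seven[OF assms(2,4)] by auto
    then show ?thesis using 2 r by auto
  next
    case 3
    then have "L = {#5, 3#} \<or> L = {#7, 1#}" using split_seven[OF assms(1,3)] by auto
    then show ?thesis using 3 r r[THEN rfive_sym] by auto
  next
    case 4
    then have "M = {#5, 3, 1#} \<or> M = {#9#}" using split_seven[OF assms(2,4)] by auto
    then show ?thesis using 4 r by auto
  next
    case 5
    then have "L = {#5, 3, 1#} \<or> L = {#9#}" using split_seven[OF assms(1,3)] by auto
    then show ?thesis using 5 r r[THEN rfive_sym] by auto
  qed
qed

lemma eta_ge_five:
  assumes "n \<ge> 6" "a \<in> even_perms n" "b \<in> even_perms n" "ctype {1..n} a L" "ctype {1..n} b M"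
    and "L \<noteq> replicate_mset n 1" "M \<noteq> replicate_mset n 1"
    and "\<not> (three_type n L \<and> full_type n M)" "\<not> (full_type n L \<and> three_type n M)"
  shows "5 \<le> eta (alt_group n) (class_prod n a b)"
proof -
  have n2: "n \<ge> 2" using assms(1) by simp
  have ev: "even (\<Sum>l\<in>#L. l - 1)" "even (\<Sum>l\<in>#M. l - 1)"
    using assms(2-5) ctype_evenperm unfolding even_perms_def by blast+
  have pt: "partition_of n L" "partition_of n M" using assms(4,5) by (auto intro: ctype_part)
  show ?thesis
  proof (cases "n = 6")
    case True
    note six = six_types[OF pt(1)[unfolded True] ev(1) assms(6)[unfolded True]]
      six_types[OF pt(2)[unfolded True] ev(2) assms(7)[unfolded True]]
    have ns: "nonsplit {#4, 2#}" "nonsplit {#3, 3#}" "nonsplit {#3, 1, 1, 1#}" "nonsplit {#2, 2, 1, 1#}"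
      by (auto simp: nonsplit_def)
    have L: "nonsplit L \<or> L = {#5, 1#}" using six(1) ns by metis
    have M: "nonsplit M \<or> M = {#5, 1#}" using six(2) ns by metis
    consider "L = {#5, 1#}" "M = {#5, 1#}" | "five_types n L M" "nonsplit L \<or> nonsplit M"
      | "four_types_splitting n L M" "nonsplit L" "nonsplit M"
      using six_five[OF pt[unfolded True] six] L M True by blast
    then show ?thesis
    proof cases
      case 1
      have "five_signed_types n L M" using rexact_51_51 1 True by simp
      then show ?thesis by (rule rfive_eta[OF n2 assms(2-5)])
    next
      case 2
      then show ?thesis by (rule five_eta[OF n2 assms(2-5)])
    next
      case 3
      then show ?thesis by (rule tight_eta[OF n2 assms(2-5)])
    qed
  next
    case False
    then have n7: "7 \<le> n" using assms(1) by simp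
    show ?thesis
    proof (cases "nonsplit L \<or> nonsplit M")
      case True
      have "five_types n L M"
        using shape_five[OF pt shapeI[OF pt(1) ev(1) n7 assms(6)] shapeI[OF pt(2) ev(2) n7 assms(7)]]
          assms(8,9) by blast
      then show ?thesis using five_eta[OF n2 assms(2-5) _ True] by blast
    next
      case False
      then show ?thesis using rfive_eta[OF n2 assms(2-5)] split_rfive[OF pt _ _ n7] by blast
    qed
  qed
qed

section \<open>The exceptional pairs\<close>

lemma ctype_Cons:
  assumes "ctype R q M" "distinct cs" "set cs \<inter> R = {}" "cs \<noteq> []"
  shows "ctype (set cs \<union> R) (cycle_of_list cs \<circ> q) (add_mset (length cs) M)"
proof -
  obtain css where c: "q = perm_of css" "distinct (concat css)" "[] \<notin> set css"
    "set (concat css) = R" "mset (map length css) = M"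
    using assms(1) unfolding ctype_def by blast
  show ?thesis
    unfolding ctype_def using c assms(2-4) by (intro exI[of _ "cs # css"]) (auto simp: perm_of_Cons)
qed

lemma perm_of_singletons:
  assumes "\<forall>cs \<in> set css. length cs = 1"
  shows "perm_of css = id"
proof -
  have "filter (\<lambda>cs. 2 \<le> length cs) css = []" using assms by (auto simp: filter_empty_conv)
  then show ?thesis using perm_of_remove_singletons[of css] by simp
qed

lemma ctype_ones: "ctype S p (replicate_mset n 1) \<Longrightarrow> p = id"
  unfolding ctype_def
proof clarify
  fix css :: "'a list list"
  assume "mset (map length css) = replicate_mset n 1"
  then have "set (map length css) \<subseteq> {1}" by (metis in_replicate_mset insertI1 set_mset_mset subsetI singleton_iff)
  then show "perm_of css = id" by (intro perm_of_singletons) auto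
qed

lemma ctype_three:
  assumes "ctype S q (add_mset 3 (replicate_mset m 1))"
  shows "\<exists>x y z. distinct [x, y, z] \<and> {x, y, z} \<subseteq> S \<and> q = cycle_of_list [x, y, z]"
proof -
  have "mset (3 # replicate m 1) = add_mset 3 (replicate_mset m (1 :: nat))" by simp
  then obtain css where c: "q = perm_of css" "distinct (concat css)" "set (concat css) = S"
    "map length css = 3 # replicate m 1"
    using ctype_list[of S q "3 # replicate m 1"] assms by metis
  then obtain C css' where css: "css = C # css'" "length C = 3" "map length css' = replicate m 1"
    by (cases css) auto
  have "set (map length css') \<subseteq> {1}" unfolding css(3) by auto
  then have "perm_of css' = id" by (intro perm_of_singletons) auto
  moreover obtain x y z where "C = [x, y, z]" using css(2) stupid_lemma by blast
  ultimately show ?thesis using c css(1) by (auto simp: perm_of_Cons)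
qed

text \<open>With \<open>x\<close> as the mark, uniqueness of the type forces the marked cycle to be
  a 2-cycle; cutting it off leaves a fixed-point-free involution on the remaining points.\<close>

lemma involution_peel:
  assumes "ctype S p (replicate_mset k 2)" "x \<in> S"
  obtains x' q where "x' \<in> S" "x' \<noteq> x" "p x = x'" "p = transpose x x' \<circ> q" "1 \<le> k"
    "ctype (S - {x, x'}) q (replicate_mset (k - 1) 2)" "p x' = x"
proof -
  obtain j M where m: "marked_ctype S p x (Suc j) M"
    using mctype_exists[OF ctype_permutes[OF assms(1)] ctype_finite[OF assms(1)] assms(2)] by blast
  have eq: "add_mset (Suc j) M = replicate_mset k 2"
    using ctype_unique[OF mctype_imp_ctype[OF m] assms(1)] .
  then have "Suc j \<in># replicate_mset k 2" by (metis union_single_eq_member)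
  then have j: "Suc j = 2" "1 \<le> k" by (auto simp: in_replicate_mset split: if_splits)
  then obtain k' where k': "k = Suc k'" by (cases k) auto
  have M: "M = replicate_mset (k - 1) 2" using eq j(1) k' by simp
  obtain C css where c: "p = perm_of ((x # C) # css)" "distinct (concat ((x # C) # css))"
    "[] \<notin> set css" "set (concat ((x # C) # css)) = S" "Suc j = Suc (length C)" "mset (map length css) = M"
    using m unfolding marked_ctype_def by blast
  have "length C = 1" using c(5) j(1) by linarith
  then obtain x' where C: "C = [x']" by (cases C) auto
  have ct: "ctype (S - {x, x'}) (perm_of css) (replicate_mset (k - 1) 2)"
    unfolding ctype_def using c M C by (intro exI[of _ css]) auto
  have px: "p x = x'" "p x' = x"
    using perm_of_in[OF c(2), of "[x, x']"] c(1) C by simp_all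
  have "p = transpose x x' \<circ> perm_of css" using c(1) C by (simp add: perm_of_Cons)
  moreover have "x' \<in> S" "x' \<noteq> x" using c(2,4) C by auto
  ultimately show thesis using that px j(2) ct by blast
qed

section \<open>A fixed-point-free involution times a 3-cycle\<close>

lemma three_cycle_times_two_pairs:
  assumes "distinct [x, y, z, w]"
  shows "transpose x y \<circ> transpose z w \<circ> cycle_of_list [x, y, z] = cycle_of_list [y, w, z]"
  using assms by (auto simp: fun_eq_iff transpose_def)

lemma three_cycle_times_three_pairs:
  assumes "distinct [x, y, z, x', y', z']"
  shows "transpose x x' \<circ> transpose y y' \<circ> transpose z z' \<circ> cycle_of_list [x, y, z] =
    cycle_of_list [x, y', y, z', z, x']"
proof
  fix a
  have ne: "x \<noteq> y" "x \<noteq> z" "x \<noteq> x'" "x \<noteq> y'" "x \<noteq> z'" "y \<noteq> z" "y \<noteq> x'" "y \<noteq> y'" "y \<noteq> z'"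
    "z \<noteq> x'" "z \<noteq> y'" "z \<noteq> z'" "x' \<noteq> y'" "x' \<noteq> z'" "y' \<noteq> z'" using assms by auto
  consider "a = x" | "a = y" | "a = z" | "a = x'" | "a = y'" | "a = z'"
    | "a \<noteq> x" "a \<noteq> y" "a \<noteq> z" "a \<noteq> x'" "a \<noteq> y'" "a \<noteq> z'" by blast
  then show "(transpose x x' \<circ> transpose y y' \<circ> transpose z z' \<circ> cycle_of_list [x, y, z]) a =
    cycle_of_list [x, y', y, z', z, x'] a"
    by cases (simp_all add: transpose_def ne ne[symmetric])
qed

text \<open>The 3-cycle contains the 2-cycle of \<open>x\<close> and \<open>y\<close> and meets one
  more, that of \<open>z\<close>. On these four points the product fixes \<open>x\<close> and
  permutes the other three cyclically; the remaining 2-cycles are untouched.\<close>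

lemma involution_three_paired:
  assumes "ctype S p (replicate_mset k 2)" "distinct [x, y, z]" "{x, y, z} \<subseteq> S" "p x = y"
  shows "ctype S (p \<circ> cycle_of_list [x, y, z]) (add_mset 1 (add_mset 3 (replicate_mset (k - 2) 2)))"
proof -
  have xS: "x \<in> S" using assms(3) by simp
  obtain q1 where q1: "p = transpose x y \<circ> q1" "ctype (S - {x, y}) q1 (replicate_mset (k - 1) 2)"
    using involution_peel[OF assms(1) xS] assms(4) by metis
  have zS: "z \<in> S - {x, y}" using assms(2,3) by auto
  obtain w q2 where w: "w \<in> S - {x, y}" "w \<noteq> z" "q1 = transpose z w \<circ> q2"
    "ctype (S - {x, y} - {z, w}) q2 (replicate_mset (k - 1 - 1) 2)"
    using involution_peel[OF q1(2) zS] by metis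
  let ?R = "S - {x, y} - {z, w}"
  have "q2 \<circ> cycle_of_list [x, y, z] = cycle_of_list [x, y, z] \<circ> q2"
    by (rule disjoint_permutes_commute[OF ctype_permutes[OF w(4)] cycle_permutes]) auto
  then have "p \<circ> cycle_of_list [x, y, z] =
      (transpose x y \<circ> transpose z w \<circ> cycle_of_list [x, y, z]) \<circ> q2"
    unfolding q1(1) w(3) by (simp only: comp_assoc)
  also have "\<dots> = cycle_of_list [x] \<circ> (cycle_of_list [y, w, z] \<circ> q2)"
    using assms(2) w(1,2) by (subst three_cycle_times_two_pairs) auto
  finally have eq: "p \<circ> cycle_of_list [x, y, z] = cycle_of_list [x] \<circ> (cycle_of_list [y, w, z] \<circ> q2)" .
  have c1: "ctype (set [y, w, z] \<union> ?R) (cycle_of_list [y, w, z] \<circ> q2)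
      (add_mset (length [y, w, z]) (replicate_mset (k - 1 - 1) 2))"
    using assms(2) w(1,2) by (intro ctype_Cons[OF w(4)]) auto
  have c2: "ctype (set [x] \<union> (set [y, w, z] \<union> ?R)) (cycle_of_list [x] \<circ> (cycle_of_list [y, w, z] \<circ> q2))
      (add_mset (length [x]) (add_mset (length [y, w, z]) (replicate_mset (k - 1 - 1) 2)))"
    using assms(2) w(1,2) by (intro ctype_Cons[OF c1]) auto
  have S: "set [x] \<union> (set [y, w, z] \<union> ?R) = S" using assms(3) w(1) by auto
  have len: "length [x] = 1" "length [y, w, z] = 3" "k - 1 - 1 = k - 2" by simp_all
  show ?thesis using c2 unfolding eq S len .
qed

text \<open>The three points lie in three different 2-cycles, and the product runs through all six
  points in one cycle.\<close>

lemma involution_three_unpaired: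
  assumes "ctype S p (replicate_mset k 2)" "distinct [x, y, z]" "{x, y, z} \<subseteq> S"
    and "p x \<noteq> y" "p y \<noteq> z" "p z \<noteq> x"
  shows "ctype S (p \<circ> cycle_of_list [x, y, z]) (add_mset 6 (replicate_mset (k - 3) 2))"
proof -
  have xS: "x \<in> S" using assms(3) by simp
  obtain x' q1 where x': "x' \<in> S" "x' \<noteq> x" "p x = x'" "p x' = x" "p = transpose x x' \<circ> q1"
    "ctype (S - {x, x'}) q1 (replicate_mset (k - 1) 2)"
    using involution_peel[OF assms(1) xS] by metis
  \<comment> \<open>\<open>p\<close> exchanges \<open>x\<close> and \<open>x'\<close>, so
    \<open>x' = z\<close> would give \<open>p z = x\<close>.\<close>
  have d1: "x' \<noteq> y" "x' \<noteq> z" using x'(3,4) assms(4,6) by auto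
  have yS: "y \<in> S - {x, x'}" using assms(2,3) d1 by auto
  obtain y' q2 where y': "y' \<in> S - {x, x'}" "y' \<noteq> y" "q1 y = y'" "q1 = transpose y y' \<circ> q2"
    "ctype (S - {x, x'} - {y, y'}) q2 (replicate_mset (k - 1 - 1) 2)"
    using involution_peel[OF x'(6) yS] by metis
  have "p y = y'" using y'(1,3) unfolding x'(5) by (auto simp: transpose_def)
  then have d2: "y' \<noteq> z" using assms(5) by auto
  have zS: "z \<in> S - {x, x'} - {y, y'}" using assms(2,3) d1 d2 by auto
  obtain z' q3 where z': "z' \<in> S - {x, x'} - {y, y'}" "z' \<noteq> z" "q2 = transpose z z' \<circ> q3"
    "ctype (S - {x, x'} - {y, y'} - {z, z'}) q3 (replicate_mset (k - 1 - 1 - 1) 2)"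
    using involution_peel[OF y'(5) zS] by metis
  let ?R = "S - {x, x'} - {y, y'} - {z, z'}"
  have dist: "distinct [x, y, z, x', y', z']" using assms(2) x'(2) y'(1,2) z'(1,2) d1 d2 by auto
  have "q3 \<circ> cycle_of_list [x, y, z] = cycle_of_list [x, y, z] \<circ> q3"
    by (rule disjoint_permutes_commute[OF ctype_permutes[OF z'(4)] cycle_permutes]) auto
  then have "p \<circ> cycle_of_list [x, y, z] =
      (transpose x x' \<circ> transpose y y' \<circ> transpose z z' \<circ> cycle_of_list [x, y, z]) \<circ> q3"
    unfolding x'(5) y'(4) z'(3) by (simp only: comp_assoc)
  then have eq: "p \<circ> cycle_of_list [x, y, z] = cycle_of_list [x, y', y, z', z, x'] \<circ> q3"
    unfolding three_cycle_times_three_pairs[OF dist] .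
  have c: "ctype (set [x, y', y, z', z, x'] \<union> ?R) (cycle_of_list [x, y', y, z', z, x'] \<circ> q3)
      (add_mset (length [x, y', y, z', z, x']) (replicate_mset (k - 1 - 1 - 1) 2))"
    using dist by (intro ctype_Cons[OF z'(4)]) auto
  have S: "set [x, y', y, z', z, x'] \<union> ?R = S" using assms(3) x'(1) y'(1) z'(1) by auto
  have len: "length [x, y', y, z', z, x'] = 6" "k - 1 - 1 - 1 = k - 3" by simp_all
  show ?thesis using c unfolding eq S len .
qed

text \<open>Rotating the 3-cycle brings any 2-cycle contained in it to the first two entries, so
  there are only two essentially different positions.\<close>

lemma involution_three:
  assumes "ctype S p (replicate_mset k 2)" "ctype S q (add_mset 3 (replicate_mset m 1))"
  shows "ctype S (p \<circ> q) (add_mset 1 (add_mset 3 (replicate_mset (k - 2) 2))) \<or>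
    ctype S (p \<circ> q) (add_mset 6 (replicate_mset (k - 3) 2))"
proof -
  obtain x y z where q: "distinct [x, y, z]" "{x, y, z} \<subseteq> S" "q = cycle_of_list [x, y, z]"
    using ctype_three[OF assms(2)] by blast
  have rot: "q = cycle_of_list [y, z, x]" "q = cycle_of_list [z, x, y]"
    using cycle_of_list_rotate_independent[OF q(1), of 1] cycle_of_list_rotate_independent[OF q(1), of 2]
      q(3) by (simp_all add: numeral_2_eq_2)
  consider "p x = y" | "p y = z" | "p z = x" | "p x \<noteq> y" "p y \<noteq> z" "p z \<noteq> x" by blast
  then show ?thesis
  proof cases
    case 1
    then show ?thesis using involution_three_paired[OF assms(1) q(1,2)] q(3) by simp
  next
    case 2
    then show ?thesis using involution_three_paired[OF assms(1), of y z x] q(1,2) rot(1) by auto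
  next
    case 3
    then show ?thesis using involution_three_paired[OF assms(1), of z x y] q(1,2) rot(2) by auto
  next
    case 4
    then show ?thesis using involution_three_unpaired[OF assms(1) q(1,2)] q(3) by simp
  qed
qed

section \<open>Upper bounds for the number of classes\<close>

lemma conj_class_eq:
  assumes "u \<in> even_perms n"
  shows "conj_class (alt_group n) (conj_by u x) = conj_class (alt_group n) x"
proof -
  have u: "u permutes {1..n}" using assms by (simp add: even_perms_def)
  have "conj_by v (conj_by u x) \<in> conj_class (alt_group n) x" if "v \<in> even_perms n" for v
  proof -
    have "conj_by v (conj_by u x) = conj_by (v \<circ> u) x" using that cj_comp[OF _ u, of v x] by (simp add: even_perms_def)
    then show ?thesis unfolding conj_class_alt using even_perms_comp[OF that assms] by blast
  qed
  moreover have "conj_by v x \<in> conj_class (alt_group n) (conj_by u x)" if "v \<in> even_perms n" for v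
  proof -
    have iu: "inv' u \<in> even_perms n" using even_perms_inv[OF assms] .
    have p: "v permutes {1..n}" "inv' u permutes {1..n}" using that iu by (auto simp: even_perms_def)
    have "conj_by v x = conj_by (v \<circ> inv' u) (conj_by u x)"
      unfolding cj_comp[OF p] cj_inv[OF u] ..
    then show ?thesis unfolding conj_class_alt using even_perms_comp[OF that iu] by blast
  qed
  ultimately show ?thesis unfolding conj_class_alt by blast
qed

text \<open>If the conjugator from \<open>x\<close> to \<open>y\<close> is odd, composing it with an
  odd element centralizing \<open>x\<close> makes it even.\<close>

lemma nonsplit_conj_class:
  assumes "ctype {1..n} x K" "ctype {1..n} y K" "nonsplit K"
  shows "conj_class (alt_group n) y = conj_class (alt_group n) x"
proof -
  obtain g where g: "g permutes {1..n}" "y = conj_by g x" using ctype_imp_cj assms by blast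
  obtain c where c: "c permutes {1..n}" "\<not> evenperm c" "conj_by c x = x"
    using odd_centralizer assms by blast
  show ?thesis
  proof (cases "evenperm g")
    case True
    then show ?thesis using conj_class_eq[of g n x] g by (simp add: even_perms_def)
  next
    case False
    then have "g \<circ> c \<in> even_perms n"
      using evenperm_comp_permutes[OF g(1) c(1)] c(2) permutes_compose[OF c(1) g(1)]
      by (simp add: even_perms_def del: o_apply)
    moreover have "conj_by (g \<circ> c) x = y" using cj_comp[OF g(1) c(1)] c(3) g(2) by metis
    ultimately show ?thesis using conj_class_eq by metis
  qed
qed

text \<open>Assigning to each class a type of one of its elements is injective, because a nonsplit
  type belongs to a single class.\<close>

lemma eta_le_card:
  assumes "finite T" "\<And>x. x \<in> X \<Longrightarrow> \<exists>K \<in> T. ctype {1..n} x K" "\<And>K. K \<in> T \<Longrightarrow> nonsplit K"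
  shows "eta (alt_group n) X \<le> card T"
proof -
  define \<C> where "\<C> = {C \<in> conj_classes (alt_group n). C \<subseteq> X}"
  define P where "P C K \<longleftrightarrow> K \<in> T \<and> (\<exists>x. C = conj_class (alt_group n) x \<and> ctype {1..n} x K)" for C K
  have "\<forall>C \<in> \<C>. \<exists>K. P C K"
  proof
    fix C assume C: "C \<in> \<C>"
    then obtain x where x: "C = conj_class (alt_group n) x" by (auto simp: \<C>_def conj_classes_def)
    then have "x \<in> X" using C self_in_conj_class unfolding \<C>_def by blast
    then show "\<exists>K. P C K" using assms(2) x unfolding P_def by blast
  qed
  then obtain f where f: "\<forall>C \<in> \<C>. P C (f C)" by (rule bchoice[THEN exE])
  have "inj_on f \<C>"
  proof (rule inj_onI)
    fix C D assume "C \<in> \<C>" "D \<in> \<C>" and eq: "f C = f D"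
    then have CD: "P C (f C)" "P D (f C)" using f by auto
    then have ns: "nonsplit (f C)" using assms(3) by (simp add: P_def)
    obtain x where x: "C = conj_class (alt_group n) x" "ctype {1..n} x (f C)"
      using CD(1) by (auto simp: P_def)
    obtain y where y: "D = conj_class (alt_group n) y" "ctype {1..n} y (f C)"
      using CD(2) by (auto simp: P_def)
    show "C = D" using nonsplit_conj_class[OF x(2) y(2) ns] x(1) y(1) by simp
  qed
  moreover have "f ` \<C> \<subseteq> T" using f by (auto simp: P_def)
  ultimately show ?thesis unfolding eta_def \<C>_def[symmetric] using assms(1) by (rule card_inj_on_le)
qed

section \<open>Products of disjoint transpositions as cycle types\<close>

lemma pdt_imp_ctype:
  assumes "prod_disjoint_transpositions k p" "p permutes S" "finite S"
  shows "\<exists>j. ctype S p (replicate_mset k 2 + replicate_mset j 1)"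
proof -
  obtain css where css: "length css = k" "\<forall>cs \<in> set css. length cs = 2" "distinct (concat css)"
    "p = perm_of css"
    using assms(1) unfolding prod_disjoint_transpositions_def perm_of_def by blast
  \<comment> \<open>Each point of a listed 2-cycle is moved by \<open>p\<close> and so lies in
    \<open>S\<close>; the other points of \<open>S\<close> are then added as one-element
    cycles.\<close>
  have "x \<in> S" if x: "cs \<in> set css" "x \<in> set cs" for cs x
  proof -
    obtain u v where cs: "cs = [u, v]" using css(2) x(1) by (auto simp: numeral_2_eq_2 length_Suc_conv)
    have "u \<noteq> v" using css(3) x(1) cs by (auto simp: distinct_concat_iff)
    then have "p x \<noteq> x" using perm_of_in[OF css(3) x] css(4) x(2) cs by auto
    then show ?thesis using assms(2) permutes_not_in by metis
  qed
  then have sub: "set (concat css) \<subseteq> S" by auto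
  obtain rs where rs: "set rs = S - set (concat css)" "distinct rs"
    using finite_distinct_list assms(3) by (metis finite_Diff)
  let ?css = "css @ map (\<lambda>x. [x]) rs"
  have "perm_of (map (\<lambda>x. [x]) rs) = id" by (rule perm_of_singletons) auto
  then have "p = perm_of ?css" by (simp add: perm_of_append css(4))
  moreover have cr: "concat (map (\<lambda>x. [x]) rs) = rs" by (induction rs) auto
  have "distinct (concat ?css)" unfolding concat_append cr using css(3) rs by auto
  moreover have "set (concat ?css) = S" unfolding concat_append cr using sub rs(1) by auto
  moreover have "[] \<notin> set ?css" using css(2) by auto
  moreover have "map length css = replicate k 2"
    using css(1,2) by (auto intro!: nth_equalityI)
  then have "map length ?css = replicate k 2 @ replicate (length rs) 1"
    by (simp add: comp_def map_replicate_const)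
  then have "mset (map length ?css) = replicate_mset k 2 + replicate_mset (length rs) 1"
    by (simp only: mset_append mset_replicate)
  ultimately show ?thesis unfolding ctype_def by blast
qed

lemma ctype_imp_pdt:
  assumes "ctype S p (replicate_mset k 2 + replicate_mset j 1)"
  shows "prod_disjoint_transpositions k p"
proof -
  have "mset (replicate k 2 @ replicate j 1) = replicate_mset k 2 + replicate_mset j (1 :: nat)" by simp
  then obtain css where css: "p = perm_of css" "distinct (concat css)"
    "map length css = replicate k 2 @ replicate j 1"
    using ctype_list[of S p "replicate k 2 @ replicate j 1"] assms by metis
  let ?f = "filter (\<lambda>cs. 2 \<le> length cs) css"
  have "map length ?f = filter (\<lambda>l. 2 \<le> l) (map length css)" by (simp add: filter_map comp_def)
  then have m: "map length ?f = replicate k 2" unfolding css(3) by simp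
  then have "length ?f = k" by (metis length_map length_replicate)
  moreover have "\<forall>cs \<in> set ?f. length cs = 2"
  proof
    fix cs assume "cs \<in> set ?f"
    then have "length cs \<in> set (map length ?f)" by simp
    then show "length cs = 2" unfolding m by simp
  qed
  moreover have "distinct (concat ?f)" using css(2) by (induction css) auto
  moreover have "p = perm_of ?f" using perm_of_remove_singletons css(1) by metis
  ultimately show ?thesis unfolding prod_disjoint_transpositions_def perm_of_def by blast
qed

lemma full_type_pdt:
  assumes "full_type n L" "ctype {1..n} p L"
  shows "\<exists>k. prod_disjoint_transpositions k p"
proof -
  obtain k where "L = replicate_mset k 2 \<or> L = add_mset 1 (replicate_mset k 2)"
    using assms(1) by (auto simp: full_type_def)
  then have "L = replicate_mset k 2 + replicate_mset 0 1 \<or> L = replicate_mset k 2 + replicate_mset 1 1"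
    by auto
  then show ?thesis using assms(2) ctype_imp_pdt by metis
qed

text \<open>When \<alpha> is the 3-cycle of an exceptional pair, this makes the premise of the
  second claim of the theorem false.\<close>

lemma three_type_not_pdt:
  assumes "three_type n L" "ctype {1..n} p L"
  shows "\<not> prod_disjoint_transpositions k p"
proof
  assume "prod_disjoint_transpositions k p"
  then obtain j where "ctype {1..n} p (replicate_mset k 2 + replicate_mset j 1)"
    using pdt_imp_ctype ctype_permutes[OF assms(2)] by blast
  then have "L = replicate_mset k 2 + replicate_mset j 1" using ctype_unique assms(2) by blast
  then have "count L 3 = 0" by simp
  then show False using assms(1) by (simp add: three_type_def)
qed

lemma three_type_three_cycles:
  assumes "three_type n L" "ctype {1..n} p L"
  shows "p \<in> three_cycles n"
proof -
  obtain x y z where "distinct [x, y, z]" "{x, y, z} \<subseteq> {1..n}" "p = cycle_of_list [x, y, z]"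
    using ctype_three assms unfolding three_type_def by blast
  then show ?thesis by (intro CollectI exI[of _ "[x, y, z]"]) simp
qed

text \<open>Explicit positions of the 3-cycle give the lower bounds 2 and 4. For odd
  \<open>n\<close> the assumption of fewer than five classes completes the count; for even
  \<open>n\<close> the upper bound 2 comes from \<open>involution_three\<close>.\<close>

lemma full_three_eta:
  assumes "n \<ge> 6" "a \<in> even_perms n" "b \<in> even_perms n" "ctype {1..n} a L" "ctype {1..n} b M"
    and "full_type n L" "three_type n M" "eta (alt_group n) (class_prod n a b) < 5"
  shows "4 dvd n \<and> prod_disjoint_transpositions (n div 2) a \<and>
      eta (alt_group n) (class_prod n a b) = 2 \<or>
    4 dvd (n - 1) \<and> prod_disjoint_transpositions ((n - 1) div 2) a \<and>
      eta (alt_group n) (class_prod n a b) = 4"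
proof -
  have n2: "n \<ge> 2" using assms(1) by simp
  have pt: "partition_of n L" "partition_of n M" using assms(4,5) by (auto intro: ctype_part)
  have M: "M = add_mset 3 (replicate_mset (n - 3) 1)" using assms(7) by (simp add: three_type_def)
  obtain k where k: "even k" "n = 2 * k \<and> L = replicate_mset k 2 \<or>
      n = Suc (2 * k) \<and> L = add_mset 1 (replicate_mset k 2)"
    using assms(6) by (auto simp: full_type_def)
  have "n = 2 * k \<or> n = Suc (2 * k)" using k(2) by blast
  \<comment> \<open>\<open>k = 2\<close> would mean four or five points, and 3 is odd.\<close>
  then have k4: "4 \<le> k" using k(1) assms(1) by presburger
  have ns: "nonsplit L" using k(2) k4 unfolding nonsplit_def by (intro bexI[of _ 2]) auto
  have lower: "card T \<le> eta (alt_group n) (class_prod n a b)" if "T \<subseteq> product_types n L M" "finite T" for T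
    using ptypes_class_prod[OF n2 assms(4,5)] that ns
    by (intro ctypes_le_eta[OF assms(2,3)]) blast+
  from k(2) show ?thesis
  proof
    assume n: "n = 2 * k \<and> L = replicate_mset k 2"
    have "has_pattern [2, 2, 2] L"
      using n k4 by (intro mpatI[of 2] mset_subset_eqI) auto
    moreover have "has_pattern [3, 1, 1, 1] M"
      unfolding M using n k4 by (intro mpatI[of 3] mset_subset_eqI) auto
    ultimately obtain T where T: "T \<subseteq> product_types n L M" "finite T" "card T = 2"
      using core_ptypes[OF core_2 _ _ pt] by auto
    then have "2 \<le> eta (alt_group n) (class_prod n a b)" using lower by metis
    moreover have "eta (alt_group n) (class_prod n a b) \<le> 2"
    proof -
      let ?T = "{add_mset 1 (add_mset 3 (replicate_mset (k - 2) 2)),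
        add_mset 6 (replicate_mset (k - 3) 2)} :: nat multiset set"
      have "eta (alt_group n) (class_prod n a b) \<le> card ?T"
      proof (rule eta_le_card)
        fix x assume "x \<in> class_prod n a b"
        then obtain u v where x: "x = conj_by u a \<circ> conj_by v b" "u permutes {1..n}" "v permutes {1..n}"
          by (auto simp: class_prod_def even_perms_def)
        have "ctype {1..n} (conj_by u a) (replicate_mset k 2)"
          using ctype_cj[OF assms(4) x(2)] n by simp
        moreover have "ctype {1..n} (conj_by v b) (add_mset 3 (replicate_mset (n - 3) 1))"
          using ctype_cj[OF assms(5) x(3)] M by simp
        ultimately show "\<exists>K \<in> ?T. ctype {1..n} x K" unfolding x(1) using involution_three by blast
      next
        fix K assume K: "K \<in> ?T"
        \<comment> \<open>Since \<open>k\<close> is at least 4, a 2-cycle survives in either type;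
          neither class splits, and two types mean at most two classes.\<close>
        then have "2 \<in># K" using k4 by auto
        then show "nonsplit K" unfolding nonsplit_def by (intro bexI[of _ 2]) auto
      qed simp
      also have "\<dots> \<le> 2" by (simp add: card_insert_if)
      finally show ?thesis .
    qed
    moreover have "prod_disjoint_transpositions k a"
      using ctype_imp_pdt[of "{1..n}" a k 0] assms(4) n by simp
    moreover have "4 dvd n" "n div 2 = k" using n k(1) by auto
    ultimately show ?thesis by simp
  next
    assume n: "n = Suc (2 * k) \<and> L = add_mset 1 (replicate_mset k 2)"
    have "has_pattern [2, 2, 2, 1] L"
      using n k4 by (intro mpatI[of 2] mset_subset_eqI) auto
    moreover have "has_pattern [3, 1, 1, 1, 1] M"
      unfolding M using n k4 by (intro mpatI[of 3] mset_subset_eqI) auto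
    ultimately obtain T where T: "T \<subseteq> product_types n L M" "finite T" "card T = 4"
      using core_ptypes[OF core_4 _ _ pt] by auto
    then have "4 \<le> eta (alt_group n) (class_prod n a b)" using lower by metis
    moreover have "prod_disjoint_transpositions k a"
      using ctype_imp_pdt[of "{1..n}" a k 1] assms(4) n by simp
    moreover have "4 dvd (n - 1)" "(n - 1) div 2 = k" using n k(1) by auto
    ultimately show ?thesis using assms(8) by simp
  qed
qed

theorem theorem1:
  fixes n :: nat and \<alpha> \<beta> :: "nat \<Rightarrow> nat"
  defines "A \<equiv> alt_group n"
  assumes "n \<ge> 6"
    and "\<alpha> \<in> carrier A" "\<alpha> \<noteq> \<one>\<^bsub>A\<^esub>"
    and "\<beta> \<in> carrier A" "\<beta> \<noteq> \<one>\<^bsub>A\<^esub>"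
    and "eta A (conj_class A \<alpha> <#>\<^bsub>A\<^esub> conj_class A \<beta>) < 5"
  shows "((\<exists>k. prod_disjoint_transpositions k \<alpha>) \<or> (\<exists>k. prod_disjoint_transpositions k \<beta>)) \<and>
    ((\<exists>k. prod_disjoint_transpositions k \<alpha>) \<longrightarrow>
       (4 dvd n \<and> prod_disjoint_transpositions (n div 2) \<alpha> \<and> \<beta> \<in> three_cycles n \<and>
          eta A (conj_class A \<alpha> <#>\<^bsub>A\<^esub> conj_class A \<beta>) = 2) \<or>
       (4 dvd (n - 1) \<and> prod_disjoint_transpositions ((n - 1) div 2) \<alpha> \<and> \<beta> \<in> three_cycles n \<and>
          eta A (conj_class A \<alpha> <#>\<^bsub>A\<^esub> conj_class A \<beta>) = 4))"
proof -
  have ab: "\<alpha> \<in> even_perms n" "\<beta> \<in> even_perms n" and ne: "\<alpha> \<noteq> id" "\<beta> \<noteq> id"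
    using assms(3-6) unfolding A_def carrier_alt_group alt_group_one by blast+
  have eta: "eta A (conj_class A \<alpha> <#>\<^bsub>A\<^esub> conj_class A \<beta>) = eta (alt_group n) (class_prod n \<alpha> \<beta>)"
    unfolding A_def set_mult_alt ..
  have lt: "eta (alt_group n) (class_prod n \<alpha> \<beta>) < 5" using assms(7) unfolding eta .
  obtain L where L: "ctype {1..n} \<alpha> L"
    using ctype_exists[of \<alpha> "{1..n}"] ab(1) by (auto simp: even_perms_def)
  obtain M where M: "ctype {1..n} \<beta> M"
    using ctype_exists[of \<beta> "{1..n}"] ab(2) by (auto simp: even_perms_def)
  have "L \<noteq> replicate_mset n 1" "M \<noteq> replicate_mset n 1" using L M ne ctype_ones by blast+
  then consider "three_type n L" "full_type n M" | "full_type n L" "three_type n M"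
    using eta_ge_five[OF assms(2) ab L M] lt by linarith
  then show ?thesis
  proof cases
    case 1
    then show ?thesis using full_type_pdt[OF _ M] three_type_not_pdt[OF _ L] by blast
  next
    case 2
    then show ?thesis
      using full_type_pdt[OF 2(1) L] three_type_three_cycles[OF 2(2) M]
        full_three_eta[OF assms(2) ab L M 2 lt] unfolding eta by blast
  qed
qed

end
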